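(* Let $p\in(0,1)$, $p\neq 7/8$. Then $\Gamma_n\to\Gamma^{(p)}$ almost surely for some random vector $\Gamma^{(p)}$. For $p<7/8$, $\Gamma^{(p)}=\gamma_0:=(1/3,1/3)^\top$ almost surely. For $p>7/8$, $\Gamma^{(p)}$ takes the values $\gamma_p$ and $\bar\gamma_p$, where $$\gamma_p=\Big(\tfrac{8p^2-10p+3+\sqrt{32p^2-52p+21}}{2(2p-1)^2},\ \tfrac{8p^2-10p+3-\sqrt{32p^2-52p+21}}{2(2p-1)^2}\Big)^\top$$ and $\bar\gamma_p$ is obtained from $\gamma_p$ by replacing $\sqrt{32p^2-52p+21}$ with $-\sqrt{32p^2-52p+21}$. Moreover, for each $\gamma$ in the support of $\Gamma^{(p)}$, on the event $\{\Gamma^{(p)}=\gamma\}$, $$\mathbb E\big(e_{n+1}e_{n+1}^\top\mid\mathcal G_n\big)\xrightarrow{\text{a.s.}}\sigma(\gamma):=\begin{pmatrix}\gamma_1-\gamma_1^2&-\gamma_1\gamma_2\\-\gamma_1\gamma_2&\gamma_2-\gamma_2^2\end{pmatrix}.$$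
   Context: A random variable is $\mathrm{Rad}(q)$ if it equals $+1$ with probability $q$ and $-1$ with probability $1-q$. Random walk with two memory channels with parameter $p\in(0,1)$: $S_0=0$; $X_1,X_2$ are i.i.d. $\mathrm{Rad}(1/2)$; for each $n\ge 2$, let $U_{1,n+1},U_{2,n+1}$ be i.i.d. uniform on $\{1,\dots,n\}$ and $\alpha_{1,n+1},\alpha_{2,n+1}$ i.i.d. $\mathrm{Rad}(p)$, all mutually independent and independent of $X_1,\dots,X_n$ (and earlier draws); $T_{n+1}=\alpha_{1,n+1}X_{U_{1,n+1}}+\alpha_{2,n+1}X_{U_{2,n+1}}$, $X_{n+1}=\max(-1,\min(1,T_{n+1}))$, $S_n=X_1+\dots+X_n$. $S_n^{\pm}$ denotes the number of $\pm1$ steps among $X_1,\dots,X_n$, and $\Gamma_n=(S_n^+/n,\,S_n^-/n)^\top$. $\mathcal G_n=\sigma(\Gamma_1,\dots,\Gamma_n)$. Let $h_p(x)=\big(((1-p)x_1+px_2-1)^2-(1-x_1-x_2)^2-x_1,\ ((1-p)x_2+px_1-1)^2-(1-x_1-x_2)^2-x_2\big)^\top$ for $x\in[0,1]^2$, and for $n\ge2$, $e_{n+1}=(n+1)(\Gamma_{n+1}-\Gamma_n)-h_p(\Gamma_n)$. *)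

theory Defs
  imports "HOL-Probability.Probability"
begin

text \<open>Sources of randomness of the walk with two memory channels.
  Init k : the initial step X_k (k = 1,2);
  Unif1 m, Unif2 m : the uniform indices U_{1,m}, U_{2,m} (m \<ge> 3);
  Alpha1 m, Alpha2 m : the signs alpha_{1,m}, alpha_{2,m} (m \<ge> 3).\<close>
datatype src = Init nat | Unif1 nat | Unif2 nat | Alpha1 nat | Alpha2 nat

definition used_src :: "src set" where
  "used_src = {Init 1, Init 2} \<union> (\<Union>m\<in>{3..}. {Unif1 m, Unif2 m, Alpha1 m, Alpha2 m})"

definition rad :: "real \<Rightarrow> int pmf" where
  "rad q = map_pmf (\<lambda>b. if b then 1 else -1) (bernoulli_pmf q)"

definition clip :: "int \<Rightarrow> int" where
  "clip t = max (-1) (min 1 t)"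

text \<open>History of the walk: hist xi n w k = X_k(w) for 1 \<le> k \<le> n.\<close>
primrec hist :: "(src \<Rightarrow> 'a \<Rightarrow> int) \<Rightarrow> nat \<Rightarrow> 'a \<Rightarrow> nat \<Rightarrow> int" where
  "hist xi 0 w = (\<lambda>_. 0)"
| "hist xi (Suc n) w =
     (let h = hist xi n w in
      h(Suc n := (if Suc n \<le> 2 then xi (Init (Suc n)) w
                  else clip (xi (Alpha1 (Suc n)) w * h (nat (xi (Unif1 (Suc n)) w))
                           + xi (Alpha2 (Suc n)) w * h (nat (xi (Unif2 (Suc n)) w))))))"

definition stepX :: "(src \<Rightarrow> 'a \<Rightarrow> int) \<Rightarrow> nat \<Rightarrow> 'a \<Rightarrow> int" where
  "stepX xi n w = hist xi n w n"

definition Gam :: "(src \<Rightarrow> 'a \<Rightarrow> int) \<Rightarrow> nat \<Rightarrow> 'a \<Rightarrow> real \<times> real" where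
  "Gam xi n w = (real (card {k\<in>{1..n}. stepX xi k w = 1}) / real n,
                 real (card {k\<in>{1..n}. stepX xi k w = -1}) / real n)"

definition hp :: "real \<Rightarrow> real \<times> real \<Rightarrow> real \<times> real" where
  "hp p x = (((1-p) * fst x + p * snd x - 1)^2 - (1 - fst x - snd x)^2 - fst x,
             ((1-p) * snd x + p * fst x - 1)^2 - (1 - fst x - snd x)^2 - snd x)"

text \<open>err xi p n = e_{n+1} = (n+1)(Gamma_{n+1} - Gamma_n) - h_p(Gamma_n).\<close>
definition err :: "(src \<Rightarrow> 'a \<Rightarrow> int) \<Rightarrow> real \<Rightarrow> nat \<Rightarrow> 'a \<Rightarrow> real \<times> real" where
  "err xi p n w = (let g = Gam xi n w; g' = Gam xi (Suc n) w; h = hp p g in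
     (real (Suc n) * (fst g' - fst g) - fst h, real (Suc n) * (snd g' - snd g) - snd h))"

definition filt :: "'a measure \<Rightarrow> (src \<Rightarrow> 'a \<Rightarrow> int) \<Rightarrow> nat \<Rightarrow> 'a measure" where
  "filt M xi n = sigma (space M)
     {Gam xi k -` A \<inter> space M | k A. k \<in> {1..n} \<and> A \<in> sets (borel :: (real \<times> real) measure)}"

definition gamma_p :: "real \<Rightarrow> real \<times> real" where
  "gamma_p p = (let s = sqrt (32*p^2 - 52*p + 21); d = 2 * (2*p - 1)^2 in
     ((8*p^2 - 10*p + 3 + s) / d, (8*p^2 - 10*p + 3 - s) / d))"

definition gamma_bar_p :: "real \<Rightarrow> real \<times> real" where
  "gamma_bar_p p = (let s = - sqrt (32*p^2 - 52*p + 21); d = 2 * (2*p - 1)^2 in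
     ((8*p^2 - 10*p + 3 + s) / d, (8*p^2 - 10*p + 3 - s) / d))"

definition sig11 :: "real \<times> real \<Rightarrow> real" where "sig11 g = fst g - (fst g)^2"
definition sig12 :: "real \<times> real \<Rightarrow> real" where "sig12 g = - fst g * snd g"
definition sig22 :: "real \<times> real \<Rightarrow> real" where "sig22 g = snd g - (snd g)^2"

end

theory Submission
  imports Defs
begin

text \<open>
  With \<open>c = 2 * p - 1\<close>, \<open>u = (S\<^sup>+ + S\<^sup>-) / n\<close> and \<open>v = (S\<^sup>+ - S\<^sup>-) / n\<close>, the walk is a stochastic
  approximation of the flow \<open>u' = u - 3/2 * u\<^sup>2 + c\<^sup>2 * v\<^sup>2 / 2\<close>, \<open>v' = v * (c * (2 - u) - 1)\<close>.
  If a nonnegative functional of the walk has drift at most \<open>- D / n\<close> plus a summable error, then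
  \<open>D / n\<close> is almost surely summable, and as \<open>D\<close> changes by \<open>O(1 / n)\<close> per step, \<open>D\<close> tends to 0; no
  martingale convergence theorem is needed.

  The functional \<open>(max 0 (1/2 - u))\<^sup>2\<close> and the bound \<open>E (1 / u) \<le> 9/2\<close> show that eventually \<open>u \<ge> 1/3\<close>.
  For \<open>p < 7/8\<close> a quadratic functional centred at \<open>(2/3, 0)\<close> then decreases. For \<open>p > 7/8\<close> the flow has
  the Lyapunov function \<open>(u - u*)\<^sup>2 + c / 2 * (v\<^sup>2 - v*\<^sup>2 * ln (v\<^sup>2))\<close>, infinite on the stable manifold
  \<open>v = 0\<close> of the unstable equilibrium. Regularising the logarithm on the diffusive scale
  \<open>v \<approx> 1 / sqrt n\<close>, where the noise pushes the walk away from \<open>v = 0\<close>, keeps the drift inequality, which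
  excludes the unstable limit. The law of the walk is invariant under a global change of sign,
  so both stable limits have probability \<open>1/2\<close>.
\<close>

section \<open>Sums of drifts and slowly varying sequences\<close>

text \<open>In the region \<open>0 \<le> u \<le> 1\<close>, \<open>\<bar>v\<bar> \<le> u\<close> the
  flow rests at the origin, at \<open>(2/3, 0)\<close> and, exactly for \<open>c > 3/4\<close>, at
  two further points that differ in the sign of \<open>v\<close>. Near \<open>(2/3, 0)\<close> the
  coordinate \<open>v\<close> grows at rate \<open>4/3 * c - 1\<close>, whose sign changes at
  \<open>p = 7/8\<close>. A fixed smooth functional has no drift of order \<open>1 / n\<close> at a
  rest point, so it cannot exclude an unstable one; a logarithm that is infinite there can, but its
  second-order term must be controlled where \<open>v\<close> has size \<open>1 / sqrt n\<close>.
  The bound \<open>u \<ge> 1/3\<close> keeps both the damping of \<open>u\<close> and the variance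
  of a step away from 0.

  A path of given length takes almost surely finitely many values, so the drift inequalities are
  pointwise inequalities for functions of an integer list, integrated by
  \<open>expectation_one_step\<close>. Conditional expectations occur only in the last claim:
  \<open>h_p(Gamma_n) + Gamma_n\<close> is the pair of conditional probabilities of the steps 1 and
  -1, so \<open>e_{n+1}\<close> is a pair of centred disjoint indicators and its conditional second
  moments are explicit in \<open>Gamma_n\<close>.\<close>

lemma slow_variation_tendsto_0:
  fixes D :: "nat \<Rightarrow> real"
  assumes nonneg: "\<And>n. 0 \<le> D n"
    and var: "\<And>n. \<bar>D (Suc n) - D n\<bar> \<le> C / real (Suc n)"
    and sum: "summable (\<lambda>n. D n / real (Suc n))"
  shows "D \<longlonglongrightarrow> 0"
proof -
  have C0: "0 \<le> C" using var[of 0] by simp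
  \<comment> \<open>\<open>D\<close> need not be monotone. The increments of its square are
    dominated by a summable sequence, so the telescoping series converges absolutely.\<close>
  have bound: "norm ((D (Suc n))\<^sup>2 - (D n)\<^sup>2) \<le> 2 * C * (D n / real (Suc n)) + C\<^sup>2 * (1 / real (Suc n) ^ 2)" for n
  proof -
    have "norm ((D (Suc n))\<^sup>2 - (D n)\<^sup>2) = \<bar>D (Suc n) - D n\<bar> * (D (Suc n) + D n)"
      using nonneg[of n] nonneg[of "Suc n"] by (simp add: square_diff_square_factored power2_eq_square abs_mult)
    also have "\<dots> \<le> (C / real (Suc n)) * (2 * D n + C / real (Suc n))"
      using var[of n] nonneg[of n] nonneg[of "Suc n"] C0 by (intro mult_mono) auto
    also have "\<dots> = 2 * C * (D n / real (Suc n)) + C\<^sup>2 * (1 / real (Suc n) ^ 2)"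
      by (simp add: power2_eq_square algebra_simps del: of_nat_Suc)
    finally show ?thesis .
  qed
  have "summable (\<lambda>n. 1 / real (Suc n) ^ 2)"
    using inverse_power_summable[of 2, where 'a = real] by (subst summable_Suc_iff) (simp add: inverse_eq_divide)
  then have "summable (\<lambda>n. (D (Suc n))\<^sup>2 - (D n)\<^sup>2)"
    by (intro summable_comparison_test'[OF _ bound] summable_add summable_mult sum)
  then have "convergent (\<lambda>n. \<Sum>i<n. (D (Suc i))\<^sup>2 - (D i)\<^sup>2)"
    by (simp add: summable_iff_convergent)
  then obtain l where "(\<lambda>n. (D n)\<^sup>2 - (D 0)\<^sup>2) \<longlonglongrightarrow> l"
    unfolding convergent_def sum_lessThan_telescope[of "\<lambda>i. (D i)\<^sup>2"] by blast
  from tendsto_add[OF this tendsto_const[of "(D 0)\<^sup>2"]]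
  have "(\<lambda>n. (D n)\<^sup>2) \<longlonglongrightarrow> l + (D 0)\<^sup>2" by simp
  from tendsto_real_sqrt[OF this] nonneg
  have lim: "D \<longlonglongrightarrow> sqrt (l + (D 0)\<^sup>2)" by simp
  define r where "r = sqrt (l + (D 0)\<^sup>2)"
  have "r \<ge> 0" using lim nonneg unfolding r_def by (intro LIMSEQ_le_const[OF lim]) auto
  \<comment> \<open>A positive limit would bound the harmonic series by a multiple of the given
    convergent one.\<close>
  moreover have "\<not> r > 0"
  proof
    assume r: "r > 0"
    have "\<forall>\<^sub>F n in sequentially. D n > r / 2"
      using order_tendstoD(1)[OF lim[folded r_def], of "r/2"] r by simp
    then have "\<forall>\<^sub>F n in sequentially. norm (1 / real (Suc n)) \<le> (2 / r) * (D n / real (Suc n))"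
    proof eventually_elim
      case (elim n)
      then have "1 / real (Suc n) \<le> (2 / r * D n) / real (Suc n)"
        using r by (intro divide_right_mono) (auto simp: field_simps)
      then show ?case by simp
    qed
    then have "summable (\<lambda>n. 1 / real (Suc n))"
      by (rule summable_comparison_test_ev) (intro summable_mult sum)
    then have "summable (\<lambda>n. inverse (real n))"
      by (subst (asm) summable_Suc_iff) (simp add: inverse_eq_divide)
    then show False using not_summable_harmonic[where 'a = real] by simp
  qed
  ultimately show ?thesis using lim unfolding r_def by simp
qed

text \<open>Only unconditional means enter: the drift inequality telescopes to a bound on the sum of
  the means of \<open>d n\<close>, and monotone convergence turns this into almost sure
  summability.\<close>

lemma (in prob_space) AE_summable_drift:
  fixes Y d :: "nat \<Rightarrow> 'a \<Rightarrow> real" and c :: "nat \<Rightarrow> real"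
  assumes Y: "\<And>n. expectation (Y n) \<ge> 0"
    and d: "\<And>n. integrable M (d n)" "\<And>n. AE w in M. 0 \<le> d n w"
    and step: "\<And>n. expectation (Y (Suc n)) \<le> expectation (Y n) - expectation (d n) + c n"
    and c: "summable c" "\<And>n. 0 \<le> c n"
  shows "AE w in M. summable (\<lambda>n. d n w)"
proof -
  have le: "expectation (Y N) + (\<Sum>n<N. expectation (d n)) \<le> expectation (Y 0) + (\<Sum>n<N. c n)" for N
  proof (induction N)
    case (Suc N)
    then show ?case using step[of N] by simp
  qed simp
  have d0: "0 \<le> expectation (d n)" for n using d(2) by (rule integral_nonneg_AE)
  have "summable (\<lambda>n. expectation (d n))"
  proof (rule summableI_nonneg_bounded)
    show "(\<Sum>n<N. expectation (d n)) \<le> expectation (Y 0) + suminf c" for N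
      using le[of N] Y[of N] sum_le_suminf[OF c(1), of "{..<N}"] c(2) by simp
  qed (rule d0)
  then have fin: "(\<Sum>n. ennreal (expectation (d n))) \<noteq> top"
    using suminf_ennreal2[of "\<lambda>n. expectation (d n)"] d0 by (metis ennreal_neq_top)
  have "(\<integral>\<^sup>+w. (\<Sum>n. ennreal (d n w)) \<partial>M) = (\<Sum>n. \<integral>\<^sup>+w. ennreal (d n w) \<partial>M)"
    using d(1) by (intro nn_integral_suminf) auto
  also have "\<dots> = (\<Sum>n. ennreal (expectation (d n)))"
    using d by (intro suminf_cong nn_integral_eq_integral) auto
  finally have "(\<integral>\<^sup>+w. (\<Sum>n. ennreal (d n w)) \<partial>M) \<noteq> \<infinity>" using fin by simp
  then have "AE w in M. (\<Sum>n. ennreal (d n w)) \<noteq> \<infinity>"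
    using d(1) by (intro nn_integral_PInf_AE) auto
  moreover have "AE w in M. \<forall>n. 0 \<le> d n w" using d(2) by (simp add: AE_all_countable)
  ultimately show ?thesis
    by eventually_elim (auto intro!: summable_suminf_not_top)
qed

section \<open>Drift inequalities\<close>

text \<open>The mean of \<open>F X\<close> for a \<open>{-1, 0, 1}\<close>-valued \<open>X\<close> with mean \<open>m\<close> and second moment \<open>q\<close>.\<close>

definition tmean :: "real \<Rightarrow> real \<Rightarrow> (int \<Rightarrow> real) \<Rightarrow> real" where
  "tmean q m F = (q + m) / 2 * F 1 + (q - m) / 2 * F (-1) + (1 - q) * F 0"

lemma tmean_mono:
  assumes "\<bar>m\<bar> \<le> q" "q \<le> 1" "\<And>x. x \<in> {-1, 0, 1} \<Longrightarrow> F x \<le> G x"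
  shows "tmean q m F \<le> tmean q m G"
  unfolding tmean_def using assms by (intro add_mono mult_left_mono) auto

lemma tmean_linear:
  "tmean q m (\<lambda>x. F x + G x) = tmean q m F + tmean q m G"
  "tmean q m (\<lambda>x. F x - G x) = tmean q m F - tmean q m G"
  "tmean q m (\<lambda>x. a * F x) = a * tmean q m F"
  "tmean q m (\<lambda>x. F x * a) = tmean q m F * a"
  "tmean q m (\<lambda>x. F x / a) = tmean q m F / a"
  "tmean q m (\<lambda>_. a) = a"
  by (simp_all add: tmean_def algebra_simps add_divide_distrib diff_divide_distrib)

section \<open>Taylor bounds and one-step estimates\<close>

lemma ln_one_plus_cubic_bound:
  fixes z :: real
  assumes "\<bar>z\<bar> \<le> 1 / 2"
  shows "z - z\<^sup>2 / 2 - \<bar>z\<bar> ^ 3 \<le> ln (1 + z)"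
proof (cases "z \<ge> 0")
  case True
  let ?h = "\<lambda>z. ln (1 + z) - z + z\<^sup>2 / (2::real)"
  have "?h 0 \<le> ?h z"
  proof (rule DERIV_nonneg_imp_nondecreasing[OF True])
    fix x :: real assume x: "0 \<le> x" "x \<le> z"
    have "(?h has_real_derivative (1 / (1 + x) - 1 + x)) (at x)"
      using x by (auto intro!: derivative_eq_intros)
    moreover have "0 \<le> 1 / (1 + x) - 1 + x" using x by (simp add: field_simps)
    ultimately show "\<exists>y. (?h has_real_derivative y) (at x) \<and> 0 \<le> y" by blast
  qed
  moreover have "0 \<le> \<bar>z\<bar> ^ 3" by simp
  ultimately have "z - z\<^sup>2 / 2 \<le> ln (1 + z)" "0 \<le> \<bar>z\<bar> ^ 3" by simp_all
  then show ?thesis by linarith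
next
  case False
  let ?h = "\<lambda>z. ln (1 + z) - z + z\<^sup>2 / (2::real) - z ^ 3"
  have "?h 0 \<le> ?h z"
  proof (rule DERIV_nonpos_imp_nonincreasing[of z 0])
    fix x :: real assume x: "z \<le> x" "x \<le> 0"
    then have x1: "1 + x \<ge> 1/2" using assms by simp
    have "(?h has_real_derivative (1 / (1 + x) - 1 + x - 3 * x\<^sup>2)) (at x)"
      using x x1 by (auto intro!: derivative_eq_intros simp: eval_nat_numeral)
    moreover have "1 / (1 + x) - 1 + x - 3 * x\<^sup>2 = x\<^sup>2 * (1 / (1 + x) - 3)"
      using x1 by (simp add: field_simps power2_eq_square)
    moreover have "x\<^sup>2 * (1 / (1 + x) - 3) \<le> 0"
      using x1 by (intro mult_nonneg_nonpos) (auto simp: field_simps)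
    ultimately show "\<exists>y. (?h has_real_derivative y) (at x) \<and> y \<le> 0" by auto
  qed (use False in simp)
  moreover have "\<bar>z\<bar> ^ 3 = - (z ^ 3)" using False by simp
  ultimately show ?thesis by simp
qed

lemma inverse_one_plus_cubic_bound:
  fixes z :: real
  assumes "\<bar>z\<bar> \<le> 1 / 2"
  shows "1 / (1 + z) \<le> 1 - z + z\<^sup>2 + 2 * \<bar>z\<bar> ^ 3"
proof -
  have z: "1 + z \<ge> 1/2" using assms by simp
  have "1 / (1 + z) = 1 - z + z\<^sup>2 + (- (z ^ 3)) * (1 / (1 + z))"
    using z by (simp add: field_simps power2_eq_square power3_eq_cube)
  also have "(- (z ^ 3)) * (1 / (1 + z)) \<le> \<bar>z\<bar> ^ 3 * 2"
  proof (rule mult_mono)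
    show "- (z ^ 3) \<le> \<bar>z\<bar> ^ 3" by (metis abs_ge_minus_self power_abs)
  qed (use z in \<open>auto simp: field_simps\<close>)
  finally show ?thesis by simp
qed

text \<open>Moments up to order 2 are exact, so a one-step mean can be estimated by bounding the
  integrand by a quadratic in \<open>x\<close>. The next lemmas and \<open>Psi_drift\<close> all
  proceed this way.\<close>

lemma tmean_quadratic: "tmean q m (\<lambda>x. A + B * real_of_int x + C * (real_of_int x)\<^sup>2) = A + B * m + C * q"
  by (simp add: tmean_def field_simps)

lemma tmean_square_step:
  fixes h u a q m :: real
  assumes "0 \<le> u" "u \<le> 1" "\<bar>m\<bar> \<le> q" "q \<le> 1"
  shows "tmean q m (\<lambda>x. (u + ((real_of_int x)\<^sup>2 - u) * h - a)\<^sup>2)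
           \<le> (u - a)\<^sup>2 + 2 * (u - a) * (q - u) * h + h\<^sup>2"
proof -
  have "tmean q m (\<lambda>x. (u + ((real_of_int x)\<^sup>2 - u) * h - a)\<^sup>2)
        \<le> tmean q m (\<lambda>x. ((u - a)\<^sup>2 - 2 * (u - a) * u * h + h\<^sup>2) + 0 * real_of_int x
                            + (2 * (u - a) * h) * (real_of_int x)\<^sup>2)"
  proof (rule tmean_mono)
    fix x :: int assume x: "x \<in> {-1, 0, 1}"
    have "\<bar>(real_of_int x)\<^sup>2 - u\<bar> \<le> 1" using x assms by auto
    then have "((real_of_int x)\<^sup>2 - u)\<^sup>2 * h\<^sup>2 \<le> 1 * h\<^sup>2"
      by (intro mult_right_mono) (simp_all add: abs_square_le_1)
    then show "(u + ((real_of_int x)\<^sup>2 - u) * h - a)\<^sup>2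
        \<le> ((u - a)\<^sup>2 - 2 * (u - a) * u * h + h\<^sup>2) + 0 * real_of_int x
                            + (2 * (u - a) * h) * (real_of_int x)\<^sup>2"
      by (simp add: power2_eq_square algebra_simps)
  qed (use assms in auto)
  then show ?thesis by (simp only: tmean_quadratic) (simp add: algebra_simps)
qed

lemma tmean_square_step':
  fixes h v q m :: real
  assumes "\<bar>v\<bar> \<le> 1" "\<bar>m\<bar> \<le> q" "q \<le> 1"
  shows "tmean q m (\<lambda>x. (v + (real_of_int x - v) * h)\<^sup>2) \<le> v\<^sup>2 + 2 * v * (m - v) * h + 4 * h\<^sup>2"
proof -
  have "tmean q m (\<lambda>x. (v + (real_of_int x - v) * h)\<^sup>2)
        \<le> tmean q m (\<lambda>x. (v\<^sup>2 - 2 * v * v * h + 4 * h\<^sup>2) + (2 * v * h) * real_of_int x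
                            + 0 * (real_of_int x)\<^sup>2)"
  proof (rule tmean_mono)
    fix x :: int assume x: "x \<in> {-1, 0, 1}"
    have "\<bar>real_of_int x - v\<bar> \<le> 2" using x assms by auto
    then have "(real_of_int x - v)\<^sup>2 \<le> 2\<^sup>2" using abs_le_square_iff[of "real_of_int x - v" 2] by simp
    then have "(real_of_int x - v)\<^sup>2 * h\<^sup>2 \<le> 4 * h\<^sup>2"
      by (intro mult_right_mono) simp_all
    then show "(v + (real_of_int x - v) * h)\<^sup>2
        \<le> (v\<^sup>2 - 2 * v * v * h + 4 * h\<^sup>2) + (2 * v * h) * real_of_int x + 0 * (real_of_int x)\<^sup>2"
      by (simp add: power2_eq_square algebra_simps)
  qed (use assms in auto)
  then show ?thesis by (simp only: tmean_quadratic) (simp add: algebra_simps)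
qed

text \<open>A lower bound, because \<open>lyap\<close> subtracts this product. The factor
  \<open>v\<^sup>2 - w\<close> occurs only in terms of order at most one in \<open>h\<close>, which
  are kept exactly; hence the error does not depend on \<open>w\<close>.\<close>

lemma tmean_mixed_step:
  fixes h u v U w q m :: real
  assumes "0 \<le> u" "u \<le> 1" "0 \<le> U" "U \<le> 1" "\<bar>v\<bar> \<le> 1" "\<bar>m\<bar> \<le> q" "q \<le> 1" "0 \<le> h" "h \<le> 1"
  shows "(u - U) * (v\<^sup>2 - w) + ((q - u) * (v\<^sup>2 - w) + 2 * (u - U) * v * (m - v)) * h - 12 * h\<^sup>2
    \<le> tmean q m (\<lambda>x. (u + ((real_of_int x)\<^sup>2 - u) * h - U) * ((v + (real_of_int x - v) * h)\<^sup>2 - w))"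
proof -
  let ?A = "(u - U) * (v\<^sup>2 - w) - (u * (v\<^sup>2 - w) + 2 * (u - U) * v * v) * h - 12 * h\<^sup>2"
  let ?B = "2 * (u - U) * v * h" and ?C = "(v\<^sup>2 - w) * h"
  have "tmean q m (\<lambda>x. ?A + ?B * real_of_int x + ?C * (real_of_int x)\<^sup>2) \<le>
     tmean q m (\<lambda>x. (u + ((real_of_int x)\<^sup>2 - u) * h - U) * ((v + (real_of_int x - v) * h)\<^sup>2 - w))"
  proof (rule tmean_mono)
    fix x :: int assume x: "x \<in> {-1, 0, 1}"
    define a where "a = ((real_of_int x)\<^sup>2 - u)"
    define b where "b = real_of_int x - v"
    have a: "\<bar>a\<bar> \<le> 1" using x assms by (auto simp: a_def)
    have b: "\<bar>b\<bar> \<le> 2" using x assms by (auto simp: b_def)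
    have b2: "\<bar>b\<^sup>2\<bar> \<le> 4" using b power_mono[of "\<bar>b\<bar>" 2 2] by simp
    have "\<bar>(u - U) * b\<^sup>2\<bar> \<le> 1 * 4" unfolding abs_mult using assms b2 by (intro mult_mono) auto
    moreover have "\<bar>a * (2 * v * b)\<bar> \<le> 1 * (2 * 1 * 2)"
      unfolding abs_mult using assms a b by (intro mult_mono) auto
    moreover have "\<bar>a * (b\<^sup>2 * h)\<bar> \<le> 1 * (4 * 1)"
      unfolding abs_mult using assms a b2 by (intro mult_mono) auto
    \<comment> \<open>12 = 4 + 4 + 4: two terms of second order in \<open>h\<close> and one of third
      order, reduced by \<open>h \<le> 1\<close>.\<close>
    ultimately have "-12 \<le> (u - U) * b\<^sup>2 + a * (2 * v * b) + a * (b\<^sup>2 * h)" by linarith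
    then have "-12 * h\<^sup>2 \<le> ((u - U) * b\<^sup>2 + a * (2 * v * b) + a * (b\<^sup>2 * h)) * h\<^sup>2"
      by (intro mult_right_mono) auto
    moreover have "(u + a * h - U) * ((v + b * h)\<^sup>2 - w) = (u - U) * (v\<^sup>2 - w) + a * h * (v\<^sup>2 - w)
       + (u - U) * 2 * v * b * h + ((u - U) * b\<^sup>2 + a * (2 * v * b) + a * (b\<^sup>2 * h)) * h\<^sup>2"
      by (simp add: power2_eq_square algebra_simps)
    ultimately have "(u - U) * (v\<^sup>2 - w) + a * h * (v\<^sup>2 - w) + (u - U) * 2 * v * b * h - 12 * h\<^sup>2
       \<le> (u + a * h - U) * ((v + b * h)\<^sup>2 - w)" by linarith
    then show "?A + ?B * real_of_int x + ?C * (real_of_int x)\<^sup>2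
      \<le> (u + ((real_of_int x)\<^sup>2 - u) * h - U) * ((v + (real_of_int x - v) * h)\<^sup>2 - w)"
      unfolding a_def[symmetric] b_def[symmetric]
      by (simp add: a_def[unfolded power2_eq_square] b_def power2_eq_square algebra_simps)
  qed (use assms in auto)
  then show ?thesis by (simp only: tmean_quadratic) (simp add: algebra_simps power2_eq_square)
qed

text \<open>\<open>Psi n S\<close> is \<open>ln ((S / n)\<^sup>2)\<close>, regularised on the scale \<open>S \<approx> sqrt n\<close>: when \<open>S\<close> has
  increments of mean \<open>a * S / n\<close> and second moment bounded below, the noise keeps the drift of
  \<open>Psi\<close> at least that of \<open>ln ((S / n)\<^sup>2)\<close> along the mean flow, up to a summable error.
  The constants 8 and 4000 are chosen large enough for \<open>Psi_drift_main_term\<close>.\<close>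

definition Psi :: "real \<Rightarrow> real \<Rightarrow> real" where
  "Psi n S = ln ((S\<^sup>2 + 8 * n) / n\<^sup>2) - 4000 * (n / (S\<^sup>2 + 8 * n))"

text \<open>Here \<open>s\<close> stands for \<open>S\<^sup>2 / n\<close>, and both sides have been multiplied by \<open>n\<close>.\<close>

lemma Psi_drift_main_term:
  fixes s a q :: real
  assumes s: "0 \<le> s" and a: "3/4 \<le> a" "a \<le> 2" and q: "1/6 \<le> q" "q \<le> 1"
  shows "2 * (a - 1) \<le> (2 * s * a + q + 8) / (s+8) - 2 * s * q / (s+8)\<^sup>2 - 2
     - 4000 * (1 / (s+8) - (2 * s * a + q + 8) / (s+8)\<^sup>2 + 4 * s * q / (s+8)^3)"
proof -
  define t where "t = s + 8"
  have t: "t > 0" using s by (simp add: t_def)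
  \<comment> \<open>This is the gain of the correction term in \<open>Psi\<close>. The coefficient
    of \<open>s\<close> is positive since \<open>8 * (2 * a - 1) \<ge> 4\<close> and
    \<open>3 * q \<le> 3\<close>. At \<open>s = 0\<close> only \<open>8 * q\<close> is left, so
    there the gain comes entirely from the noise bound \<open>q \<ge> 1/6\<close>.\<close>
  have "s\<^sup>2 / 2 + s + 4/3 \<le> (2 * a-1) * s\<^sup>2 + s * (8 * (2 * a-1) - 3 * q) + 8 * q"
  proof -
    have "1/2 * s\<^sup>2 \<le> (2 * a-1) * s\<^sup>2" using a by (intro mult_right_mono) auto
    moreover have "s * 1 \<le> s * (8 * (2 * a-1) - 3 * q)" using s a q by (intro mult_left_mono) auto
    ultimately show ?thesis using q by linarith
  qed
  also have "\<dots> = (2 * s * a + q + 8 - t) * t - 4 * s * q" by (simp add: t_def power2_eq_square algebra_simps)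
  finally have 1: "4000 * (s\<^sup>2 / 2 + s + 4/3) \<le> 4000 * ((2 * s * a + q + 8 - t) * t - 4 * s * q)" by simp
  have 2: "t\<^sup>2 * (-24) \<le> t\<^sup>2 * (q + 8 - 16 * a)" using a q by (intro mult_left_mono) auto
  have "s * (q * t) \<le> t * (1 * t)" using s q t by (intro mult_mono) (auto simp: t_def)
  then have 3: "- 2 * t\<^sup>2 \<le> - 2 * s * q * t" by (simp add: power2_eq_square algebra_simps)
  \<comment> \<open>After multiplication by \<open>t ^ 3\<close> the logarithm alone loses at most
    \<open>26 * t\<^sup>2\<close>; the factor 4000 lets the gain dominate this coefficient by
    coefficient in \<open>s\<close>.\<close>
  have "0 \<le> -26 * t\<^sup>2 + 4000 * (s\<^sup>2 / 2 + s + 4/3)"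
    using s by (simp add: t_def power2_eq_square algebra_simps)
  with 1 2 3 have P: "0 \<le> t\<^sup>2 * (q + 8 - 16 * a) - 2 * s * q * t + 4000 * ((2 * s * a + q + 8 - t) * t - 4 * s * q)"
    by linarith
  have "(2 * s * a + q + 8) / t - 2 * s * q / t\<^sup>2 - 2
     - 4000 * (1 / t - (2 * s * a + q + 8) / t\<^sup>2 + 4 * s * q / t^3) - 2 * (a - 1)
     = (t\<^sup>2 * (q + 8 - 16 * a) - 2 * s * q * t + 4000 * ((2 * s * a + q + 8 - t) * t - 4 * s * q)) / t ^ 3"
  proof -
    have s': "s = t - 8" by (simp add: t_def)
    show ?thesis unfolding s' using t by (simp add: field_simps power2_eq_square power3_eq_cube)
  qed
  also have "\<dots> \<ge> 0" using P t by simp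
  finally show ?thesis by (simp add: t_def)
qed

text \<open>The regularisation bounds the relative increment of \<open>S\<^sup>2 + 8 * n\<close> by
  a multiple of \<open>1 / sqrt n\<close>, whatever \<open>S\<close> is. Expanding both terms of
  \<open>Psi\<close> to second order therefore leaves remainders of the summable order
  \<open>n powr (-3/2)\<close>, and the second-order part is
  \<open>Psi_drift_main_term\<close>.\<close>

lemma Psi_drift:
  fixes n S a q m :: real
  assumes n: "11 \<le> n" and a: "3/4 \<le> a" "a \<le> 2" and q: "1/6 \<le> q" "q \<le> 1"
    and m: "m = S * a / n" "\<bar>m\<bar> \<le> q"
  shows "Psi n S + 2 * (a - 1) / n - 412050 / n powr (3/2)
           \<le> tmean q m (\<lambda>x. Psi (n + 1) (S + real_of_int x))"
proof -
  define R where "R = S\<^sup>2 + 8 * n"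
  define \<rho> where "\<rho> = sqrt R"
  \<comment> \<open>\<open>n \<ge> 11\<close> is there to give \<open>\<rho> \<ge> 9\<close>, which
    absorbs bounded terms, as in \<open>2 * \<rho> + 9 \<le> 3 * \<rho>\<close> and
    \<open>36 * \<rho> + 81 \<le> 45 * \<rho>\<close>.\<close>
  have R: "R \<ge> 88" using n zero_le_power2[of S] unfolding R_def by linarith
  have R\<rho>: "R = \<rho>\<^sup>2" using R by (simp add: \<rho>_def)
  have "sqrt 81 \<le> \<rho>" unfolding \<rho>_def using R by (intro real_sqrt_le_mono) simp
  then have \<rho>9: "9 \<le> \<rho>" using real_sqrt_abs[of 9] by simp
  have S\<rho>: "\<bar>S\<bar> \<le> \<rho>"
  proof -
    have "sqrt (S\<^sup>2) \<le> \<rho>" unfolding \<rho>_def using n by (intro real_sqrt_le_mono) (simp add: R_def)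
    then show ?thesis by simp
  qed
  have nR: "n / R \<le> 1" "(n + 1) / R \<le> 1"
  proof -
    have "n + 1 \<le> R" using n zero_le_power2[of S] unfolding R_def by linarith
    then show "n / R \<le> 1" "(n + 1) / R \<le> 1" using R by simp_all
  qed
  \<comment> \<open>The relative increment:
    \<open>(S + x)\<^sup>2 + 8 * (n + 1) = R * (1 + z x)\<close>.\<close>
  define z where "z = (\<lambda>x. (2 * S * real_of_int x + (real_of_int x)\<^sup>2 + 8) / R)"
  have zb: "\<bar>z x\<bar> \<le> 3 / \<rho>" "(z x)\<^sup>2 \<le> 4 * S\<^sup>2 * (real_of_int x)\<^sup>2 / R\<^sup>2 + 45 / \<rho> ^ 3"
    if x: "x \<in> {-1, 0, 1}" for x
  proof -
    have x1: "\<bar>real_of_int x\<bar> \<le> 1" "(real_of_int x)\<^sup>2 \<le> 1" using x by auto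
    have Sx: "\<bar>S * real_of_int x\<bar> \<le> \<rho> * 1" unfolding abs_mult using S\<rho> x1 by (intro mult_mono) auto
    have "\<bar>2 * S * real_of_int x + (real_of_int x)\<^sup>2 + 8\<bar> \<le> 3 * \<rho>"
      using Sx x1 \<rho>9 zero_le_power2[of "real_of_int x"] by linarith
    then have "\<bar>z x\<bar> \<le> 3 * \<rho> / R" unfolding z_def abs_divide using R by (simp add: divide_right_mono)
    also have "\<dots> = 3 / \<rho>" using \<rho>9 by (simp add: R\<rho> power2_eq_square)
    finally show "\<bar>z x\<bar> \<le> 3 / \<rho>" .
    have "4 * (S * real_of_int x) * ((real_of_int x)\<^sup>2 + 8) \<le> 4 * \<rho> * 9"
    proof -
      have "S * real_of_int x * ((real_of_int x)\<^sup>2 + 8) \<le> \<bar>S * real_of_int x\<bar> * ((real_of_int x)\<^sup>2 + 8)"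
        by (intro mult_right_mono) auto
      also have "\<dots> \<le> \<rho> * 9" using Sx x1 \<rho>9 by (intro mult_mono) auto
      finally show ?thesis by simp
    qed
    moreover have "((real_of_int x)\<^sup>2 + 8)\<^sup>2 \<le> 9\<^sup>2" using x1 by (intro power_mono) auto
    moreover have "(2 * S * real_of_int x + (real_of_int x)\<^sup>2 + 8)\<^sup>2 = 4 * S\<^sup>2 * (real_of_int x)\<^sup>2
        + 4 * (S * real_of_int x) * ((real_of_int x)\<^sup>2 + 8) + ((real_of_int x)\<^sup>2 + 8)\<^sup>2"
      by (simp add: power2_eq_square algebra_simps)
    ultimately have "(2 * S * real_of_int x + (real_of_int x)\<^sup>2 + 8)\<^sup>2 \<le> 4 * S\<^sup>2 * (real_of_int x)\<^sup>2 + 45 * \<rho>"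
      using \<rho>9 by simp
    then have "(z x)\<^sup>2 \<le> (4 * S\<^sup>2 * (real_of_int x)\<^sup>2 + 45 * \<rho>) / R\<^sup>2"
      unfolding z_def power_divide by (intro divide_right_mono) auto
    also have "\<dots> = 4 * S\<^sup>2 * (real_of_int x)\<^sup>2 / R\<^sup>2 + 45 / \<rho> ^ 3"
      using \<rho>9 by (simp add: R\<rho> add_divide_distrib eval_nat_numeral)
    finally show "(z x)\<^sup>2 \<le> 4 * S\<^sup>2 * (real_of_int x)\<^sup>2 / R\<^sup>2 + 45 / \<rho> ^ 3" .
  qed
  \<comment> \<open>Coefficients of a quadratic minorant of \<open>Psi (n + 1) (S + x)\<close>. Of
    the square of \<open>z x\<close> only \<open>4 * S\<^sup>2 * x\<^sup>2 / R\<^sup>2\<close> is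
    kept. The error is \<open>50 + 4000 * 103\<close>, where 50 exceeds 27 + 45/2 from the logarithm
    and 103 = 45 + 4 + 54 comes from the reciprocal.\<close>
  define A where "A = Psi n S + 8 / R - 2 / n - 4000 * (1 / R - (n / R) * (8 / R)) - 412050 / \<rho> ^ 3"
  define B where "B = 2 * S / R + 4000 * (n / R) * (2 * S / R)"
  define C where "C = 1 / R - 2 * S\<^sup>2 / R\<^sup>2 + 4000 * (n / R) * (1 / R) - 16000 * (n / R) * S\<^sup>2 / R\<^sup>2"
  have "tmean q m (\<lambda>x. A + B * real_of_int x + C * (real_of_int x)\<^sup>2)
      \<le> tmean q m (\<lambda>x. Psi (n + 1) (S + real_of_int x))"
  proof (rule tmean_mono)
    fix x :: int assume x: "x \<in> {-1, 0, 1}"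
    let ?x = "real_of_int x" and ?z = "z x"
    have z3: "\<bar>?z\<bar> \<le> 3 / \<rho>" using zb(1)[OF x] .
    also have "3 / \<rho> \<le> 1/2" using \<rho>9 by (simp add: field_simps)
    finally have z12: "\<bar>?z\<bar> \<le> 1/2" .
    have z33: "\<bar>?z\<bar> ^ 3 \<le> 27 / \<rho> ^ 3" using power_mono[OF z3, of 3] by (simp add: power_divide)
    have z2: "?z\<^sup>2 \<le> 1 / \<rho>"
    proof -
      have "?z\<^sup>2 \<le> (3 / \<rho>)\<^sup>2" using z3 \<rho>9 by (simp add: abs_le_square_iff[symmetric])
      also have "\<dots> \<le> 1 / \<rho>" using \<rho>9 by (simp add: field_simps power2_eq_square)
      finally show ?thesis .
    qed
    have R': "(S + ?x)\<^sup>2 + 8 * (n + 1) = R * (1 + ?z)"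
    proof -
      have "R * ?z = 2 * S * ?x + ?x\<^sup>2 + 8" using R by (simp add: z_def)
      then show ?thesis by (simp add: distrib_left) (simp add: R_def power2_eq_square algebra_simps)
    qed
    have "Psi (n + 1) (S + ?x) = ln (R * (1 + ?z) / (n + 1)\<^sup>2) - 4000 * ((n + 1) / (R * (1 + ?z)))"
      unfolding Psi_def R' ..
    also have "ln (R * (1 + ?z) / (n + 1)\<^sup>2) = ln (R / n\<^sup>2) + ln (1 + ?z) - 2 * ln (1 + 1 / n)"
    proof -
      have "1 + 1 / n = (n + 1) / n" using n by (simp add: field_simps)
      moreover have "ln (R * y / (n + 1)\<^sup>2) = ln R + ln y - 2 * ln (n + 1)" if "0 < y" for y
        using that n R by (simp add: ln_mult ln_div ln_realpow)
      moreover have "0 < 1 + ?z" using z12 by linarith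
      moreover have "ln (R / n\<^sup>2) = ln R - 2 * ln n" "ln ((n + 1) / n) = ln (n + 1) - ln n"
        using n R by (simp_all add: ln_div ln_realpow)
      ultimately show ?thesis by simp
    qed
    also have "(n + 1) / (R * (1 + ?z)) = (n + 1) / R * (1 / (1 + ?z))" by simp
    finally have Psi': "Psi (n + 1) (S + ?x) = Psi n S + ln (1 + ?z) - 2 * ln (1 + 1 / n)
        - 4000 * ((n + 1) / R * (1 / (1 + ?z)) - n / R)"
      by (simp add: Psi_def R_def)
    have l1: "?z - ?z\<^sup>2 / 2 - 27 / \<rho> ^ 3 \<le> ln (1 + ?z)"
      using ln_one_plus_cubic_bound[OF z12] z33 by linarith
    have l2: "ln (1 + 1 / n) \<le> 1 / n" using n by (intro ln_add_one_self_le_self) auto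
    have "1 / (1 + ?z) \<le> 1 - ?z + ?z\<^sup>2 + 54 / \<rho> ^ 3"
      using inverse_one_plus_cubic_bound[OF z12] z33 by linarith
    then have "(n + 1) / R * (1 / (1 + ?z)) \<le> (n + 1) / R * (1 - ?z + ?z\<^sup>2 + 54 / \<rho> ^ 3)"
      using n R by (intro mult_left_mono) auto
    also have "\<dots> = n / R + 1 / R - n / R * ?z + n / R * ?z\<^sup>2 + (1 / R) * (- ?z + ?z\<^sup>2)
        + (n + 1) / R * (54 / \<rho> ^ 3)"
    proof -
      have "(r + i) * (1 - y + y' + e) = r + i - r * y + r * y' + i * (- y + y') + (r + i) * e"
        for r i y y' e :: real by (simp add: algebra_simps)
      then show ?thesis unfolding add_divide_distrib .
    qed
    also have "(1 / R) * (- ?z + ?z\<^sup>2) \<le> (1 / R) * (4 / \<rho>)"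
    proof (rule mult_left_mono)
      have "4 / \<rho> = 3 / \<rho> + 1 / \<rho>" by (simp add: field_simps)
      then show "- ?z + ?z\<^sup>2 \<le> 4 / \<rho>" using z3 z2 by linarith
    qed (use R in simp)
    also have "(1 / R) * (4 / \<rho>) = 4 / \<rho> ^ 3" by (simp add: R\<rho> eval_nat_numeral)
    also have "(n + 1) / R * (54 / \<rho> ^ 3) \<le> 1 * (54 / \<rho> ^ 3)" using nR \<rho>9 by (intro mult_right_mono) auto
    also have "n / R * ?z\<^sup>2 \<le> n / R * (4 * S\<^sup>2 * ?x\<^sup>2 / R\<^sup>2) + 45 / \<rho> ^ 3"
    proof -
      have "n / R * ?z\<^sup>2 \<le> n / R * (4 * S\<^sup>2 * ?x\<^sup>2 / R\<^sup>2 + 45 / \<rho> ^ 3)"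
        using zb(2)[OF x] n R by (intro mult_left_mono) auto
      also have "\<dots> = n / R * (4 * S\<^sup>2 * ?x\<^sup>2 / R\<^sup>2) + n / R * (45 / \<rho> ^ 3)" by (simp add: algebra_simps)
      also have "n / R * (45 / \<rho> ^ 3) \<le> 1 * (45 / \<rho> ^ 3)" using nR \<rho>9 by (intro mult_right_mono) auto
      finally show ?thesis by simp
    qed
    finally have l3: "(n + 1) / R * (1 / (1 + ?z)) - n / R
       \<le> 1 / R - n / R * ?z + n / R * (4 * S\<^sup>2 * ?x\<^sup>2 / R\<^sup>2) + 103 * (1 / \<rho> ^ 3)"
      by simp
    have "?z - 2 * S\<^sup>2 * ?x\<^sup>2 / R\<^sup>2 - 50 * (1 / \<rho> ^ 3) \<le> ln (1 + ?z)"
    proof -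
      have "1 / \<rho> ^ 3 \<ge> 0" using \<rho>9 by simp
      moreover have "27 / \<rho> ^ 3 = 27 * (1 / \<rho> ^ 3)" "45 / \<rho> ^ 3 = 45 * (1 / \<rho> ^ 3)"
        "4 * S\<^sup>2 * ?x\<^sup>2 / R\<^sup>2 = 2 * (2 * S\<^sup>2 * ?x\<^sup>2 / R\<^sup>2)" by simp_all
      ultimately show ?thesis using l1 zb(2)[OF x] by linarith
    qed
    moreover have gen: "P + t - 2 * i - 4000 * Y \<le> P + l - 2 * l' - 4000 * X"
      if "l' \<le> i" "X \<le> Y" "t \<le> l" for P t i Y l l' X :: real using that by linarith
    ultimately have "Psi n S + (?z - 2 * S\<^sup>2 * ?x\<^sup>2 / R\<^sup>2 - 50 * (1 / \<rho> ^ 3)) - 2 * (1 / n)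
       - 4000 * (1 / R - n / R * ?z + n / R * (4 * S\<^sup>2 * ?x\<^sup>2 / R\<^sup>2) + 103 * (1 / \<rho> ^ 3))
       \<le> Psi (n + 1) (S + ?x)" unfolding Psi' by (intro gen l2 l3)
    also have "Psi n S + (?z - 2 * S\<^sup>2 * ?x\<^sup>2 / R\<^sup>2 - 50 * (1 / \<rho> ^ 3)) - 2 * (1 / n)
       - 4000 * (1 / R - n / R * ?z + n / R * (4 * S\<^sup>2 * ?x\<^sup>2 / R\<^sup>2) + 103 * (1 / \<rho> ^ 3))
       = A + B * ?x + C * ?x\<^sup>2"
      by (simp add: A_def B_def C_def z_def add_divide_distrib algebra_simps)
    finally show "A + B * ?x + C * ?x\<^sup>2 \<le> Psi (n + 1) (S + ?x)" .
  qed (use m q in auto)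
  moreover have "Psi n S + 2 * (a - 1) / n - 412050 / n powr (3/2) \<le> A + B * m + C * q"
  proof -
    \<comment> \<open>In terms of \<open>s\<close> every remaining term is \<open>1 / n\<close>
      times a function of \<open>s\<close>, \<open>a\<close> and \<open>q\<close> alone.\<close>
    define s where "s = S\<^sup>2 / n"
    have s: "0 \<le> s" "S\<^sup>2 = n * s" "R = n * (s + 8)" using n by (simp_all add: s_def R_def algebra_simps)
    have Sm: "S * m = s * a" using n by (simp add: m s_def power2_eq_square)
    have "A + B * m + C * q = Psi n S - 412050 / \<rho> ^ 3 + (2 * (S * m) + q + 8) / R - 2 * S\<^sup>2 * q / R\<^sup>2 - 2 / n
         - 4000 * (1 / R - n * (2 * (S * m) + q + 8) / R\<^sup>2 + 4 * n * S\<^sup>2 * q / R ^ 3)"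
      by (simp add: A_def B_def C_def add_divide_distrib algebra_simps eval_nat_numeral)
    also have "\<dots> = Psi n S - 412050 / \<rho> ^ 3 + ((2 * s * a + q + 8) / (s+8) - 2 * s * q / (s+8)\<^sup>2 - 2
     - 4000 * (1 / (s+8) - (2 * s * a + q + 8) / (s+8)\<^sup>2 + 4 * s * q / (s+8)^3)) / n"
    proof -
      define t where "t = s + 8"
      have t: "0 < t" "R = n * t" using s by (simp_all add: t_def)
      have *: "2 * S\<^sup>2 * q / R\<^sup>2 = 2 * s * q / t\<^sup>2 / n" "n * X / R\<^sup>2 = X / t\<^sup>2 / n"
          "4 * n * S\<^sup>2 * q / R ^ 3 = 4 * s * q / t^3 / n" "X / R = X / t / n" for X
        using n t(1) unfolding s(2) t(2) by (simp_all add: eval_nat_numeral mult_ac)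
      show ?thesis unfolding * Sm t_def[symmetric] by (simp add: add_divide_distrib diff_divide_distrib mult_ac)
    qed
    also have "\<dots> \<ge> Psi n S - 412050 / \<rho> ^ 3 + 2 * (a - 1) / n"
      using Psi_drift_main_term[OF s(1) a q] n by (intro add_left_mono divide_right_mono) auto
    finally have 1: "Psi n S - 412050 / \<rho> ^ 3 + 2 * (a - 1) / n \<le> A + B * m + C * q" .
    have "n powr (3/2) = (sqrt n) ^ 3"
      using n by (simp add: powr_half_sqrt[symmetric] powr_powr[symmetric] powr_realpow[symmetric] powr_powr)
    also have "\<dots> \<le> \<rho> ^ 3" unfolding \<rho>_def using n zero_le_power2[of S]
      by (intro power_mono real_sqrt_le_mono) (auto simp: R_def simp del: zero_le_power2)
    finally have "412050 / \<rho> ^ 3 \<le> 412050 / n powr (3/2)" using n \<rho>9 by (intro divide_left_mono) auto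
    with 1 show ?thesis by linarith
  qed
  ultimately show ?thesis by (simp only: tmean_quadratic)
qed

text \<open>Second moment and mean of a step, given \<open>u = (S\<^sup>+ + S\<^sup>-) / n\<close> and \<open>v = (S\<^sup>+ - S\<^sup>-) / n\<close>, where \<open>c = 2 * p - 1\<close>.\<close>

definition step_sq :: "real \<Rightarrow> real \<Rightarrow> real \<Rightarrow> real" where
  "step_sq c u v = 2 * u - 3/2 * u\<^sup>2 + c\<^sup>2 * v\<^sup>2 / 2"

definition step_mean :: "real \<Rightarrow> real \<Rightarrow> real \<Rightarrow> real" where
  "step_mean c u v = c * v * (2 - u)"

text \<open>One channel yields the sign \<open>s\<close> with probability \<open>y / 2\<close>,
  where \<open>y = u + s * (c * v)\<close>, and 0 with probability \<open>1 - u\<close>. Hence, for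
  second moment \<open>q\<close> and mean \<open>m\<close>,
  \<open>(q + s * m) / 2 = (y / 2)\<^sup>2 + y * (1 - u)\<close>, which shows nonnegativity, and
  \<open>1 - q = (1 - u)\<^sup>2 + (u\<^sup>2 - c\<^sup>2 * v\<^sup>2) / 2\<close>.\<close>

lemma step_moment_bounds:
  assumes "u \<le> 1" "\<bar>v\<bar> \<le> u" "\<bar>c\<bar> \<le> 1"
  shows "\<bar>step_mean c u v\<bar> \<le> step_sq c u v" "step_sq c u v \<le> 1" "2 * u - 3/2 * u\<^sup>2 \<le> step_sq c u v"
proof -
  have cv: "\<bar>c * v\<bar> \<le> u" using mult_mono[OF assms(3,2)] by (simp add: abs_mult)
  have u0: "0 \<le> u" using assms by linarith
  have nn: "0 \<le> step_sq c u v + s * step_mean c u v" if "s = 1 \<or> s = -1" for s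
  proof -
    have "0 \<le> u + s * (c * v)" using cv that by auto
    moreover have "0 \<le> y * y + 4 * (y * (1 - u))" if "0 \<le> y" for y
      using that assms by simp
    ultimately have "0 \<le> (u + s * (c * v)) * (u + s * (c * v)) + 4 * ((u + s * (c * v)) * (1 - u))"
      by blast
    also have "\<dots> = 2 * (step_sq c u v + s * step_mean c u v)"
      using that by (auto simp: step_sq_def step_mean_def power2_eq_square algebra_simps)
    finally show ?thesis by simp
  qed
  show "\<bar>step_mean c u v\<bar> \<le> step_sq c u v" using nn[of 1] nn[of "-1"] by simp
  have "(c * v)\<^sup>2 \<le> u\<^sup>2" using cv u0 by (simp add: abs_le_square_iff[symmetric])
  moreover have "0 \<le> (1 - u)\<^sup>2" by simp
  ultimately show "step_sq c u v \<le> 1"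
    by (simp add: step_sq_def power_mult_distrib power2_diff)
  show "2 * u - 3/2 * u\<^sup>2 \<le> step_sq c u v" by (simp add: step_sq_def)
qed

lemma drift_away_from_zero:
  assumes "u \<le> 1" "\<bar>v\<bar> \<le> u" "\<bar>c\<bar> \<le> 1" "0 \<le> h"
  shows "tmean (step_sq c u v) (step_mean c u v) (\<lambda>x. (max 0 (1/2 - (u + ((real_of_int x)\<^sup>2 - u) * h)))\<^sup>2)
    \<le> (max 0 (1/2 - u))\<^sup>2 - max 0 (1/2 - u) * u / 2 * h + h\<^sup>2"
proof -
  let ?q = "step_sq c u v" and ?m = "step_mean c u v"
  note b = step_moment_bounds[OF assms(1-3)]
  have u0: "0 \<le> u" using assms by linarith
  define \<beta> where "\<beta> = max 0 (1/2 - u)"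
  \<comment> \<open>\<open>u + \<beta>\<close> is \<open>max u (1/2)\<close>. Freezing the target
    there replaces the truncated square by a plain one that agrees with it before the step and
    dominates it afterwards.\<close>
  have "tmean ?q ?m (\<lambda>x. (max 0 (1/2 - (u + ((real_of_int x)\<^sup>2 - u) * h)))\<^sup>2)
      \<le> tmean ?q ?m (\<lambda>x. (u + ((real_of_int x)\<^sup>2 - u) * h - (u + \<beta>))\<^sup>2)"
  proof (rule tmean_mono[OF b(1,2)])
    fix x :: int
    have "\<bar>max 0 (1/2 - (u + ((real_of_int x)\<^sup>2 - u) * h))\<bar> \<le> \<bar>u + ((real_of_int x)\<^sup>2 - u) * h - (u + \<beta>)\<bar>"
      unfolding \<beta>_def by linarith
    then show "(max 0 (1/2 - (u + ((real_of_int x)\<^sup>2 - u) * h)))\<^sup>2 \<le> (u + ((real_of_int x)\<^sup>2 - u) * h - (u + \<beta>))\<^sup>2"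
      by (simp only: abs_le_square_iff)
  qed
  also have "\<dots> \<le> (u - (u + \<beta>))\<^sup>2 + 2 * (u - (u + \<beta>)) * (?q - u) * h + h\<^sup>2"
    using u0 assms b by (intro tmean_square_step) auto
  also have "\<dots> = \<beta>\<^sup>2 - 2 * (\<beta> * (?q - u)) * h + h\<^sup>2" by simp
  also have "\<dots> \<le> \<beta>\<^sup>2 - 2 * (\<beta> * (u / 4)) * h + h\<^sup>2"
  proof -
    have "\<beta> * (u / 4) \<le> \<beta> * (?q - u)"
    proof (cases "u \<le> 1/2")
      case True
      then have "u * u \<le> u * (1/2)" using u0 by (intro mult_left_mono) auto
      then have "u / 4 \<le> ?q - u" using b(3) by (simp add: power2_eq_square)
      then show ?thesis by (intro mult_left_mono) (auto simp: \<beta>_def)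
    qed (simp add: \<beta>_def)
    then have "\<beta> * (u / 4) * h \<le> \<beta> * (?q - u) * h" using assms by (intro mult_right_mono)
    then show ?thesis by simp
  qed
  finally show ?thesis unfolding \<beta>_def by (simp add: mult_ac)
qed

lemma drift_subcritical:
  assumes c: "\<bar>c\<bar> \<le> 1" "c < 3/4"
  obtains k K :: real where "0 \<le> k" "0 < K"
    "\<And>u v h. \<lbrakk>1/3 \<le> u; u \<le> 1; \<bar>v\<bar> \<le> u; 0 \<le> h\<rbrakk> \<Longrightarrow>
       tmean (step_sq c u v) (step_mean c u v)
         (\<lambda>x. (u + ((real_of_int x)\<^sup>2 - u) * h - 2/3)\<^sup>2 + k * (v + (real_of_int x - v) * h)\<^sup>2)
       \<le> (u - 2/3)\<^sup>2 + k * v\<^sup>2 - ((u - 2/3)\<^sup>2 + K * v\<^sup>2) * h + (1 + 4 * k) * h\<^sup>2"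
proof -
  obtain k K :: real where k: "0 \<le> k" "0 < K"
    and kK: "\<And>u. \<lbrakk>0 \<le> u; u \<le> 1\<rbrakk> \<Longrightarrow> (u - 2/3) * c\<^sup>2 + 2 * k * (c * (2 - u) - 1) \<le> - K"
  proof (cases "c > 0")
    case True
    \<comment> \<open>The weight \<open>c / 2\<close> cancels \<open>u\<close> from the coefficient
      of \<open>v\<^sup>2\<close> and leaves \<open>c * (4/3 * c - 1)\<close>, which is negative
      because \<open>c < 3/4\<close>.\<close>
    show ?thesis
    proof (rule that[of "c / 2" "c * (1 - 4/3 * c)"])
      show "0 < c * (1 - 4/3 * c)" using True c by simp
    qed (use True in \<open>auto simp: power2_eq_square algebra_simps\<close>)
  next
    case False
    \<comment> \<open>For \<open>c \<le> 0\<close> the drift of \<open>v\<close> is already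
      restoring, and the contribution \<open>-2\<close> of the weight 1 outweighs
      \<open>(u - 2/3) * c\<^sup>2 \<le> 1\<close>.\<close>
    show ?thesis
    proof (rule that[of 1 1])
      fix u :: real assume u: "0 \<le> u" "u \<le> 1"
      have "(u - 2/3) * c\<^sup>2 \<le> 1 * c\<^sup>2" using u by (intro mult_right_mono) auto
      moreover have "c\<^sup>2 \<le> 1" using c by (simp add: abs_square_le_1)
      moreover have "c * (2 - u) \<le> 0" using False u by (intro mult_nonpos_nonneg) auto
      moreover have "X + 2 * 1 * (Y - 1) \<le> -1" if "X \<le> 1 * C" "C \<le> 1" "Y \<le> 0" for X Y C :: real
        using that by simp
      ultimately show "(u - 2/3) * c\<^sup>2 + 2 * 1 * (c * (2 - u) - 1) \<le> - 1" by blast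
    qed auto
  qed
  show ?thesis
  proof (rule that[OF k])
    fix u v h :: real assume u: "1/3 \<le> u" "u \<le> 1" and v: "\<bar>v\<bar> \<le> u" and h: "0 \<le> h"
    let ?q = "step_sq c u v" and ?m = "step_mean c u v"
    note b = step_moment_bounds[OF u(2) v c(1)]
    have "tmean ?q ?m (\<lambda>x. (u + ((real_of_int x)\<^sup>2 - u) * h - 2/3)\<^sup>2 + k * (v + (real_of_int x - v) * h)\<^sup>2)
      \<le> ((u - 2/3)\<^sup>2 + 2 * (u - 2/3) * (?q - u) * h + h\<^sup>2) + k * (v\<^sup>2 + 2 * v * (?m - v) * h + 4 * h\<^sup>2)"
      unfolding tmean_linear using u v b k
      by (intro add_mono mult_left_mono tmean_square_step tmean_square_step') auto
    also have "\<dots> = (u - 2/3)\<^sup>2 + k * v\<^sup>2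
        + (- 3 * u * (u - 2/3)\<^sup>2 + ((u - 2/3) * c\<^sup>2 + 2 * k * (c * (2 - u) - 1)) * v\<^sup>2) * h + (1 + 4 * k) * h\<^sup>2"
      by (simp add: step_sq_def step_mean_def power2_eq_square field_simps)
    \<comment> \<open>Here \<open>u \<ge> 1/3\<close> enters: the damping coefficient
      \<open>3 * u\<close> is at least 1.\<close>
    also have "\<dots> \<le> (u - 2/3)\<^sup>2 + k * v\<^sup>2 + (- 1 * (u - 2/3)\<^sup>2 + (- K) * v\<^sup>2) * h + (1 + 4 * k) * h\<^sup>2"
      using kK[of u] u h by (intro add_mono mult_right_mono order_refl) auto
    finally show "tmean ?q ?m (\<lambda>x. (u + ((real_of_int x)\<^sup>2 - u) * h - 2/3)\<^sup>2 + k * (v + (real_of_int x - v) * h)\<^sup>2)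
      \<le> (u - 2/3)\<^sup>2 + k * v\<^sup>2 - ((u - 2/3)\<^sup>2 + K * v\<^sup>2) * h + (1 + 4 * k) * h\<^sup>2"
      by (simp add: algebra_simps)
  qed
qed

text \<open>Rest points off the line \<open>v = 0\<close>: \<open>v' = 0\<close> forces
  \<open>c * (2 - u) = 1\<close>, and then \<open>u' = 0\<close> gives
  \<open>c\<^sup>2 * v\<^sup>2 = u * (3 * u - 2)\<close>.\<close>

definition u_star :: "real \<Rightarrow> real" where "u_star c = 2 - 1 / c"
definition v_star_sq :: "real \<Rightarrow> real" where "v_star_sq c = u_star c * (3 * u_star c - 2) / c\<^sup>2"

lemma star_bounds:
  assumes "3/4 < c" "c < 1"
  shows "2/3 < u_star c" "u_star c < 1" "0 < v_star_sq c" "v_star_sq c \<le> 2"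
proof -
  show 1: "2/3 < u_star c" "u_star c < 1" using assms by (simp_all add: u_star_def field_simps)
  then show "0 < v_star_sq c" using assms by (simp add: v_star_sq_def)
  have "u_star c * (3 * u_star c - 2) \<le> 1 * 1" using 1 by (intro mult_mono) auto
  moreover have "(3/4)\<^sup>2 \<le> c\<^sup>2" using assms by (intro power_mono) auto
  ultimately show "v_star_sq c \<le> 2" using assms unfolding v_star_sq_def
    by (simp add: divide_le_eq power2_eq_square)
qed

text \<open>The mean-field flow has the Lotka--Volterra type Lyapunov function
  \<open>(u - u_star c)\<^sup>2 + c / 2 * (v\<^sup>2 - v_star_sq c * ln (v\<^sup>2))\<close>; the mixed term of \<open>lyap\<close>
  makes its derivative strictly negative outside the two stable equilibria.\<close>

definition lyap :: "real \<Rightarrow> real \<Rightarrow> real \<Rightarrow> real \<Rightarrow> real" where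
  "lyap c n u v = 11 * ((u - u_star c)\<^sup>2 + c / 2 * v\<^sup>2 - c * v_star_sq c / 2 * (Psi n (n * v) - 8))
     - (u - u_star c) * (v\<^sup>2 - v_star_sq c) + 3"

text \<open>Explains the constants 8 and 3 of \<open>lyap\<close>: \<open>Psi n (n * v)\<close> is
  at most \<open>ln (v\<^sup>2 + 8 / n) \<le> 8\<close>, and the mixed term is at most 3 because
  \<open>v_star_sq c \<le> 2\<close>.\<close>

lemma lyap_nonneg:
  assumes c: "3/4 < c" "c < 1" and n: "1 \<le> n" and u: "0 \<le> u" "u \<le> 1" and v: "\<bar>v\<bar> \<le> 1"
  shows "0 \<le> lyap c n u v"
proof -
  note s = star_bounds[OF c]
  have eq: "((n * v)\<^sup>2 + 8 * n) / n\<^sup>2 = v\<^sup>2 + 8 / n"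
    using n by (simp add: add_divide_distrib power2_eq_square)
  have "v\<^sup>2 + 8 / n \<le> 1 + 8" using v n by (intro add_mono) (auto simp: abs_square_le_1 divide_le_eq)
  then have "ln (v\<^sup>2 + 8 / n) \<le> 8"
    using ln_le_minus_one[of "v\<^sup>2 + 8 / n"] n by (simp add: add_nonneg_pos)
  moreover have "0 \<le> n / ((n * v)\<^sup>2 + 8 * n)" using n by simp
  ultimately have "Psi n (n * v) \<le> 8" unfolding Psi_def eq by simp
  then have 1: "c * v_star_sq c / 2 * (Psi n (n * v) - 8) \<le> 0"
    using c s by (intro mult_nonneg_nonpos) auto
  have "v\<^sup>2 \<le> 1" using v by (simp add: abs_square_le_1)
  then have vw: "\<bar>v\<^sup>2 - v_star_sq c\<bar> \<le> 3" using s zero_le_power2[of v] by linarith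
  have "\<bar>(u - u_star c) * (v\<^sup>2 - v_star_sq c)\<bar> \<le> 1 * 3"
    unfolding abs_mult using u s vw by (intro mult_mono) auto
  then have 2: "(u - u_star c) * (v\<^sup>2 - v_star_sq c) \<le> 3" by linarith
  have "0 \<le> (u - u_star c)\<^sup>2 + c / 2 * v\<^sup>2" using c by simp
  moreover have "0 \<le> 11 * (X - Y) - Z + 3" if "Y \<le> 0" "Z \<le> 3" "0 \<le> X" for X Y Z :: real
    using that by (simp add: right_diff_distrib)
  ultimately show ?thesis using 1 2 unfolding lyap_def by blast
qed

text \<open>With \<open>a = u - U\<close> and \<open>b = v\<^sup>2 - w\<close>, the weight
  \<open>c / 2\<close> cancels the products \<open>a * b\<close> of the main part and leaves
  \<open>22 * r * a\<^sup>2\<close>, which does not see \<open>b\<close>. The mixed term supplies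
  \<open>- c\<^sup>2 * b\<^sup>2 / 2\<close>; the factor 11 is large enough to absorb its other
  contributions.\<close>

lemma lyap_mean_field_decrease:
  fixes c u v :: real
  assumes c: "3/4 < c" "c < 1" and u: "1/3 \<le> u" "u \<le> 1" and v: "\<bar>v\<bar> \<le> u"
  defines "U \<equiv> u_star c" and "w \<equiv> v_star_sq c" and "g \<equiv> c * (2 - u) - 1" and "q \<equiv> step_sq c u v"
  shows "11 * (2 * (u - U) * (q - u) + c * v\<^sup>2 * g - c * w * g)
      - ((q - u) * (v\<^sup>2 - w) + 2 * (u - U) * v\<^sup>2 * g) \<le> - ((u - U)\<^sup>2 + 9/64 * (v\<^sup>2 - w)\<^sup>2)"
proof -
  note s = star_bounds[OF c, folded U_def w_def]
  define a where "a = u - U"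
  define b where "b = v\<^sup>2 - w"
  have g: "g = - c * a" using c by (simp add: g_def a_def U_def u_star_def algebra_simps)
  have w: "c\<^sup>2 * w = U * (3 * U - 2)" using c by (simp add: w_def v_star_sq_def U_def)
  have "q - u = u - 3/2 * u\<^sup>2 + (c\<^sup>2 * b + c\<^sup>2 * w) / 2"
    by (simp add: q_def step_sq_def b_def algebra_simps)
  also have "\<dots> = a * (1 - 3/2 * (u + U)) + c\<^sup>2 * b / 2"
    unfolding w a_def by (simp add: power2_eq_square field_simps)
  finally have qu: "q - u = a * (1 - 3/2 * (u + U)) + c\<^sup>2 * b / 2" .
  define r where "r = 1 - 3/2 * (u + U)"
  \<comment> \<open>The upper bound combines \<open>u \<ge> 1/3\<close> with
    \<open>U > 2/3\<close>.\<close>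
  have r: "r \<le> -1/2" "-2 \<le> r" proof -
    have "1 \<le> u + U" "u + U \<le> 2" using u s by linarith+
    then show "r \<le> -1/2" "-2 \<le> r" by (simp_all add: r_def field_simps)
  qed
  have c2: "9/16 \<le> c\<^sup>2" using power_mono[of "3/4" c 2] c by (simp add: power2_eq_square)
  have v1: "v\<^sup>2 \<le> 1" using u v by (simp add: abs_square_le_1)
  have "11 * (2 * a * (q - u) + c * v\<^sup>2 * g - c * w * g) - ((q - u) * b + 2 * a * v\<^sup>2 * g)
     = 22 * (r * a\<^sup>2) - a * r * b - c\<^sup>2 * b\<^sup>2 / 2 + 2 * (c * v\<^sup>2) * a\<^sup>2"
    unfolding qu r_def[symmetric] g b_def by (simp add: power2_eq_square field_simps)
  moreover have "r * a\<^sup>2 \<le> -1/2 * a\<^sup>2" using r by (intro mult_right_mono) auto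
  \<comment> \<open>Young's inequality, weighted so that half of the available
    \<open>9/32 * b\<^sup>2\<close> survives; for \<open>a\<^sup>2\<close> the balance is
    \<open>-11 + 2 + 64/9 \<le> -1\<close>.\<close>
  moreover have "- (a * r * b) \<le> 64/9 * a\<^sup>2 + 9/64 * b\<^sup>2"
  proof -
    have "\<bar>a * r * b\<bar> \<le> \<bar>a\<bar> * 2 * \<bar>b\<bar>"
      unfolding abs_mult using r by (intro mult_right_mono mult_left_mono) auto
    moreover have "0 \<le> (8/3 * \<bar>a\<bar> - 3/8 * \<bar>b\<bar>)\<^sup>2" by simp
    then have "\<bar>a\<bar> * 2 * \<bar>b\<bar> \<le> 64/9 * a\<^sup>2 + 9/64 * b\<^sup>2"
      unfolding power2_diff power_mult_distrib power2_abs by (simp add: power2_eq_square)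
    ultimately show ?thesis by linarith
  qed
  moreover have "9/16 * b\<^sup>2 \<le> c\<^sup>2 * b\<^sup>2" using c2 by (intro mult_right_mono) auto
  moreover have "c * v\<^sup>2 * a\<^sup>2 \<le> 1 * 1 * a\<^sup>2" using c v1 by (intro mult_mono) auto
  moreover have "0 \<le> a\<^sup>2" "0 \<le> b\<^sup>2" by simp_all
  ultimately show ?thesis unfolding a_def[symmetric] b_def[symmetric] by linarith
qed

lemma drift_supercritical:
  fixes c n u v :: real
  assumes c: "3/4 < c" "c < 1" and n: "11 \<le> n" and u: "1/3 \<le> u" "u \<le> 1" and v: "\<bar>v\<bar> \<le> u"
  shows "tmean (step_sq c u v) (step_mean c u v)
         (\<lambda>x. lyap c (n + 1) (u + ((real_of_int x)\<^sup>2 - u) / (n + 1)) (v + (real_of_int x - v) / (n + 1)))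
       \<le> lyap c n u v - ((u - u_star c)\<^sup>2 + 9/64 * (v\<^sup>2 - v_star_sq c)\<^sup>2) / (n + 1) + 10^7 / n powr (3/2)"
proof -
  define U where "U = u_star c"
  define w where "w = v_star_sq c"
  define h where "h = 1 / (n + 1)"
  define q where "q = step_sq c u v"
  define m where "m = step_mean c u v"
  define g where "g = c * (2 - u) - 1"
  note s = star_bounds[OF c, folded U_def w_def]
  have h: "0 \<le> h" "h \<le> 1" using n by (simp_all add: h_def field_simps)
  have c1: "\<bar>c\<bar> \<le> 1" using c by simp
  note b = step_moment_bounds[OF u(2) v c1, folded q_def m_def]
  have mg: "m - v = v * g" by (simp add: m_def step_mean_def g_def algebra_simps)
  have cu: "3/4 \<le> c * (2 - u)" "c * (2 - u) \<le> 2"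
    using mult_mono[of "3/4" c 1 "2 - u"] mult_mono[of c 1 "2 - u" 2] c u by simp_all
  \<comment> \<open>The noise bound that \<open>Psi_drift\<close> demands:
    \<open>q \<ge> 2 * u - 3/2 * u\<^sup>2 \<ge> u / 2\<close>, and
    \<open>u \<ge> 1/3\<close>.\<close>
  have q16: "1/6 \<le> q"
  proof -
    have "u * u \<le> 1 * u" using u by (intro mult_right_mono) auto
    then show ?thesis using b(3) u unfolding power2_eq_square by linarith
  qed
  have P: "Psi n (n * v) + 2 * g / n - 412050 / n powr (3/2) \<le> tmean q m (\<lambda>x. Psi (n + 1) (n * v + real_of_int x))"
    unfolding g_def using n cu q16 b by (intro Psi_drift) (auto simp: m_def step_mean_def)
  \<comment> \<open>\<open>Psi\<close> drifts at rate \<open>1 / n\<close>, the averages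
    \<open>u\<close> and \<open>v\<close> at rate \<open>h = 1 / (n + 1)\<close>. The mismatch costs
    \<open>1 / n\<^sup>2\<close> and accounts for the extra 2 in 412052.\<close>
  have "g * (1 / n - h) \<ge> - (1 / n\<^sup>2)"
  proof -
    have "1 / n - h = 1 / (n * (n + 1))" using n by (simp add: h_def field_simps)
    also have "\<dots> \<le> 1 / n\<^sup>2" using n by (intro divide_left_mono) (auto simp: power2_eq_square)
    finally have "-1 * (1 / n\<^sup>2) \<le> -1 * (1 / n - h)" by simp
    also have "\<dots> \<le> g * (1 / n - h)" using cu n by (intro mult_right_mono) (auto simp: g_def h_def field_simps)
    finally show ?thesis by simp
  qed
  moreover have h2: "h\<^sup>2 \<le> 1 / n\<^sup>2" using n by (simp add: h_def power_divide frac_le)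
  moreover have n32: "1 / n\<^sup>2 \<le> 1 / n powr (3/2)"
  proof -
    have "n powr (3/2) \<le> n powr 2" using n by (intro powr_mono) auto
    then show ?thesis using n by (intro divide_left_mono) (auto simp: powr_numeral)
  qed
  ultimately have P': "Psi n (n * v) + 2 * g * h - 412052 / n powr (3/2) \<le> tmean q m (\<lambda>x. Psi (n + 1) (n * v + real_of_int x))"
  proof -
    assume 1: "- (1 / n\<^sup>2) \<le> g * (1 / n - h)"
    have "2 * g * h - 2 * (1 / n\<^sup>2) \<le> 2 * g / n" using 1 by (simp add: right_diff_distrib)
    moreover have "412052 / n powr (3/2) = 412050 / n powr (3/2) + 2 * (1 / n powr (3/2))" by (simp add: field_simps)
    ultimately show ?thesis using P n32 by linarith
  qed
  define A where "A = tmean q m (\<lambda>x. (u + ((real_of_int x)\<^sup>2 - u) * h - U)\<^sup>2)"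
  define B where "B = tmean q m (\<lambda>x. (v + (real_of_int x - v) * h)\<^sup>2)"
  define C where "C = tmean q m (\<lambda>x. Psi (n + 1) (n * v + real_of_int x))"
  define D where "D = tmean q m (\<lambda>x. (u + ((real_of_int x)\<^sup>2 - u) * h - U) * ((v + (real_of_int x - v) * h)\<^sup>2 - w))"
  have A: "A \<le> (u - U)\<^sup>2 + 2 * (u - U) * (q - u) * h + h\<^sup>2"
    unfolding A_def using u b by (intro tmean_square_step) auto
  have B: "B \<le> v\<^sup>2 + 2 * v * (v * g) * h + 4 * h\<^sup>2"
    unfolding B_def mg[symmetric] using u v b by (intro tmean_square_step') auto
  have D: "(u - U) * (v\<^sup>2 - w) + ((q - u) * (v\<^sup>2 - w) + 2 * (u - U) * v * (v * g)) * h - 12 * h\<^sup>2 \<le> D"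
    unfolding D_def mg[symmetric] using u v b s h by (intro tmean_mixed_step) auto
  \<comment> \<open>\<open>Psi\<close> acts on the sum \<open>n * v\<close>, whose increment is the
    step itself.\<close>
  have vn: "(n + 1) * (v + (real_of_int x - v) * h) = n * v + real_of_int x" for x
    using n by (simp add: h_def field_simps)
  have "tmean q m (\<lambda>x. lyap c (n + 1) (u + ((real_of_int x)\<^sup>2 - u) / (n + 1)) (v + (real_of_int x - v) / (n + 1)))
    = tmean q m (\<lambda>x. lyap c (n + 1) (u + ((real_of_int x)\<^sup>2 - u) * h) (v + (real_of_int x - v) * h))"
    by (simp add: h_def)
  also have "\<dots> = 11 * (A + c / 2 * B - c * w / 2 * (C - 8)) - D + 3"
    unfolding lyap_def vn U_def[symmetric] w_def[symmetric] A_def B_def C_def D_def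
    by (simp only: tmean_linear)
  also have "\<dots> \<le> 11 * (((u - U)\<^sup>2 + 2 * (u - U) * (q - u) * h + h\<^sup>2) + c / 2 * (v\<^sup>2 + 2 * v * (v * g) * h + 4 * h\<^sup>2)
      - c * w / 2 * (Psi n (n * v) + 2 * g * h - 412052 / n powr (3/2) - 8))
      - ((u - U) * (v\<^sup>2 - w) + ((q - u) * (v\<^sup>2 - w) + 2 * (u - U) * v * (v * g)) * h - 12 * h\<^sup>2) + 3"
    using A B D P'[folded C_def] c s
    by (intro add_mono diff_mono mult_left_mono order_refl) auto
  also have "\<dots> = lyap c n u v + (11 * (2 * (u - U) * (q - u) + c * v\<^sup>2 * g - c * w * g)
      - ((q - u) * (v\<^sup>2 - w) + 2 * (u - U) * v\<^sup>2 * g)) * h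
      + (23 + 22 * c) * h\<^sup>2 + (11/2) * (c * w) * (412052 / n powr (3/2))"
    unfolding lyap_def U_def[symmetric] w_def[symmetric]
    by (simp add: power2_eq_square algebra_simps)
  \<comment> \<open>In \<open>23 + 22 * c \<le> 45\<close> the 23 is 11 from \<open>A\<close> and 12
    from \<open>D\<close>, and \<open>22 * c\<close> comes from \<open>B\<close>. With
    \<open>c * w \<le> 2\<close> the total error is \<open>45 + 11 * 412052\<close>, which is below
    \<open>10 ^ 7\<close>.\<close>
  also have "\<dots> \<le> lyap c n u v + (- ((u - U)\<^sup>2 + 9/64 * (v\<^sup>2 - w)\<^sup>2)) * h
      + 45 * (1 / n powr (3/2)) + (11/2) * 2 * (412052 / n powr (3/2))"
  proof (intro add_mono mult_right_mono order_refl)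
    show "11 * (2 * (u - U) * (q - u) + c * v\<^sup>2 * g - c * w * g)
      - ((q - u) * (v\<^sup>2 - w) + 2 * (u - U) * v\<^sup>2 * g) \<le> - ((u - U)\<^sup>2 + 9/64 * (v\<^sup>2 - w)\<^sup>2)"
      unfolding U_def w_def g_def q_def using c u v by (rule lyap_mean_field_decrease)
    show "(23 + 22 * c) * h\<^sup>2 \<le> 45 * (1 / n powr (3/2))"
      using h2 n32 c by (intro mult_mono) auto
    show "11/2 * (c * w) \<le> 11/2 * 2" using mult_mono[of c 1 w 2] c s by simp
  qed (use h in auto)
  also have "\<dots> \<le> lyap c n u v - ((u - U)\<^sup>2 + 9/64 * (v\<^sup>2 - w)\<^sup>2) / (n + 1) + 10^7 / n powr (3/2)"
  proof -
    have gen: "y + (- X) * h + 45 * (1 / N) + 11/2 * 2 * (412052 / N) \<le> y - X / (n + 1) + 10^7 / N"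
      if "0 \<le> N" for X y N :: real using that by (simp add: h_def divide_right_mono)
    show ?thesis by (rule gen) simp
  qed
  finally show ?thesis by (simp only: q_def m_def U_def w_def)
qed

section \<open>The law of the next step\<close>

definition hist_list :: "(src \<Rightarrow> 'a \<Rightarrow> int) \<Rightarrow> nat \<Rightarrow> 'a \<Rightarrow> int list" where
  "hist_list xi n w = map (\<lambda>k. stepX xi k w) [1..<Suc n]"

text \<open>List positions start at 0, steps are numbered from 1. The default 0 agrees with
  \<open>hist\<close> outside the recorded range, so \<open>hist_nat_eq_recall\<close> holds for
  every integer index.\<close>

definition recall :: "int list \<Rightarrow> int \<Rightarrow> int" where
  "recall l i = (if 1 \<le> nat i \<and> nat i \<le> length l then l ! (nat i - 1) else 0)"

text \<open>The past is passed as a list and the randomness as a map of all sources, of which only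
  those of time \<open>Suc (length l)\<close> are read. For a fixed list the value is therefore
  independent of the path so far.\<close>

definition next_step :: "int list \<Rightarrow> (src \<Rightarrow> int) \<Rightarrow> int" where
  "next_step l f = (let n = Suc (length l) in
     if n \<le> 2 then f (Init n)
     else clip (f (Alpha1 n) * recall l (f (Unif1 n)) + f (Alpha2 n) * recall l (f (Unif2 n))))"

primrec path_fun :: "nat \<Rightarrow> (src \<Rightarrow> int) \<Rightarrow> int list" where
  "path_fun 0 f = []"
| "path_fun (Suc n) f = path_fun n f @ [next_step (path_fun n f) f]"

lemma length_hist_list [simp]: "length (hist_list xi n w) = n"
  by (simp add: hist_list_def)

lemma length_path_fun [simp]: "length (path_fun n f) = n"
  by (induction n) auto

lemma hist_eq_0: "k = 0 \<or> n < k \<Longrightarrow> hist xi n w k = 0"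
  by (induction n) (auto simp: Let_def)

lemma hist_eq_stepX: "k \<le> n \<Longrightarrow> hist xi n w k = stepX xi k w"
proof (induction n)
  case (Suc n)
  then show ?case by (cases "k = Suc n") (auto simp: Let_def stepX_def)
qed (simp add: stepX_def)

lemma hist_nat_eq_recall: "hist xi n w (nat i) = recall (hist_list xi n w) i"
  using hist_eq_0[of "nat i" n xi w] hist_eq_stepX[of "nat i" n xi w]
  by (auto simp: recall_def hist_list_def nth_append simp del: upt_Suc)

lemma stepX_Suc: "stepX xi (Suc n) w = next_step (hist_list xi n w) (\<lambda>s. xi s w)"
  by (simp add: stepX_def next_step_def Let_def hist_nat_eq_recall)

lemma hist_list_Suc: "hist_list xi (Suc n) w = hist_list xi n w @ [next_step (hist_list xi n w) (\<lambda>s. xi s w)]"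
  by (subst stepX_Suc[symmetric]) (simp add: hist_list_def)

lemma hist_list_eq_path_fun: "hist_list xi n w = path_fun n (\<lambda>s. xi s w)"
  by (induction n) (simp_all add: hist_list_Suc, simp add: hist_list_def)

lemma take_hist_list: "k \<le> n \<Longrightarrow> take k (hist_list xi n w) = hist_list xi k w"
  by (simp add: hist_list_def take_map take_upt del: upt_Suc)

section \<open>Splitting the sources by time\<close>

primrec time_of :: "src \<Rightarrow> nat" where
  "time_of (Init n) = n" | "time_of (Unif1 n) = n" | "time_of (Unif2 n) = n"
| "time_of (Alpha1 n) = n" | "time_of (Alpha2 n) = n"

definition sources_upto :: "nat \<Rightarrow> src set" where "sources_upto n = {s \<in> used_src. time_of s \<le> n}"
definition sources_at :: "nat \<Rightarrow> src set" where "sources_at n = {s \<in> used_src. time_of s = n}"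

lemma finite_sources: "finite (sources_upto n)" "finite (sources_at n)"
proof -
  have "sources_upto n \<subseteq> Init ` {..n} \<union> Unif1 ` {..n} \<union> Unif2 ` {..n} \<union> Alpha1 ` {..n} \<union> Alpha2 ` {..n}"
  proof
    fix s assume "s \<in> sources_upto n"
    then show "s \<in> Init ` {..n} \<union> Unif1 ` {..n} \<union> Unif2 ` {..n} \<union> Alpha1 ` {..n} \<union> Alpha2 ` {..n}"
      by (cases s) (auto simp: sources_upto_def)
  qed
  then show "finite (sources_upto n)" by (rule finite_subset) auto
  then show "finite (sources_at n)" by (rule finite_subset[rotated]) (auto simp: sources_upto_def sources_at_def)
qed

lemma used_src_simps [simp]:
  "Init n \<in> used_src \<longleftrightarrow> n \<in> {1, 2}" "Unif1 n \<in> used_src \<longleftrightarrow> 3 \<le> n" "Unif2 n \<in> used_src \<longleftrightarrow> 3 \<le> n"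
  "Alpha1 n \<in> used_src \<longleftrightarrow> 3 \<le> n" "Alpha2 n \<in> used_src \<longleftrightarrow> 3 \<le> n"
  by (auto simp: used_src_def)

lemma next_step_restrict:
  "next_step l (restrict f (sources_at (Suc (length l)))) = next_step l f"
proof -
  have "Init (Suc (length l)) \<in> used_src" if "Suc (length l) \<le> 2" using that by (cases "length l") auto
  then show ?thesis unfolding next_step_def Let_def by (auto simp: sources_at_def)
qed

lemma path_fun_cong: "(\<And>s. s \<in> sources_upto n \<Longrightarrow> f s = g s) \<Longrightarrow> path_fun n f = path_fun n g"
proof (induction n)
  case (Suc n)
  then have eq: "path_fun n f = path_fun n g" by (simp add: sources_upto_def)
  have "restrict f (sources_at (Suc n)) = restrict g (sources_at (Suc n))"
    using Suc.prems by (auto simp: sources_upto_def sources_at_def restrict_def)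
  then have "next_step (path_fun n g) f = next_step (path_fun n g) g"
    using next_step_restrict[of "path_fun n g" f] next_step_restrict[of "path_fun n g" g] by simp
  then show ?case using eq by simp
qed simp

lemma path_fun_restrict: "path_fun n (restrict f (sources_upto n)) = path_fun n f"
  by (rule path_fun_cong) simp

text \<open>The step after a history of length less than 2 is a \<open>Rad(1/2)\<close> initial step, with second moment 1 and
  mean 0. For the empty history, \<open>path_u\<close> and \<open>path_v\<close> are 0.\<close>

definition path_u :: "int list \<Rightarrow> real" where
  "path_u l = (real (count_list l 1) + real (count_list l (-1))) / real (length l)"
definition path_v :: "int list \<Rightarrow> real" where
  "path_v l = (real (count_list l 1) - real (count_list l (-1))) / real (length l)"

definition path_sq :: "real \<Rightarrow> int list \<Rightarrow> real" where
  "path_sq p l = (if length l < 2 then 1 else step_sq (2 * p - 1) (path_u l) (path_v l))"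
definition path_mean :: "real \<Rightarrow> int list \<Rightarrow> real" where
  "path_mean p l = (if length l < 2 then 0 else step_mean (2 * p - 1) (path_u l) (path_v l))"

text \<open>The values that a path takes almost surely. The last condition records that the two
  initial steps are signs; it keeps \<open>path_u\<close> positive from time 2 on.\<close>

definition paths :: "nat \<Rightarrow> int list set" where
  "paths n = {l. length l = n \<and> set l \<subseteq> {-1, 0, 1} \<and> (\<forall>i<min n 2. l ! i \<noteq> 0)}"

lemma finite_paths: "finite (paths n)"
proof (rule finite_subset)
  show "paths n \<subseteq> {l. set l \<subseteq> {-1, 0, 1} \<and> length l = n}" by (auto simp only: paths_def mem_Collect_eq)
qed (simp add: finite_lists_length_eq)

lemma paths_Suc: "l @ [x] \<in> paths (Suc n) \<longleftrightarrow> l \<in> paths n \<and> x \<in> {-1, 0, 1} \<and> (n < 2 \<longrightarrow> x \<noteq> 0)"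
proof (cases "length l = n")
  case True
  have 1: "(\<forall>i<min (Suc n) 2. (l @ [x]) ! i \<noteq> 0) \<longleftrightarrow> (\<forall>i<min n 2. l ! i \<noteq> 0) \<and> (n < 2 \<longrightarrow> x \<noteq> 0)"
    using True by (auto simp: nth_append less_Suc_eq min_def not_less)
  have 2: "set (l @ [x]) \<subseteq> A \<longleftrightarrow> set l \<subseteq> A \<and> x \<in> A" for A by auto
  have 3: "length (l @ [x]) = Suc n \<longleftrightarrow> length l = n" by simp
  have 4: "(A \<and> (S \<and> T) \<and> (P \<and> Q)) = ((A \<and> S \<and> P) \<and> T \<and> Q)" for A S T P Q by blast
  show ?thesis unfolding paths_def mem_Collect_eq 1 2 3 4 ..
qed (simp add: paths_def)

text \<open>A finite product of discrete countable spaces is discrete, so every function of finitely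
  many sources is measurable.\<close>

lemma PiM_int_eq_count_space:
  "finite A \<Longrightarrow> PiM A (\<lambda>_. count_space (UNIV :: int set)) = count_space (PiE A (\<lambda>_. UNIV))"
  by (intro count_space_PiM_finite) auto

lemma set_pmf_rad: "set_pmf (rad q) \<subseteq> {-1, 1}"
  by (auto simp: rad_def)

lemma pmf_rad: "0 \<le> q \<Longrightarrow> q \<le> 1 \<Longrightarrow> pmf (rad q) x = (if x = 1 then q else if x = -1 then 1 - q else 0)"
proof -
  assume q: "0 \<le> q" "q \<le> 1"
  have "inj (\<lambda>b. if b then 1 else - 1 :: int)" by (auto simp: inj_def)
  from pmf_map_inj'[OF this, of "bernoulli_pmf q"] q
  have "pmf (rad q) 1 = q" "pmf (rad q) (-1) = 1 - q"
    unfolding rad_def by (metis (full_types) pmf_bernoulli_True, metis (full_types) pmf_bernoulli_False)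
  moreover have "pmf (rad q) x = 0" if "x \<noteq> 1" "x \<noteq> -1"
    using set_pmf_rad[of q] that by (auto simp: pmf_eq_0_set_pmf)
  ultimately show ?thesis by auto
qed

section \<open>Independence of blocks of sources and the law of one step\<close>

locale two_memory_walk = prob_space M for M :: "'a measure" +
  fixes xi :: "src \<Rightarrow> 'a \<Rightarrow> int" and p :: real
  assumes p01: "0 < p" "p < 1"
    and indep: "indep_vars (\<lambda>_. count_space UNIV) xi used_src"
    and dist_init: "\<And>k. k \<in> {1, 2} \<Longrightarrow>
           distr M (count_space UNIV) (xi (Init k)) = measure_pmf (rad (1/2))"
    and dist_U: "\<And>n. n \<ge> 2 \<Longrightarrow>
           distr M (count_space UNIV) (xi (Unif1 (Suc n))) = measure_pmf (pmf_of_set {1..int n})"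
           "\<And>n. n \<ge> 2 \<Longrightarrow>
           distr M (count_space UNIV) (xi (Unif2 (Suc n))) = measure_pmf (pmf_of_set {1..int n})"
    and dist_A: "\<And>n. n \<ge> 2 \<Longrightarrow>
           distr M (count_space UNIV) (xi (Alpha1 (Suc n))) = measure_pmf (rad p)"
           "\<And>n. n \<ge> 2 \<Longrightarrow>
           distr M (count_space UNIV) (xi (Alpha2 (Suc n))) = measure_pmf (rad p)"
begin

abbreviation "X w \<equiv> (\<lambda>s. xi s w)"

lemma xi_measurable: "s \<in> used_src \<Longrightarrow> xi s \<in> measurable M (count_space UNIV)"
  using indep by (auto simp: indep_vars_def)

text \<open>The equation \<open>P (restrict f A) = P f\<close> expresses that \<open>P\<close> reads
  only the sources in \<open>A\<close>.\<close>

lemma block_measurable: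
  assumes A: "finite A" "A \<subseteq> used_src" and P: "\<And>f. P (restrict f A) = P f"
  shows "(\<lambda>w. P (X w)) \<in> measurable M (count_space UNIV)"
proof -
  have "(\<lambda>w. restrict (X w) A) \<in> measurable M (PiM A (\<lambda>_. count_space UNIV))"
    using A xi_measurable by (intro measurable_restrict) auto
  from measurable_compose[OF this, of P "count_space UNIV"] show ?thesis
    using A by (simp add: PiM_int_eq_count_space P)
qed

lemma block_set_measurable:
  assumes "finite A" "A \<subseteq> used_src" "\<And>f. P (restrict f A) = P f"
  shows "{w \<in> space M. P (X w)} \<in> events"
proof -
  have "{w \<in> space M. P (X w)} = (\<lambda>w. P (X w)) -` {True} \<inter> space M" by auto
  then show ?thesis using measurable_sets[OF block_measurable[of A P, OF assms], of "{True}"] by simp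
qed

lemma block_indep:
  assumes A: "finite A" "A \<subseteq> used_src" "\<And>f. P (restrict f A) = P f"
    and B: "finite B" "B \<subseteq> used_src" "\<And>f. Q (restrict f B) = Q f"
    and AB: "A \<inter> B = {}"
  shows "prob {w \<in> space M. P (X w) \<and> Q (X w)} = prob {w \<in> space M. P (X w)} * prob {w \<in> space M. Q (X w)}"
proof -
  have "indep_var (PiM A (\<lambda>_. count_space UNIV)) (\<lambda>w. restrict (X w) A)
     (PiM B (\<lambda>_. count_space UNIV)) (\<lambda>w. restrict (X w) B)"
    using indep_var_restrict[OF indep AB A(2) B(2)] .
  from indep_var_compose[OF this, of P "count_space UNIV" Q "count_space UNIV"]
  have "indep_var (count_space UNIV) (\<lambda>w. P (X w)) (count_space UNIV) (\<lambda>w. Q (X w))"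
    using A B by (simp add: PiM_int_eq_count_space comp_def)
  from prob_indep_random_variable[OF this, of "{True}" "{True}"] show ?thesis by simp
qed

lemma hist_list_measurable: "hist_list xi n \<in> measurable M (count_space UNIV)"
proof -
  have "(\<lambda>w. restrict (X w) (sources_upto n)) \<in> measurable M (PiM (sources_upto n) (\<lambda>_. count_space UNIV))"
    using xi_measurable by (intro measurable_restrict) (auto simp: sources_upto_def)
  from measurable_compose[OF this, of "path_fun n" "count_space UNIV"] have
    "(\<lambda>w. path_fun n (X w)) \<in> measurable M (count_space UNIV)"
    by (simp add: PiM_int_eq_count_space finite_sources path_fun_restrict)
  then show ?thesis by (simp add: hist_list_eq_path_fun[abs_def])
qed

lemma hist_list_set_measurable [measurable]: "{w \<in> space M. P (hist_list xi n w)} \<in> events"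
  using measurable_sets[OF hist_list_measurable, of "{l. P l}" n] by (simp add: vimage_def Int_def conj_ac)

lemma borel_measurable_hist_list [measurable]: "(\<lambda>w. F (hist_list xi n w)) \<in> borel_measurable M"
  using measurable_compose[OF hist_list_measurable, of F borel] by simp

lemma next_set_measurable: "length l = n \<Longrightarrow> {w \<in> space M. next_step l (X w) = x} \<in> events"
proof (rule block_set_measurable[of "sources_at (Suc n)" "\<lambda>f. next_step l f = x"])
  assume "length l = n"
  then show "(next_step l (restrict f (sources_at (Suc n))) = x) = (next_step l f = x)" for f
    using next_step_restrict[of l f] by simp
qed (auto simp: finite_sources, auto simp: sources_at_def)

lemma prob_hist_list_next:
  assumes "length l = n"
  shows "prob {w \<in> space M. hist_list xi n w = l \<and> next_step l (X w) = x}
    = prob {w \<in> space M. hist_list xi n w = l} * prob {w \<in> space M. next_step l (X w) = x}"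
  unfolding hist_list_eq_path_fun
proof (rule block_indep[of "sources_upto n" "\<lambda>f. path_fun n f = l" "sources_at (Suc n)"])
  show "(path_fun n (restrict f (sources_upto n)) = l) = (path_fun n f = l)" for f
    by (simp add: path_fun_restrict)
  show "(next_step l (restrict f (sources_at (Suc n))) = x) = (next_step l f = x)" for f
    using next_step_restrict[of l f] assms by simp
qed (auto simp: finite_sources, auto simp: sources_upto_def sources_at_def)

lemma prob_xi:
  assumes "s \<in> used_src" "distr M (count_space UNIV) (xi s) = measure_pmf \<mu>"
  shows "prob {w \<in> space M. xi s w \<in> A} = measure_pmf.prob \<mu> A"
proof -
  have "measure_pmf.prob \<mu> A = measure (distr M (count_space UNIV) (xi s)) A" using assms by simp
  also have "\<dots> = prob {w \<in> space M. xi s w \<in> A}"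
    using xi_measurable[OF assms(1)] by (subst measure_distr) (auto simp: vimage_def Int_def conj_commute)
  finally show ?thesis by simp
qed

lemma AE_xi:
  assumes "s \<in> used_src" "distr M (count_space UNIV) (xi s) = measure_pmf \<mu>"
  shows "AE w in M. xi s w \<in> set_pmf \<mu>"
proof -
  have "AE i in distr M (count_space UNIV) (xi s). i \<in> set_pmf \<mu>"
    unfolding assms(2) by (simp add: AE_measure_pmf_iff)
  then show ?thesis using xi_measurable[OF assms(1)] by (subst (asm) AE_distr_iff) auto
qed

text \<open>A uniform index gives the recalled step the empirical frequencies of \<open>l\<close>;
  an independent sign keeps it with probability \<open>p\<close> and reverses it otherwise.\<close>

lemma prob_channel:
  assumes n: "2 \<le> n" "length l = n" and ab: "a \<in> used_src" "b \<in> used_src" "a \<noteq> b"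
    and da: "distr M (count_space UNIV) (xi a) = measure_pmf (rad p)"
    and db: "distr M (count_space UNIV) (xi b) = measure_pmf (pmf_of_set {1..int n})"
  shows "prob {w \<in> space M. xi a w * recall l (xi b w) = z} =
    (p * real (count_list l z) + (1 - p) * real (count_list l (- z))) / real n"
proof -
  have P1: "prob {w \<in> space M. recall l (xi b w) = y} = real (count_list l y) / real n" for y
  proof -
    have "prob {w \<in> space M. recall l (xi b w) = y} = prob {w \<in> space M. xi b w \<in> {i. recall l i = y}}" by simp
    also have "\<dots> = measure_pmf.prob (pmf_of_set {1..int n}) {i. recall l i = y}" by (rule prob_xi[OF ab(2) db])
    also have "\<dots> = real (card ({1..int n} \<inter> {i. recall l i = y})) / real n"
      using n by (subst measure_pmf_of_set) auto
    also have "card ({1..int n} \<inter> {i. recall l i = y}) = card {i. i < length l \<and> l ! i = y}"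
    proof (rule bij_betw_same_card[of "\<lambda>i. nat i - 1"], rule bij_betw_byWitness[where f' = "\<lambda>i. int i + 1"])
    qed (use n in \<open>auto simp: recall_def nat_add_distrib split: if_splits\<close>)
    also have "\<dots> = count_list l y" by (simp add: count_list_eq_length_filter length_filter_conv_card eq_commute)
    finally show ?thesis .
  qed
  have P2: "prob {w \<in> space M. xi a w = s \<and> recall l (xi b w) = y} = pmf (rad p) s * (real (count_list l y) / real n)" for s y
  proof -
    have "prob {w \<in> space M. X w a = s \<and> recall l (X w b) = y}
        = prob {w \<in> space M. X w a = s} * prob {w \<in> space M. recall l (X w b) = y}"
      using ab by (intro block_indep[of "{a}" "\<lambda>f. f a = s" "{b}" "\<lambda>f. recall l (f b) = y"]) auto
    moreover have "prob {w \<in> space M. xi a w \<in> {s}} = pmf (rad p) s"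
      using prob_xi[OF ab(1) da, of "{s}"] by (simp add: pmf.rep_eq)
    ultimately show ?thesis using P1 by simp
  qed
  have m: "{w \<in> space M. R (xi a w) (xi b w)} \<in> events" for R
    using ab by (intro block_set_measurable[of "{a, b}" "\<lambda>f. R (f a) (f b)"]) auto
  have "prob {w \<in> space M. xi a w * recall l (xi b w) = z}
      = prob ({w \<in> space M. xi a w = 1 \<and> recall l (xi b w) = z} \<union> {w \<in> space M. xi a w = -1 \<and> recall l (xi b w) = - z})"
  proof (rule finite_measure_eq_AE)
    show "AE w in M. (w \<in> {w \<in> space M. xi a w * recall l (xi b w) = z}) =
      (w \<in> {w \<in> space M. xi a w = 1 \<and> recall l (xi b w) = z} \<union> {w \<in> space M. xi a w = -1 \<and> recall l (xi b w) = - z})"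
      using AE_xi[OF ab(1) da] by eventually_elim (use set_pmf_rad[of p] in auto)
  qed (intro m sets.Un)+
  also have "\<dots> = prob {w \<in> space M. xi a w = 1 \<and> recall l (xi b w) = z} + prob {w \<in> space M. xi a w = -1 \<and> recall l (xi b w) = - z}"
    by (intro finite_measure_Union m) auto
  also have "\<dots> = (p * real (count_list l z) + (1 - p) * real (count_list l (- z))) / real n"
    unfolding P2 using p01 by (simp add: pmf_rad add_divide_distrib)
  finally show ?thesis .
qed

lemma prob_next:
  assumes l: "l \<in> paths n"
  shows "prob {w \<in> space M. next_step l (X w) = 1} = (path_sq p l + path_mean p l) / 2"
    and "prob {w \<in> space M. next_step l (X w) = -1} = (path_sq p l - path_mean p l) / 2"
    and "AE w in M. next_step l (X w) \<in> {-1, 0, 1} \<and> (n < 2 \<longrightarrow> next_step l (X w) \<noteq> 0)"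
proof -
  have len: "length l = n" and set: "set l \<subseteq> {-1, 0, 1}" using l by (auto simp: paths_def)
  have "prob {w \<in> space M. next_step l (X w) = 1} = (path_sq p l + path_mean p l) / 2 \<and>
    prob {w \<in> space M. next_step l (X w) = -1} = (path_sq p l - path_mean p l) / 2 \<and>
    (AE w in M. next_step l (X w) \<in> {-1, 0, 1} \<and> (n < 2 \<longrightarrow> next_step l (X w) \<noteq> 0))"
  proof (cases "n < 2")
    case True
    then have k: "Suc n \<in> {1, 2}" "Init (Suc n) \<in> used_src" by auto
    have "prob {w \<in> space M. xi (Init (Suc n)) w = x} = pmf (rad (1/2)) x" for x
      using prob_xi[OF k(2) dist_init[OF k(1)], of "{x}"] by (simp add: pmf.rep_eq)
    moreover have "AE w in M. xi (Init (Suc n)) w \<in> {-1, 1}"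
      using AE_xi[OF k(2) dist_init[OF k(1)]] by eventually_elim (use set_pmf_rad in auto)
    ultimately show ?thesis using True len
      by (auto simp: next_step_def Let_def path_sq_def path_mean_def pmf_rad)
  next
    case False
    then have n2: "2 \<le> n" by simp
    let ?Z1 = "\<lambda>f :: src \<Rightarrow> int. f (Alpha1 (Suc n)) * recall l (f (Unif1 (Suc n)))"
    let ?Z2 = "\<lambda>f :: src \<Rightarrow> int. f (Alpha2 (Suc n)) * recall l (f (Unif2 (Suc n)))"
    have next_eq: "next_step l f = clip (?Z1 f + ?Z2 f)" for f
      using n2 len by (simp add: next_step_def Let_def)
    define b where "b = (\<lambda>z. (p * real (count_list l z) + (1 - p) * real (count_list l (- z))) / real n)"
    have Z: "prob {w \<in> space M. ?Z1 (X w) = z} = b z" "prob {w \<in> space M. ?Z2 (X w) = z} = b z" for z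
      unfolding b_def using n2 len by (intro prob_channel dist_A dist_U; simp)+
    have ZZ: "prob {w \<in> space M. ?Z1 (X w) = z \<and> ?Z2 (X w) = z'} = b z * b z'" for z z'
    proof -
      have "prob {w \<in> space M. ?Z1 (X w) = z \<and> ?Z2 (X w) = z'}
        = prob {w \<in> space M. ?Z1 (X w) = z} * prob {w \<in> space M. ?Z2 (X w) = z'}"
      using n2 by (intro block_indep[of "{Alpha1 (Suc n), Unif1 (Suc n)}" "\<lambda>f. ?Z1 f = z" "{Alpha2 (Suc n), Unif2 (Suc n)}" "\<lambda>f. ?Z2 f = z'"]) auto
      then show ?thesis unfolding Z .
    qed
    have m: "{w \<in> space M. R (?Z1 (X w)) (?Z2 (X w))} \<in> events" for R
      using n2 by (intro block_set_measurable[of "{Alpha1 (Suc n), Unif1 (Suc n), Alpha2 (Suc n), Unif2 (Suc n)}"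
          "\<lambda>f. R (?Z1 f) (?Z2 f)"]) auto
    have recall_l: "recall l i \<in> {-1, 0, 1}" for i
    proof (cases "1 \<le> nat i \<and> nat i \<le> length l")
      case True
      then have "l ! (nat i - 1) \<in> set l" by (intro nth_mem) auto
      then show ?thesis using set True by (auto simp: recall_def)
    qed (auto simp: recall_def)
    have AEZ: "AE w in M. ?Z1 (X w) \<in> {-1, 0, 1} \<and> ?Z2 (X w) \<in> {-1, 0, 1}"
    proof -
      have "AE w in M. xi (Alpha1 (Suc n)) w \<in> set_pmf (rad p)" "AE w in M. xi (Alpha2 (Suc n)) w \<in> set_pmf (rad p)"
        using n2 by (intro AE_xi dist_A; simp)+
      then show ?thesis
      proof eventually_elim
        case (elim w)
        then have "xi (Alpha1 (Suc n)) w \<in> {-1, 1}" "xi (Alpha2 (Suc n)) w \<in> {-1, 1}"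
          using set_pmf_rad by auto
        with recall_l[of "xi (Unif1 (Suc n)) w"] recall_l[of "xi (Unif2 (Suc n)) w"] show ?case by auto
      qed
    qed
    \<comment> \<open>After clipping, the step is \<open>s\<close> exactly when both channels give
      \<open>s\<close>, or one gives \<open>s\<close> and the other 0; opposite signs
      cancel.\<close>
    have pr: "prob {w \<in> space M. next_step l (X w) = s} = b s * b s + (b s * b 0 + b 0 * b s)" if s: "s = 1 \<or> s = -1" for s
    proof -
      let ?E = "\<lambda>z z'. {w \<in> space M. ?Z1 (X w) = z \<and> ?Z2 (X w) = z'}"
      have "prob {w \<in> space M. next_step l (X w) = s} = prob (?E s s \<union> (?E s 0 \<union> ?E 0 s))"
        unfolding next_eq
      proof (rule finite_measure_eq_AE)
        show "AE w in M. (w \<in> {w \<in> space M. clip (?Z1 (X w) + ?Z2 (X w)) = s}) = (w \<in> ?E s s \<union> (?E s 0 \<union> ?E 0 s))"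
          using AEZ by eventually_elim (use s in \<open>auto simp: clip_def\<close>)
      qed (intro m sets.Un)+
      also have "\<dots> = prob (?E s s) + prob (?E s 0 \<union> ?E 0 s)"
        using s by (intro finite_measure_Union m sets.Un) auto
      also have "prob (?E s 0 \<union> ?E 0 s) = prob (?E s 0) + prob (?E 0 s)"
        using s by (intro finite_measure_Union m) auto
      finally show ?thesis unfolding ZZ .
    qed
    have "real (count_list l 1) + real (count_list l (-1)) + real (count_list l 0) = real n"
    proof -
      have "count_list l 1 + count_list l (-1) + count_list l 0 = length l" using set
        by (induction l) auto
      then show ?thesis using len by linarith
    qed
    then have c0: "real (count_list l 0) = real n - real (count_list l 1) - real (count_list l (-1))" by linarith
    define x where "x = real (count_list l 1) / real n"
    define y where "y = real (count_list l (-1)) / real n"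
    have b: "b 1 = p * x + (1 - p) * y" "b (-1) = p * y + (1 - p) * x" "b 0 = 1 - x - y"
      unfolding b_def x_def y_def c0 minus_minus minus_zero using n2
      by (simp_all add: add_divide_distrib diff_divide_distrib algebra_simps)
    have uv: "path_u l = x + y" "path_v l = x - y"
      by (simp_all add: path_u_def path_v_def x_def y_def len add_divide_distrib diff_divide_distrib)
    have "next_step l f \<in> {-1, 0, 1}" for f unfolding next_eq by (auto simp: clip_def)
    then show ?thesis
      using pr[of 1] pr[of "-1"] n2 len unfolding b
      by (simp add: path_sq_def path_mean_def step_sq_def step_mean_def uv power2_eq_square field_simps)
  qed
  then show "prob {w \<in> space M. next_step l (X w) = 1} = (path_sq p l + path_mean p l) / 2"
    and "prob {w \<in> space M. next_step l (X w) = -1} = (path_sq p l - path_mean p l) / 2"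
    and "AE w in M. next_step l (X w) \<in> {-1, 0, 1} \<and> (n < 2 \<longrightarrow> next_step l (X w) \<noteq> 0)" by auto
qed

lemma prob_next_0:
  assumes l: "l \<in> paths n"
  shows "prob {w \<in> space M. next_step l (X w) = 0} = 1 - path_sq p l"
proof -
  let ?E = "\<lambda>x. {w \<in> space M. next_step l (X w) = x}"
  have m: "?E x \<in> events" for x using l by (intro next_set_measurable[of _ n]) (auto simp: paths_def)
  have "1 = prob (space M)" by (simp add: prob_space)
  also have "\<dots> = prob (?E 1 \<union> (?E (-1) \<union> ?E 0))"
    using prob_next(3)[OF l] m
    by (intro finite_measure_eq_AE sets.Un sets.top) (auto elim: AE_mp)
  also have "\<dots> = prob (?E 1) + (prob (?E (-1)) + prob (?E 0))"
    by (subst finite_measure_Union; (intro m sets.Un)?; auto)+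
  also have "\<dots> = path_sq p l + prob (?E 0)" unfolding prob_next(1,2)[OF l] by (simp add: field_simps)
  finally show ?thesis by simp
qed

section \<open>Expectations as finite sums over paths\<close>

lemma AE_hist_list: "AE w in M. hist_list xi n w \<in> paths n"
proof (induction n)
  case (Suc n)
  have "AE w in M. \<forall>l\<in>paths n. next_step l (X w) \<in> {-1, 0, 1} \<and> (n < 2 \<longrightarrow> next_step l (X w) \<noteq> 0)"
    using finite_paths prob_next(3) by (subst AE_ball_countable) (auto intro: countable_finite)
  with Suc show ?case by eventually_elim (auto simp: hist_list_Suc paths_Suc)
qed (simp add: paths_def hist_list_def)

lemma integrable_hist_list: "integrable M (\<lambda>w. F (hist_list xi n w) :: real)"
proof (rule integrable_const_bound[of _ "\<Sum>l\<in>paths n. \<bar>F l\<bar>"])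
  show "AE w in M. norm (F (hist_list xi n w)) \<le> (\<Sum>l\<in>paths n. \<bar>F l\<bar>)"
    using AE_hist_list[of n]
  proof eventually_elim
    case (elim w)
    then show ?case using member_le_sum[of "hist_list xi n w" "paths n" "\<lambda>l. \<bar>F l\<bar>"] finite_paths by simp
  qed
qed simp

lemma integrable_scaled_indicator: "S \<in> events \<Longrightarrow> integrable M (\<lambda>w. a * indicator S w :: real)"
  by (intro integrable_mult_right integrable_real_indicator) (simp_all add: less_top[symmetric])

lemma expectation_scaled_indicator: "S \<in> events \<Longrightarrow> expectation (\<lambda>w. a * indicator S w) = a * prob S"
  by (simp add: sets.Int_space_eq2)

lemma expectation_hist_list: "expectation (\<lambda>w. F (hist_list xi n w)) = (\<Sum>l\<in>paths n. F l * prob {w \<in> space M. hist_list xi n w = l})"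
proof -
  have m: "{w \<in> space M. hist_list xi n w = l} \<in> events" for l
    by (rule hist_list_set_measurable[of "\<lambda>l'. l' = l"])
  have "expectation (\<lambda>w. F (hist_list xi n w))
     = expectation (\<lambda>w. \<Sum>l\<in>paths n. F l * indicator {w \<in> space M. hist_list xi n w = l} w)"
  proof (rule integral_cong_AE)
    show "AE w in M. F (hist_list xi n w) = (\<Sum>l\<in>paths n. F l * indicator {w \<in> space M. hist_list xi n w = l} w)"
      using AE_hist_list[of n]  AE_space
    proof eventually_elim
      case (elim w)
      have "(\<Sum>l\<in>paths n. F l * indicator {w \<in> space M. hist_list xi n w = l} w)
         = (\<Sum>l\<in>paths n. if hist_list xi n w = l then F l else 0)"
        using elim by (intro sum.cong) auto
      then show ?case using elim finite_paths by (simp add: sum.delta)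
    qed
  qed auto
  also have "\<dots> = (\<Sum>l\<in>paths n. F l * prob {w \<in> space M. hist_list xi n w = l})"
    by (subst Bochner_Integration.integral_sum)
      (simp_all only: expectation_scaled_indicator integrable_scaled_indicator m)
  finally show ?thesis .
qed

text \<open>The Markov property in integrated form: both sides are sums over the finitely many
  paths, and the event that the path equals \<open>l\<close> is independent of
  \<open>next_step l\<close>.\<close>

lemma expectation_one_step:
  "expectation (\<lambda>w. F (hist_list xi (Suc n) w)) =
   expectation (\<lambda>w. tmean (path_sq p (hist_list xi n w)) (path_mean p (hist_list xi n w)) (\<lambda>x. F (hist_list xi n w @ [x])))"
proof -
  let ?E = "\<lambda>l x. {w \<in> space M. hist_list xi n w = l \<and> next_step l (X w) = x}"
  have mE: "?E l x \<in> events" if "l \<in> paths n" for l x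
  proof -
    have "?E l x = {w \<in> space M. hist_list xi n w = l} \<inter> {w \<in> space M. next_step l (X w) = x}" by auto
    then show ?thesis using next_set_measurable[of l n x] that by (auto simp: paths_def)
  qed
  have "expectation (\<lambda>w. F (hist_list xi (Suc n) w))
     = expectation (\<lambda>w. \<Sum>l\<in>paths n. \<Sum>x\<in>{-1, 0, 1}. F (l @ [x]) * indicator (?E l x) w)"
  proof (rule integral_cong_AE)
    show "AE w in M. F (hist_list xi (Suc n) w) = (\<Sum>l\<in>paths n. \<Sum>x\<in>{-1, 0, 1}. F (l @ [x]) * indicator (?E l x) w)"
      using AE_hist_list[of n] AE_hist_list[of "Suc n"] AE_space
    proof eventually_elim
      case (elim w)
      have "(\<Sum>l\<in>paths n. \<Sum>x\<in>{-1, 0, 1}. F (l @ [x]) * indicator (?E l x) w)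
         = (\<Sum>l\<in>paths n. if hist_list xi n w = l then (\<Sum>x\<in>{-1, 0, 1}. if next_step l (X w) = x then F (l @ [x]) else 0) else 0)"
        using elim by (intro sum.cong) (auto simp: indicator_def)
      also have "\<dots> = (\<Sum>x\<in>{-1, 0, 1}. if next_step (hist_list xi n w) (X w) = x then F (hist_list xi n w @ [x]) else 0)"
        using elim finite_paths by (simp add: sum.delta del: sum.insert)
      also have "\<dots> = F (hist_list xi (Suc n) w)"
        using elim by (subst sum.delta') (auto simp: hist_list_Suc paths_Suc)
      finally show ?case by simp
    qed
    show "(\<lambda>w. \<Sum>l\<in>paths n. \<Sum>x\<in>{-1, 0, 1}. F (l @ [x]) * indicator (?E l x) w) \<in> borel_measurable M"
      using mE by (intro borel_measurable_sum borel_measurable_times borel_measurable_indicator) auto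
  qed simp
  also have "\<dots> = (\<Sum>l\<in>paths n. \<Sum>x\<in>{-1, 0, 1}. F (l @ [x]) * prob (?E l x))"
  proof (subst Bochner_Integration.integral_sum)
    show "integrable M (\<lambda>w. \<Sum>x\<in>{-1, 0, 1}. F (l @ [x]) * indicator (?E l x) w)" if "l \<in> paths n" for l
      using mE[OF that] by (intro Bochner_Integration.integrable_sum integrable_scaled_indicator)
    show "(\<Sum>l\<in>paths n. expectation (\<lambda>w. \<Sum>x\<in>{-1, 0, 1}. F (l @ [x]) * indicator (?E l x) w))
        = (\<Sum>l\<in>paths n. \<Sum>x\<in>{-1, 0, 1}. F (l @ [x]) * prob (?E l x))"
    proof (rule sum.cong[OF refl])
      fix l assume "l \<in> paths n"
      from mE[OF this]
      show "expectation (\<lambda>w. \<Sum>x\<in>{-1, 0, 1}. F (l @ [x]) * indicator (?E l x) w)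
        = (\<Sum>x\<in>{-1, 0, 1}. F (l @ [x]) * prob (?E l x))"
        by (subst Bochner_Integration.integral_sum)
          (simp_all only: expectation_scaled_indicator integrable_scaled_indicator)
    qed
  qed
  also have "\<dots> = (\<Sum>l\<in>paths n. tmean (path_sq p l) (path_mean p l) (\<lambda>x. F (l @ [x])) * prob {w \<in> space M. hist_list xi n w = l})"
  proof (rule sum.cong[OF refl])
    fix l assume l: "l \<in> paths n"
    then have "length l = n" by (simp add: paths_def)
    from prob_hist_list_next[OF this]
    show "(\<Sum>x\<in>{-1, 0, 1}. F (l @ [x]) * prob (?E l x))
      = tmean (path_sq p l) (path_mean p l) (\<lambda>x. F (l @ [x])) * prob {w \<in> space M. hist_list xi n w = l}"
      by (simp add: prob_next(1,2)[OF l] prob_next_0[OF l] tmean_def algebra_simps)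
  qed
  also have "\<dots> = expectation (\<lambda>w. tmean (path_sq p (hist_list xi n w)) (path_mean p (hist_list xi n w)) (\<lambda>x. F (hist_list xi n w @ [x])))"
    by (rule expectation_hist_list[symmetric])
  finally show ?thesis .
qed

end

section \<open>Lyapunov arguments for the walk\<close>

lemma count_list_pm_le_length: "count_list l 1 + count_list l (-1) \<le> length (l :: int list)"
  by (induction l) auto

text \<open>Division by 0 yields 0, so with \<open>N = 0\<close> the recursion also covers the first
  step.\<close>

lemma running_mean_step:
  fixes n :: nat and N y :: real
  assumes "n = 0 \<Longrightarrow> N = 0"
  shows "(N + y) / (real n + 1) = N / real n + (y - N / real n) / (real n + 1)"
proof (cases "n = 0")
  case False
  have "(a * real n + y) / (real n + 1) = a + (y - a) / (real n + 1)" for a :: real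
    by (simp add: field_simps)
  from this[of "N / real n"] False show ?thesis by simp
qed (use assms in simp)

lemma path_u_snoc:
  assumes "x \<in> {-1, 0, 1}"
  shows "path_u (l @ [x]) = path_u l + ((real_of_int x)\<^sup>2 - path_u l) / (real (length l) + 1)"
proof -
  have "path_u (l @ [x]) = (real (count_list l 1) + real (count_list l (-1)) + (real_of_int x)\<^sup>2) / (real (length l) + 1)"
    using assms by (auto simp: path_u_def add_ac)
  then show ?thesis unfolding path_u_def by (subst running_mean_step[symmetric]) simp_all
qed

lemma path_v_snoc:
  assumes "x \<in> {-1, 0, 1}"
  shows "path_v (l @ [x]) = path_v l + (real_of_int x - path_v l) / (real (length l) + 1)"
proof -
  have "path_v (l @ [x]) = (real (count_list l 1) - real (count_list l (-1)) + real_of_int x) / (real (length l) + 1)"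
    using assms by (auto simp: path_v_def add_ac)
  then show ?thesis unfolding path_v_def by (subst running_mean_step[symmetric]) simp_all
qed

lemma path_uv_bounds: "0 \<le> path_u l" "path_u l \<le> 1" "\<bar>path_v l\<bar> \<le> path_u l"
proof -
  have "real (count_list l 1 + count_list l (-1)) \<le> real (length l)"
    using count_list_pm_le_length[of l] by (simp only: of_nat_le_iff)
  then show "path_u l \<le> 1" by (auto simp: path_u_def divide_le_eq)
  show "0 \<le> path_u l" by (simp add: path_u_def)
  show "\<bar>path_v l\<bar> \<le> path_u l" unfolding path_v_def path_u_def abs_divide
    by (auto intro!: divide_right_mono)
qed

lemma path_v_le_1: "\<bar>path_v l\<bar> \<le> 1"
  using path_uv_bounds[of l] by linarith

lemma paths_count_ge_2:
  assumes "l \<in> paths n" "2 \<le> n"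
  shows "2 \<le> count_list l 1 + count_list l (-1)"
proof -
  obtain a b l' where l: "l = a # b # l'" using assms
    by (cases l; cases "tl l") (auto simp: paths_def)
  have "l ! 0 \<noteq> 0" "l ! 1 \<noteq> 0" "set l \<subseteq> {-1, 0, 1}" using assms by (auto simp: paths_def)
  then have "a \<in> {-1, 1}" "b \<in> {-1, 1}" by (auto simp: l)
  then show ?thesis by (auto simp: l)
qed

text \<open>On \<open>[1/6, 1/3]\<close> the vanishing quantity is bounded below, and small increments cannot jump
  across this interval.\<close>

lemma eventually_ge_third:
  fixes u :: "nat \<Rightarrow> real"
  assumes lim: "(\<lambda>n. max 0 (1/2 - u n) * u n) \<longlonglongrightarrow> 0" and u0: "\<And>n. 0 \<le> u n"
    and var: "\<And>n. \<bar>u (Suc n) - u n\<bar> \<le> 1 / real (Suc n)" and nz: "\<not> u \<longlonglongrightarrow> 0"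
  shows "\<forall>\<^sub>F n in sequentially. 1/3 \<le> u n"
proof -
  have "\<forall>\<^sub>F n in sequentially. max 0 (1/2 - u n) * u n < 1/36"
    using order_tendstoD(2)[OF lim, of "1/36"] by simp
  moreover have "\<forall>\<^sub>F n in sequentially. 1 / real (Suc n) < 1/6"
    using order_tendstoD(2)[OF LIMSEQ_inverse_real_of_nat, of "1/6"] by (simp add: inverse_eq_divide)
  ultimately have "\<forall>\<^sub>F n in sequentially. max 0 (1/2 - u n) * u n < 1/36 \<and> 1 / real (Suc n) < 1/6"
    by eventually_elim auto
  then obtain N where N: "\<And>n. N \<le> n \<Longrightarrow> max 0 (1/2 - u n) * u n < 1/36" "\<And>n. N \<le> n \<Longrightarrow> 1 / real (Suc n) < 1/6"
    unfolding eventually_sequentially by blast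
  have gap: "u n < 1/6 \<or> 1/3 < u n" if "N \<le> n" for n
  proof (rule ccontr)
    assume "\<not> (u n < 1/6 \<or> 1/3 < u n)"
    then have "1/6 * (1/6) \<le> max 0 (1/2 - u n) * u n" by (intro mult_mono) auto
    then show False using N(1)[OF that] by simp
  qed
  show ?thesis
  proof (cases "\<exists>n\<ge>N. 1/3 < u n")
    case True
    then obtain n0 where n0: "N \<le> n0" "1/3 < u n0" by blast
    have "1/3 < u n" if "n0 \<le> n" for n
      using that
    proof (induction n rule: dec_induct)
      case (step n)
      then show ?case using gap[of "Suc n"] var[of n] N(2)[of n] n0 by linarith
    qed (rule n0)
    then show ?thesis unfolding eventually_sequentially by (meson less_imp_le)
  next
    case False
    then have small: "u n < 1/6" if "N \<le> n" for n using gap[OF that] that by auto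
    have "u \<longlonglongrightarrow> 0"
    proof (rule tendsto_sandwich[OF _ _ tendsto_const])
      show "(\<lambda>n. 3 * (max 0 (1/2 - u n) * u n)) \<longlonglongrightarrow> 0" using tendsto_mult_left[OF lim, of 3] by simp
      show "\<forall>\<^sub>F n in sequentially. u n \<le> 3 * (max 0 (1/2 - u n) * u n)"
        unfolding eventually_sequentially
      proof (intro exI allI impI)
        fix n assume "N \<le> n"
        then have "1/3 * u n \<le> max 0 (1/2 - u n) * u n" using small[of n] u0 by (intro mult_right_mono) auto
        then show "u n \<le> 3 * (max 0 (1/2 - u n) * u n)" by simp
      qed
    qed (use u0 in auto)
    with nz show ?thesis by blast
  qed
qed

text \<open>Eventually \<open>\<bar>v n\<bar> > sqrt w / 2\<close> while one step moves by less than
  \<open>sqrt w\<close>, so \<open>v\<close> cannot cross 0 any more and its sign is eventually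
  constant.\<close>

lemma tendsto_sqrt_or_minus:
  fixes v :: "nat \<Rightarrow> real"
  assumes lim: "(\<lambda>n. (v n)\<^sup>2) \<longlonglongrightarrow> w" and w: "0 < w"
    and var: "\<And>n. \<bar>v (Suc n) - v n\<bar> \<le> 2 / real (Suc n)"
  shows "v \<longlonglongrightarrow> sqrt w \<or> v \<longlonglongrightarrow> - sqrt w"
proof -
  have abs: "(\<lambda>n. \<bar>v n\<bar>) \<longlonglongrightarrow> sqrt w" using tendsto_real_sqrt[OF lim] by simp
  have "\<forall>\<^sub>F n in sequentially. sqrt w / 2 < \<bar>v n\<bar>" using order_tendstoD(1)[OF abs, of "sqrt w / 2"] w by simp
  moreover have "(\<lambda>n. 2 * inverse (real (Suc n))) \<longlonglongrightarrow> 2 * 0"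
    by (intro tendsto_mult tendsto_const LIMSEQ_inverse_real_of_nat)
  then have "\<forall>\<^sub>F n in sequentially. 2 / real (Suc n) < sqrt w"
    using order_tendstoD(2)[of "\<lambda>n. 2 * inverse (real (Suc n))" 0 sequentially "sqrt w"] w by (simp add: inverse_eq_divide)
  ultimately have "\<forall>\<^sub>F n in sequentially. sqrt w / 2 < \<bar>v n\<bar> \<and> 2 / real (Suc n) < sqrt w"
    by eventually_elim auto
  then obtain N where N: "\<And>n. N \<le> n \<Longrightarrow> sqrt w / 2 < \<bar>v n\<bar>" "\<And>n. N \<le> n \<Longrightarrow> 2 / real (Suc n) < sqrt w"
    unfolding eventually_sequentially by blast
  have sgn: "0 < v n \<longleftrightarrow> 0 < v N" if "N \<le> n" for n
    using that
  proof (induction n rule: dec_induct)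
    case (step n)
    then show ?case using N(1)[of n] N(1)[of "Suc n"] N(2)[of n] var[of n] w by linarith
  qed simp
  show ?thesis
  proof (cases "0 < v N")
    case True
    then have "\<forall>\<^sub>F n in sequentially. \<bar>v n\<bar> = v n"
      unfolding eventually_sequentially
    proof (intro exI[of _ N] allI impI)
      fix n assume "N \<le> n"
      then show "\<bar>v n\<bar> = v n" using sgn[of n] True by linarith
    qed
    from tendsto_cong[OF this] abs show ?thesis by simp
  next
    case False
    then have "\<forall>\<^sub>F n in sequentially. - \<bar>v n\<bar> = v n"
      unfolding eventually_sequentially
    proof (intro exI[of _ N] allI impI)
      fix n assume "N \<le> n"
      then show "- \<bar>v n\<bar> = v n" using sgn[of n] False by linarith
    qed
    from tendsto_cong[OF this] tendsto_minus[OF abs] show ?thesis by simp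
  qed
qed

lemma summable_const_over_square: "summable (\<lambda>n. C * (1 / (real n + 1))\<^sup>2)"
proof -
  have "summable (\<lambda>n. inverse ((of_nat n :: real) ^ 2))" by (rule inverse_power_summable) simp
  then have "summable (\<lambda>n. inverse ((of_nat (Suc n) :: real) ^ 2))" by (subst summable_Suc_iff)
  then show ?thesis by (intro summable_mult) (simp add: power_divide inverse_eq_divide add.commute)
qed

context two_memory_walk
begin

abbreviation "u n w \<equiv> path_u (hist_list xi n w)"
abbreviation "v n w \<equiv> path_v (hist_list xi n w)"

lemma abs_2p_minus_1: "\<bar>2 * p - 1\<bar> \<le> 1"
  using p01 by linarith

lemma path_moment_bounds: "\<bar>path_mean p l\<bar> \<le> path_sq p l" "path_sq p l \<le> 1"
  using step_moment_bounds[OF path_uv_bounds(2,3) abs_2p_minus_1, of l]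
  by (simp_all add: path_mean_def path_sq_def)

lemma AE_all_hist_list: "AE w in M. \<forall>n. hist_list xi n w \<in> paths n"
  using AE_hist_list by (simp add: AE_all_countable)

lemma uv_increment:
  assumes "\<forall>n. hist_list xi n w \<in> paths n"
  shows "\<bar>u (Suc n) w - u n w\<bar> \<le> 1 / real (Suc n)" "\<bar>v (Suc n) w - v n w\<bar> \<le> 2 / real (Suc n)"
proof -
  define x where "x = next_step (hist_list xi n w) (X w)"
  have h: "hist_list xi (Suc n) w = hist_list xi n w @ [x]" by (simp add: hist_list_Suc x_def)
  have x: "x \<in> {-1, 0, 1}" using assms[rule_format, of "Suc n"] unfolding h by (simp add: paths_Suc)
  have "\<bar>(real_of_int x)\<^sup>2 - u n w\<bar> \<le> 1" using x path_uv_bounds[of "hist_list xi n w"] by auto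
  then show "\<bar>u (Suc n) w - u n w\<bar> \<le> 1 / real (Suc n)"
    unfolding h path_u_snoc[OF x] by (simp add: abs_divide divide_right_mono add.commute)
  have "\<bar>real_of_int x - v n w\<bar> \<le> 2" using x path_v_le_1[of "hist_list xi n w"] by auto
  then show "\<bar>v (Suc n) w - v n w\<bar> \<le> 2 / real (Suc n)"
    unfolding h path_v_snoc[OF x] by (simp add: abs_divide divide_right_mono add.commute)
qed

text \<open>The drift inequality is available only while \<open>good\<close> holds. The functional
  is killed by the indicator \<open>I\<close> once \<open>good\<close> fails at some time from
  \<open>m\<close> on; since \<open>V\<close> is nonnegative, killing only lowers the next mean, so
  the unconditional argument applies. If \<open>good\<close> never fails, the killed and the
  original sequences coincide from \<open>m\<close> on.\<close>

lemma AE_summable_lyapunov: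
  fixes V d :: "int list \<Rightarrow> real" and c :: "nat \<Rightarrow> real"
  assumes m: "2 \<le> m"
    and V: "\<And>n l. m \<le> n \<Longrightarrow> l \<in> paths n \<Longrightarrow> 0 \<le> V l"
    and d: "\<And>n l. m \<le> n \<Longrightarrow> l \<in> paths n \<Longrightarrow> 0 \<le> d l"
    and step: "\<And>n l. m \<le> n \<Longrightarrow> l \<in> paths n \<Longrightarrow> good l \<Longrightarrow>
        tmean (path_sq p l) (path_mean p l) (\<lambda>x. V (l @ [x])) \<le> V l - d l + c n"
    and c: "summable c" "\<And>n. 0 \<le> c n"
  shows "AE w in M. (\<forall>n\<ge>m. good (hist_list xi n w)) \<longrightarrow> summable (\<lambda>n. d (hist_list xi n w))"
proof -
  define I :: "int list \<Rightarrow> real" where "I l = of_bool (\<forall>k\<in>{m..length l}. good (take k l))" for l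
  define Y where "Y n w = V (hist_list xi (n + m) w) * I (hist_list xi (n + m) w)" for n w
  define e where "e n w = d (hist_list xi (n + m) w) * I (hist_list xi (n + m) w)" for n w
  have Yint: "integrable M (Y n)" for n unfolding Y_def by (rule integrable_hist_list[of "\<lambda>l. V l * I l"])
  have eint: "integrable M (e n)" for n unfolding e_def by (rule integrable_hist_list[of "\<lambda>l. d l * I l"])
  have "AE w in M. summable (\<lambda>n. e n w)"
  proof (rule AE_summable_drift[of Y e "\<lambda>n. c (n + m)"])
    show "0 \<le> expectation (Y n)" for n
      by (rule integral_nonneg_AE) (use AE_hist_list[of "n + m"] in eventually_elim, auto simp: Y_def I_def intro: V[of "n + m"])
    show "integrable M (e n)" for n by (rule eint)
    show "AE w in M. 0 \<le> e n w" for n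
      using AE_hist_list[of "n + m"] by eventually_elim (auto simp: e_def I_def intro: d[of "n + m"])
    show "summable (\<lambda>n. c (n + m))" using c(1) by (simp add: summable_iff_shift)
    fix n
    let ?h = "hist_list xi (n + m)"
    have "expectation (Y (Suc n)) = expectation (\<lambda>w. tmean (path_sq p (?h w)) (path_mean p (?h w))
        (\<lambda>x. V (?h w @ [x]) * I (?h w @ [x])))"
      unfolding Y_def add_Suc by (rule expectation_one_step)
    also have "\<dots> \<le> expectation (\<lambda>w. Y n w - e n w + c (n + m))"
    proof (rule integral_mono_AE)
      show "AE w in M. tmean (path_sq p (?h w)) (path_mean p (?h w)) (\<lambda>x. V (?h w @ [x]) * I (?h w @ [x]))
         \<le> Y n w - e n w + c (n + m)"
        using AE_hist_list[of "n + m"]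
      proof eventually_elim
        case (elim w)
        define l where "l = ?h w"
        have l: "l \<in> paths (n + m)" "length l = n + m" using elim by (auto simp: l_def paths_def)
        show ?case
        proof (cases "I l = 1")
          case True
          then have "\<forall>k\<in>{m..length l}. good (take k l)" by (simp add: I_def split: if_splits)
          then have g: "good l" using l by (elim ballE[of _ _ "length l"]) auto
          have "tmean (path_sq p l) (path_mean p l) (\<lambda>x. V (l @ [x]) * I (l @ [x]))
            \<le> tmean (path_sq p l) (path_mean p l) (\<lambda>x. V (l @ [x]))"
          proof (rule tmean_mono[OF path_moment_bounds])
            fix x :: int assume "x \<in> {-1, 0, 1}"
            then have "l @ [x] \<in> paths (Suc (n + m))" using l m by (simp add: paths_Suc)
            then have "0 \<le> V (l @ [x])" using V[of "Suc (n + m)"] by simp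
            then show "V (l @ [x]) * I (l @ [x]) \<le> V (l @ [x])" by (auto simp: I_def)
          qed
          also have "\<dots> \<le> V l - d l + c (n + m)" using step[of "n + m" l] l g by simp
          finally show ?thesis using True by (simp add: Y_def e_def l_def)
        next
          case False
          then have 0: "I l = 0" by (auto simp: I_def split: if_splits)
          then obtain k where "k \<in> {m..length l}" "\<not> good (take k l)" by (auto simp: I_def split: if_splits)
          then have "I (l @ [x]) = 0" for x by (auto simp: I_def intro!: bexI[of _ k])
          then show ?thesis using c(2) 0 by (simp add: Y_def e_def l_def tmean_def)
        qed
      qed
    qed (use Yint eint in \<open>auto intro!: integrable_hist_list[of "\<lambda>l. tmean (path_sq p l) (path_mean p l) (\<lambda>x. V (l @ [x]) * I (l @ [x]))"]\<close>)
    also have "\<dots> = expectation (Y n) - expectation (e n) + c (n + m)"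
      using Yint eint by (simp add: prob_space)
    finally show "expectation (Y (Suc n)) \<le> expectation (Y n) - expectation (e n) + c (n + m)" .
    show "0 \<le> c (n + m)" by (rule c(2))
  qed
  then show ?thesis
  proof eventually_elim
    case (elim w)
    show ?case
    proof
      assume g: "\<forall>n\<ge>m. good (hist_list xi n w)"
      have "I (hist_list xi (n + m) w) = 1" for n using g by (auto simp: I_def take_hist_list)
      then have "summable (\<lambda>n. d (hist_list xi (n + m) w))" using elim by (simp add: e_def)
      then show "summable (\<lambda>n. d (hist_list xi n w))"
        using summable_iff_shift[of "\<lambda>n. d (hist_list xi n w)" m] by simp
    qed
  qed
qed

text \<open>On the event in question \<open>D / (n + 1)\<close> is almost surely summable. As
  \<open>u\<close> and \<open>v\<close> move by at most 1 and 2 times \<open>1 / (n + 1)\<close>, a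
  Lipschitz \<open>D\<close> varies slowly enough for
  \<open>slow_variation_tendsto_0\<close>.\<close>

lemma AE_tendsto_0_lyapunov:
  fixes V :: "int list \<Rightarrow> real" and D :: "real \<Rightarrow> real \<Rightarrow> real" and c :: "nat \<Rightarrow> real"
  assumes m: "2 \<le> m"
    and V: "\<And>n l. m \<le> n \<Longrightarrow> l \<in> paths n \<Longrightarrow> 0 \<le> V l"
    and D: "\<And>u v. 0 \<le> u \<Longrightarrow> 0 \<le> D u v"
    and lip: "\<And>u v u' v'. \<lbrakk>0 \<le> u; u \<le> 1; 0 \<le> u'; u' \<le> 1; \<bar>v\<bar> \<le> 1; \<bar>v'\<bar> \<le> 1\<rbrakk> \<Longrightarrow>
        \<bar>D u' v' - D u v\<bar> \<le> L * (\<bar>u' - u\<bar> + \<bar>v' - v\<bar>)" and L: "0 \<le> L"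
    and step: "\<And>n l. m \<le> n \<Longrightarrow> l \<in> paths n \<Longrightarrow> \<theta> \<le> path_u l \<Longrightarrow>
        tmean (path_sq p l) (path_mean p l) (\<lambda>x. V (l @ [x])) \<le> V l - D (path_u l) (path_v l) / (real n + 1) + c n"
    and c: "summable c" "\<And>n. 0 \<le> c n"
  shows "AE w in M. (\<forall>n\<ge>m. \<theta> \<le> u n w) \<longrightarrow> (\<lambda>n. D (u n w) (v n w)) \<longlonglongrightarrow> 0"
proof -
  have "AE w in M. (\<forall>n\<ge>m. \<theta> \<le> u n w) \<longrightarrow>
     summable (\<lambda>n. D (u n w) (v n w) / (real (length (hist_list xi n w)) + 1))"
  proof (rule AE_summable_lyapunov[of m V "\<lambda>l. D (path_u l) (path_v l) / (real (length l) + 1)" "\<lambda>l. \<theta> \<le> path_u l" c])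
    show "0 \<le> D (path_u l) (path_v l) / (real (length l) + 1)" for l
      using D path_uv_bounds by (intro divide_nonneg_nonneg) auto
    show "tmean (path_sq p l) (path_mean p l) (\<lambda>x. V (l @ [x]))
       \<le> V l - D (path_u l) (path_v l) / (real (length l) + 1) + c n" if "m \<le> n" "l \<in> paths n" "\<theta> \<le> path_u l" for n l
      using step[OF that] that by (simp add: paths_def)
  qed (use m V c in auto)
  then show ?thesis using AE_all_hist_list
  proof eventually_elim
    case (elim w)
    show ?case
    proof
      assume "\<forall>n\<ge>m. \<theta> \<le> u n w"
      with elim have s: "summable (\<lambda>n. D (u n w) (v n w) / real (Suc n))" by (simp add: add.commute)
      show "(\<lambda>n. D (u n w) (v n w)) \<longlonglongrightarrow> 0"
      proof (rule slow_variation_tendsto_0[OF _ _ s])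
        show "0 \<le> D (u n w) (v n w)" for n using D path_uv_bounds by simp
        fix n
        have "\<bar>D (u (Suc n) w) (v (Suc n) w) - D (u n w) (v n w)\<bar>
            \<le> L * (\<bar>u (Suc n) w - u n w\<bar> + \<bar>v (Suc n) w - v n w\<bar>)"
          using path_uv_bounds path_v_le_1 by (intro lip) auto
        also have "\<dots> \<le> L * (1 / real (Suc n) + 2 / real (Suc n))"
          using uv_increment elim(2) L by (intro mult_left_mono add_mono) auto
        also have "\<dots> = (3 * L) / real (Suc n)" by (simp add: field_simps)
        finally show "\<bar>D (u (Suc n) w) (v (Suc n) w) - D (u n w) (v n w)\<bar> \<le> (3 * L) / real (Suc n)" .
      qed
    qed
  qed
qed

section \<open>The walk stays away from u = 0\<close>

lemma AE_push_tendsto_0: "AE w in M. (\<lambda>n. max 0 (1/2 - u n w) * u n w) \<longlonglongrightarrow> 0"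
proof -
  \<comment> \<open>With threshold 0 the condition on \<open>u\<close> always holds, so this limit
    comes without localisation.\<close>
  have "AE w in M. (\<forall>n\<ge>2. 0 \<le> u n w) \<longrightarrow> (\<lambda>n. max 0 (1/2 - u n w) * u n w / 2) \<longlonglongrightarrow> 0"
  proof (rule AE_tendsto_0_lyapunov[of 2 "\<lambda>l. (max 0 (1/2 - path_u l))\<^sup>2" "\<lambda>u v. max 0 (1/2 - u) * u / 2" 1 0
        "\<lambda>n. 1 * (1 / (real n + 1))\<^sup>2", OF _ _ _ _ _ _ summable_const_over_square])
    fix u v u' v' :: real
    assume u: "0 \<le> u" "u \<le> 1" "0 \<le> u'" "u' \<le> 1"
    have "\<bar>max 0 (1/2 - u') * (u' - u) + (max 0 (1/2 - u') - max 0 (1/2 - u)) * u\<bar>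
      \<le> \<bar>max 0 (1/2 - u')\<bar> * \<bar>u' - u\<bar> + \<bar>max 0 (1/2 - u') - max 0 (1/2 - u)\<bar> * \<bar>u\<bar>"
      unfolding abs_mult[symmetric] by (rule abs_triangle_ineq)
    also have "\<dots> \<le> 1 * \<bar>u' - u\<bar> + \<bar>u' - u\<bar> * 1"
      using u by (intro add_mono mult_mono) auto
    finally have "\<bar>(max 0 (1/2 - u') * (u' - u) + (max 0 (1/2 - u') - max 0 (1/2 - u)) * u) / 2\<bar> \<le> \<bar>u' - u\<bar>"
      by simp
    moreover have "max 0 (1/2 - u') * u' / 2 - max 0 (1/2 - u) * u / 2
        = (max 0 (1/2 - u') * (u' - u) + (max 0 (1/2 - u') - max 0 (1/2 - u)) * u) / 2"
      by (simp add: left_diff_distrib right_diff_distrib diff_divide_distrib add_divide_distrib)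
    ultimately have "\<bar>max 0 (1/2 - u') * u' / 2 - max 0 (1/2 - u) * u / 2\<bar> \<le> \<bar>u' - u\<bar>"
      by (simp only:)
    then show "\<bar>max 0 (1/2 - u') * u' / 2 - max 0 (1/2 - u) * u / 2\<bar> \<le> 1 * (\<bar>u' - u\<bar> + \<bar>v' - v\<bar>)"
      unfolding mult_1 using abs_ge_zero[of "v' - v"] by linarith
  next
    fix n l assume n: "2 \<le> n" and l: "l \<in> paths n"
    have len: "length l = n" using l by (simp add: paths_def)
    have q: "path_sq p l = step_sq (2*p-1) (path_u l) (path_v l)" "path_mean p l = step_mean (2*p-1) (path_u l) (path_v l)"
      using n len by (simp_all add: path_sq_def path_mean_def)
    have "tmean (path_sq p l) (path_mean p l) (\<lambda>x. (max 0 (1/2 - path_u (l @ [x])))\<^sup>2)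
      = tmean (path_sq p l) (path_mean p l) (\<lambda>x. (max 0 (1/2 - (path_u l + ((real_of_int x)\<^sup>2 - path_u l) * (1 / (real n + 1)))))\<^sup>2)"
      unfolding tmean_def by (simp add: path_u_snoc len)
    also have "\<dots> \<le> (max 0 (1/2 - path_u l))\<^sup>2 - max 0 (1/2 - path_u l) * path_u l / 2 * (1 / (real n + 1)) + (1 / (real n + 1))\<^sup>2"
      unfolding q using path_uv_bounds abs_2p_minus_1 by (intro drift_away_from_zero) auto
    finally show "tmean (path_sq p l) (path_mean p l) (\<lambda>x. (max 0 (1/2 - path_u (l @ [x])))\<^sup>2)
      \<le> (max 0 (1/2 - path_u l))\<^sup>2 - max 0 (1/2 - path_u l) * path_u l / 2 / (real n + 1) + 1 * (1 / (real n + 1))\<^sup>2"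
      by simp
  qed auto
  then show ?thesis
  proof eventually_elim
    case (elim w)
    then have "(\<lambda>n. max 0 (1/2 - u n w) * u n w / 2) \<longlonglongrightarrow> 0" using path_uv_bounds(1) by blast
    from tendsto_mult_left[OF this, of 2] show ?case by simp
  qed
qed

text \<open>The mean \<open>x\<close> of \<open>1 / u\<close> is mapped in one step to at most
  \<open>(1 - 1 / (3 * n)) * x + 3 / (2 * n)\<close>, whose fixed point is \<open>9/2\<close>. The
  contraction reflects that near \<open>u = 0\<close> a nonzero step has probability about
  \<open>2 * u\<close>, twice the rate that would keep \<open>u\<close> constant.\<close>

lemma expectation_inverse_u: "2 \<le> n \<Longrightarrow> expectation (\<lambda>w. 1 / u n w) \<le> 9/2"
proof (induction n rule: dec_induct)
  case base
  have "expectation (\<lambda>w. 1 / u 2 w) \<le> expectation (\<lambda>w. 1)"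
  proof (rule integral_mono_AE)
    show "AE w in M. 1 / u 2 w \<le> 1"
      using AE_hist_list[of 2]
    proof eventually_elim
      case (elim w)
      then have "2 \<le> count_list (hist_list xi 2 w) 1 + count_list (hist_list xi 2 w) (-1)"
        by (rule paths_count_ge_2) simp
      then have "real 2 \<le> real (count_list (hist_list xi 2 w) 1 + count_list (hist_list xi 2 w) (-1))"
        by (simp only: of_nat_le_iff)
      then have "1 \<le> u 2 w" by (simp add: path_u_def)
      then show ?case by simp
    qed
  qed (use integrable_hist_list[of "\<lambda>l. 1 / path_u l"] in auto)
  then show ?case by (simp add: prob_space)
next
  case (step n)
  let ?h = "hist_list xi n"
  have "expectation (\<lambda>w. 1 / u (Suc n) w) = expectation (\<lambda>w. tmean (path_sq p (?h w)) (path_mean p (?h w)) (\<lambda>x. 1 / path_u (?h w @ [x])))"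
    by (rule expectation_one_step)
  also have "\<dots> \<le> expectation (\<lambda>w. (1 - 1 / (3 * real n)) * (1 / u n w) + 3 / (2 * real n))"
  proof (rule integral_mono_AE)
    show "AE w in M. tmean (path_sq p (?h w)) (path_mean p (?h w)) (\<lambda>x. 1 / path_u (?h w @ [x]))
       \<le> (1 - 1 / (3 * real n)) * (1 / u n w) + 3 / (2 * real n)"
      using AE_hist_list[of n]
    proof eventually_elim
      case (elim w)
      define l where "l = ?h w"
      have len: "length l = n" by (simp add: l_def)
      define N where "N = real (count_list l 1) + real (count_list l (-1))"
      define q where "q = path_sq p l"
      have "2 \<le> count_list l 1 + count_list l (-1)" unfolding l_def using elim step(1) by (rule paths_count_ge_2)
      then have "real 2 \<le> real (count_list l 1 + count_list l (-1))" by (simp only: of_nat_le_iff)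
      then have N: "2 \<le> N" by (simp add: N_def)
      have n: "2 \<le> real n" using step(1) by simp
      have ul: "path_u l = N / real n" by (simp add: path_u_def N_def len)
      have ux: "path_u (l @ [x]) = (N + (if x = 0 then 0 else 1)) / (real n + 1)" if "x \<in> {-1, 0, 1}" for x
        using that by (auto simp: path_u_def N_def len add_ac)
      have q2: "2 * (N / real n) - 3/2 * (N / real n)\<^sup>2 \<le> q"
        using step_moment_bounds(3)[OF path_uv_bounds(2,3)[of l] abs_2p_minus_1] step(1) len
        by (simp add: q_def path_sq_def ul)
      have "tmean q (path_mean p l) (\<lambda>x. 1 / path_u (l @ [x])) = (real n + 1) * (q / (N + 1) + (1 - q) / N)"
      proof -
        have "tmean q m F = F 1 * q + F 0 * (1 - q)" if "F (-1) = F 1" for m F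
          unfolding tmean_def that by (simp add: field_simps)
        then show ?thesis by (simp add: ux distrib_left)
      qed
      also have "\<dots> = (real n + 1) / N * (1 - q / (N + 1))" using N by (simp add: field_simps)
      also have "\<dots> \<le> (real n + 1) / N * (1 - (2 * (N / real n) - 3/2 * (N / real n)\<^sup>2) / (N + 1))"
        using q2 N n by (intro mult_left_mono diff_left_mono divide_right_mono) auto
      also have "\<dots> = real n / N + 1 / N - (real n + 1) / real n * ((2 - 3/2 * (N / real n)) / (N + 1))"
        using N n by (simp add: field_simps power2_eq_square)
      also have "\<dots> \<le> real n / N + 1 / N - 1 * ((2 - 3/2 * (N / real n)) / (N + 1))"
      proof -
        have "N / real n \<le> 1" using path_uv_bounds(2)[of l] by (simp add: ul)
        then have "0 \<le> 2 - 3/2 * (N / real n)" by linarith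
        then show ?thesis using N n by (intro diff_left_mono mult_right_mono divide_nonneg_nonneg) auto
      qed
      also have "\<dots> = real n / N + 1 / N - 2 / (N + 1) + 3/2 * (N / (N + 1)) * (1 / real n)"
        by (simp add: diff_divide_distrib mult.commute)
      \<comment> \<open>\<open>2 / (N + 1) \<ge> 4/3 * (1 / N)\<close> because
        \<open>N \<ge> 2\<close>, which in turn is due to the two nonzero initial steps. What
        remains is \<open>- 1 / (3 * N)\<close>, the source of the contraction.\<close>
      also have "\<dots> \<le> real n / N + 1 / N - 4/3 * (1 / N) + 3/2 * 1 * (1 / real n)"
        using N n by (intro add_mono diff_mono mult_right_mono mult_left_mono) (auto simp: field_simps)
      also have "\<dots> = (1 - 1 / (3 * real n)) * (1 / path_u l) + 3 / (2 * real n)"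
        using N n by (simp add: ul field_simps)
      finally show ?case by (simp add: l_def q_def)
    qed
    show "integrable M (\<lambda>w. tmean (path_sq p (?h w)) (path_mean p (?h w)) (\<lambda>x. 1 / path_u (?h w @ [x])))"
      by (rule integrable_hist_list)
    show "integrable M (\<lambda>w. (1 - 1 / (3 * real n)) * (1 / u n w) + 3 / (2 * real n))"
      by (rule integrable_hist_list[of "\<lambda>l. (1 - 1 / (3 * real n)) * (1 / path_u l) + 3 / (2 * real n)"])
  qed
  also have "\<dots> = (1 - 1 / (3 * real n)) * expectation (\<lambda>w. 1 / u n w) + 3 / (2 * real n)"
  proof -
    have "expectation (\<lambda>w. a * f w + b) = a * expectation f + b" if "integrable M f"
      for a b :: real and f :: "'a \<Rightarrow> real"
      using that by (simp add: prob_space)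
    then show ?thesis using integrable_hist_list[of "\<lambda>l. 1 / path_u l" n] by blast
  qed
  also have "\<dots> \<le> (1 - 1 / (3 * real n)) * (9/2) + 3 / (2 * real n)"
    using step by (intro add_mono mult_left_mono) auto
  also have "\<dots> = 9/2" using step(1) by (simp add: field_simps)
  finally show ?case .
qed

text \<open>By Fatou's lemma the bounded means of \<open>1 / u\<close> make its lower limit almost
  surely finite.\<close>

lemma AE_u_not_tendsto_0: "AE w in M. \<not> (\<lambda>n. u n w) \<longlonglongrightarrow> 0"
proof -
  have bound: "(\<integral>\<^sup>+ w. ennreal (1 / u n w) \<partial>M) \<le> ennreal (9/2)" if "2 \<le> n" for n
    using expectation_inverse_u[OF that] path_uv_bounds(1) integrable_hist_list[of "\<lambda>l. 1 / path_u l" n]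
    by (subst nn_integral_eq_integral) (auto intro: ennreal_leI)
  have "(\<integral>\<^sup>+ w. liminf (\<lambda>n. ennreal (1 / u n w)) \<partial>M) \<le> liminf (\<lambda>n. \<integral>\<^sup>+ w. ennreal (1 / u n w) \<partial>M)"
    by (rule nn_integral_liminf) measurable
  also have "\<dots> \<le> ennreal (9/2)"
  proof (rule Liminf_le)
    show "\<forall>\<^sub>F n in sequentially. (\<integral>\<^sup>+ w. ennreal (1 / u n w) \<partial>M) \<le> ennreal (9/2)"
      using eventually_ge_at_top[of 2] by eventually_elim (rule bound)
  qed simp
  finally have "(\<integral>\<^sup>+ w. liminf (\<lambda>n. ennreal (1 / u n w)) \<partial>M) \<noteq> \<infinity>"
    using ennreal_less_top[of "9/2"] by (auto simp: top_unique)
  then have "AE w in M. liminf (\<lambda>n. ennreal (1 / u n w)) \<noteq> \<infinity>"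
    by (intro nn_integral_PInf_AE) auto
  then show ?thesis using AE_all_hist_list
  proof eventually_elim
    case (elim w)
    show ?case
    proof
      assume lim: "(\<lambda>n. u n w) \<longlonglongrightarrow> 0"
      have pos: "0 < u n w" if "2 \<le> n" for n
        using paths_count_ge_2[OF elim(2)[rule_format] that] that by (auto simp: path_u_def)
      then have "\<forall>\<^sub>F n in sequentially. 0 < u n w" using pos by (intro eventually_sequentiallyI[of 2])
      from filterlim_inverse_at_top[OF lim this]
      have "filterlim (\<lambda>n. 1 / u n w) at_top sequentially" by (simp add: inverse_eq_divide)
      then have "(\<lambda>n. ennreal (1 / u n w)) \<longlonglongrightarrow> top" by (simp add: ennreal_tendsto_top_eq_at_top)
      then have "liminf (\<lambda>n. ennreal (1 / u n w)) = top" by (intro lim_imp_Liminf) auto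
      with elim(1) show False by simp
    qed
  qed
qed

lemma AE_eventually_u_ge: "AE w in M. \<forall>\<^sub>F n in sequentially. 1/3 \<le> u n w"
  using AE_push_tendsto_0 AE_u_not_tendsto_0 AE_all_hist_list
proof eventually_elim
  case (elim w)
  then show ?case using uv_increment(1) path_uv_bounds(1) by (intro eventually_ge_third) auto
qed

text \<open>The time from which \<open>u \<ge> 1/3\<close> holds is random; letting \<open>m\<close>
  run through countably many fixed times covers all cases.\<close>

lemma AE_localize:
  assumes "\<And>m. m \<ge> k \<Longrightarrow> AE w in M. (\<forall>n\<ge>m. 1/3 \<le> u n w) \<longrightarrow> Q w"
  shows "AE w in M. Q w"
proof -
  have "AE w in M. \<forall>m. (\<forall>n\<ge>m + k. 1/3 \<le> u n w) \<longrightarrow> Q w"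
    using assms by (subst AE_all_countable) auto
  with AE_eventually_u_ge show ?thesis
  proof eventually_elim
    case (elim w)
    then obtain m where "\<forall>n\<ge>m. 1/3 \<le> u n w" unfolding eventually_sequentially by blast
    then have "\<forall>n\<ge>m + k. 1/3 \<le> u n w" by simp
    with elim show ?case by blast
  qed
qed

end

section \<open>The limit and its law\<close>

lemma abs_square_diff_le:
  fixes a b B :: real
  assumes "\<bar>a\<bar> \<le> B" "\<bar>b\<bar> \<le> B"
  shows "\<bar>a\<^sup>2 - b\<^sup>2\<bar> \<le> 2 * B * \<bar>a - b\<bar>"
proof -
  have "\<bar>a\<^sup>2 - b\<^sup>2\<bar> = \<bar>a + b\<bar> * \<bar>a - b\<bar>"
    by (simp add: abs_mult[symmetric] power2_eq_square algebra_simps)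
  also have "\<dots> \<le> (2 * B) * \<bar>a - b\<bar>" using assms by (intro mult_right_mono) auto
  finally show ?thesis .
qed

lemma tendsto_of_square_le:
  fixes a f :: "nat \<Rightarrow> real"
  assumes "f \<longlonglongrightarrow> 0" "\<And>n. (a n - A)\<^sup>2 \<le> C * f n"
  shows "a \<longlonglongrightarrow> A"
proof -
  have lim: "(\<lambda>n. C * f n) \<longlonglongrightarrow> 0" using tendsto_mult_left[OF assms(1), of C] by simp
  have "(\<lambda>n. (a n - A)\<^sup>2) \<longlonglongrightarrow> 0"
    by (rule tendsto_sandwich[OF _ _ tendsto_const lim]) (use assms(2) in auto)
  from tendsto_real_sqrt[OF this] have "(\<lambda>n. \<bar>a n - A\<bar>) \<longlonglongrightarrow> 0" by simp
  then show ?thesis by (simp add: tendsto_rabs_zero_iff LIM_zero_cancel)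
qed

definition path_gam :: "int list \<Rightarrow> real \<times> real" where
  "path_gam l = (real (count_list l 1) / real (length l), real (count_list l (-1)) / real (length l))"

lemma path_gam_eq: "path_gam l = ((path_u l + path_v l) / 2, (path_u l - path_v l) / 2)"
  by (simp add: path_gam_def path_u_def path_v_def add_divide_distrib diff_divide_distrib)

lemma Gam_eq_path_gam: "Gam xi n w = path_gam (hist_list xi n w)"
proof -
  have "card {k \<in> {1..n}. stepX xi k w = y} = count_list (hist_list xi n w) y" for y
  proof -
    have "count_list (hist_list xi n w) y = length (filter (\<lambda>k. y = stepX xi k w) [1..<Suc n])"
      by (simp add: hist_list_def count_list_eq_length_filter filter_map comp_def del: upt_Suc)
    also have "\<dots> = card (set (filter (\<lambda>k. y = stepX xi k w) [1..<Suc n]))"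
      by (rule distinct_card[symmetric]) (simp del: upt_Suc)
    also have "set (filter (\<lambda>k. y = stepX xi k w) [1..<Suc n]) = {k \<in> {1..n}. stepX xi k w = y}"
      by auto
    finally show ?thesis by simp
  qed
  then show ?thesis by (simp add: Gam_def path_gam_def)
qed

text \<open>\<open>h_p(x) + x\<close> is the pair of probabilities of the steps 1 and -1, so the
  zeros of \<open>hp\<close> are the rest points of the flow.\<close>

lemma hp_eq_step:
  "fst (hp p (x, y)) + x = (step_sq (2*p-1) (x + y) (x - y) + step_mean (2*p-1) (x + y) (x - y)) / 2"
  "snd (hp p (x, y)) + y = (step_sq (2*p-1) (x + y) (x - y) - step_mean (2*p-1) (x + y) (x - y)) / 2"
  by (simp_all add: hp_def step_sq_def step_mean_def power2_eq_square field_simps)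

lemma step_at_star:
  assumes "3/4 < c" "c < 1" "v\<^sup>2 = v_star_sq c"
  shows "step_sq c (u_star c) v = u_star c" "step_mean c (u_star c) v = v"
proof -
  have "c\<^sup>2 * v\<^sup>2 = u_star c * (3 * u_star c - 2)" using assms by (simp add: v_star_sq_def)
  then show "step_sq c (u_star c) v = u_star c"
    by (simp add: step_sq_def power2_eq_square algebra_simps)
  show "step_mean c (u_star c) v = v" using assms by (simp add: step_mean_def u_star_def)
qed

text \<open>With \<open>c = 2 * p - 1\<close>, the radicand
  \<open>32 * p\<^sup>2 - 52 * p + 21\<close> equals \<open>c ^ 4 * v_star_sq c\<close>; the two
  entries are recovered from their sum \<open>U\<close> and difference \<open>V\<close>.\<close>

lemma gamma_eq_star:
  assumes "7/8 < p" "p < 1"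
  defines "U \<equiv> u_star (2*p-1)" and "V \<equiv> sqrt (v_star_sq (2*p-1))"
  shows "gamma_p p = ((U + V) / 2, (U - V) / 2)" "gamma_bar_p p = ((U - V) / 2, (U + V) / 2)"
proof -
  define c where "c = 2*p-1"
  have c: "c > 0" using assms by (simp add: c_def)
  have p: "p = (c + 1) / 2" by (simp add: c_def)
  have U: "U = (8*p\<^sup>2 - 10*p + 3) / c\<^sup>2"
    using c unfolding U_def u_star_def c_def[symmetric] p by (simp add: field_simps power2_eq_square)
  have "v_star_sq c = (32*p\<^sup>2 - 52*p + 21) / (c\<^sup>2)\<^sup>2"
    using c unfolding v_star_sq_def u_star_def p by (simp add: field_simps power2_eq_square)
  then have V: "V = sqrt (32*p\<^sup>2 - 52*p + 21) / c\<^sup>2"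
    unfolding V_def c_def[symmetric] by (simp only: real_sqrt_divide real_sqrt_abs abs_power2)
  show "gamma_p p = ((U + V) / 2, (U - V) / 2)" "gamma_bar_p p = ((U - V) / 2, (U + V) / 2)"
    unfolding gamma_p_def gamma_bar_p_def Let_def c_def[symmetric] U V
    by (simp_all add: add_divide_distrib diff_divide_distrib)
qed

definition path_err :: "real \<Rightarrow> int list \<Rightarrow> real \<times> real" where
  "path_err p l = (let g = path_gam (butlast l); g' = path_gam l; h = hp p g in
     (real (length l) * (fst g' - fst g) - fst h, real (length l) * (snd g' - snd g) - snd h))"

lemma err_eq_path_err: "err xi p n w = path_err p (hist_list xi (Suc n) w)"
  by (simp add: err_def path_err_def Gam_eq_path_gam hist_list_Suc Let_def)

text \<open>\<open>(n + 1) * (Gamma_{n+1} - Gamma_n)\<close> is the indicator pair of the new step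
  minus \<open>Gamma_n\<close>; subtracting \<open>h_p(Gamma_n)\<close> as well centres the
  indicators at their conditional probabilities.\<close>

lemma path_err_snoc:
  assumes "l \<noteq> []"
  shows "path_err p (l @ [x]) = (of_bool (x = 1) - (fst (hp p (path_gam l)) + fst (path_gam l)),
     of_bool (x = -1) - (snd (hp p (path_gam l)) + snd (path_gam l)))"
proof -
  have "(real (length l) + 1) * ((a + b) / (real (length l) + 1) - a / real (length l)) = b - a / real (length l)"
    for a b :: real using assms by (simp add: right_diff_distrib) (simp add: field_simps)
  from this[of "real (count_list l 1)" "of_bool (x = 1)"] this[of "real (count_list l (-1))" "of_bool (x = -1)"]
  show ?thesis unfolding path_err_def Let_def path_gam_def
    by (auto simp: add.commute of_bool_def split: if_splits)
qed

text \<open>These are the variances and the covariance of the indicators of two disjoint events with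
  probabilities \<open>a\<close> and \<open>b\<close>.\<close>

lemma tmean_path_err:
  fixes p :: real
  assumes l: "2 \<le> length l"
  defines "a \<equiv> fst (hp p (path_gam l)) + fst (path_gam l)" and "b \<equiv> snd (hp p (path_gam l)) + snd (path_gam l)"
  defines "E \<equiv> tmean (path_sq p l) (path_mean p l)"
  shows "E (\<lambda>x. (fst (path_err p (l @ [x])))\<^sup>2) = a - a\<^sup>2"
    and "E (\<lambda>x. fst (path_err p (l @ [x])) * snd (path_err p (l @ [x]))) = - a * b"
    and "E (\<lambda>x. snd (path_err p (l @ [x])) * fst (path_err p (l @ [x]))) = - a * b"
    and "E (\<lambda>x. (snd (path_err p (l @ [x])))\<^sup>2) = b - b\<^sup>2"
proof -
  have ne: "l \<noteq> []" using l by auto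
  have "a = (path_sq p l + path_mean p l) / 2" "b = (path_sq p l - path_mean p l) / 2"
    unfolding a_def b_def path_gam_eq fst_conv snd_conv hp_eq_step using l
    by (simp_all add: path_sq_def path_mean_def field_simps)
  then have q: "path_sq p l = a + b" "path_mean p l = a - b" by simp_all
  show "E (\<lambda>x. (fst (path_err p (l @ [x])))\<^sup>2) = a - a\<^sup>2"
    "E (\<lambda>x. fst (path_err p (l @ [x])) * snd (path_err p (l @ [x]))) = - a * b"
    "E (\<lambda>x. snd (path_err p (l @ [x])) * fst (path_err p (l @ [x]))) = - a * b"
    "E (\<lambda>x. (snd (path_err p (l @ [x])))\<^sup>2) = b - b\<^sup>2"
    unfolding E_def tmean_def q path_err_snoc[OF ne] a_def[symmetric] b_def[symmetric]
    by (simp_all add: power2_eq_square algebra_simps)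
qed

lemma path_uminus:
  "path_u (map uminus l) = path_u l" "path_v (map uminus l) = - path_v l"
proof -
  have c: "count_list (map uminus l) 1 = count_list l (-1)" "count_list (map uminus l) (-1) = count_list l (1::int)"
    by (induction l) (auto simp: minus_equation_iff[of _ 1])
  show "path_u (map uminus l) = path_u l" "path_v (map uminus l) = - path_v l"
    unfolding path_u_def path_v_def c by (simp_all add: add.commute minus_divide_left)
qed

lemma path_moments_uminus:
  "path_sq p (map uminus l) = path_sq p l" "path_mean p (map uminus l) = - path_mean p l"
  by (simp_all add: path_sq_def path_mean_def path_uminus step_sq_def step_mean_def)

section \<open>Almost sure limits of u and v\<close>

context two_memory_walk
begin

lemma AE_subcritical:
  assumes p: "p < 7/8"
  shows "AE w in M. (\<lambda>n. u n w) \<longlonglongrightarrow> 2/3 \<and> (\<lambda>n. v n w) \<longlonglongrightarrow> 0"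
proof -
  have "2 * p - 1 < 3/4" using p by simp
  then obtain k K :: real where k: "0 \<le> k" and K: "0 < K" and drift:
    "\<And>u v h. \<lbrakk>1/3 \<le> u; u \<le> 1; \<bar>v\<bar> \<le> u; 0 \<le> h\<rbrakk> \<Longrightarrow>
       tmean (step_sq (2*p-1) u v) (step_mean (2*p-1) u v)
         (\<lambda>x. (u + ((real_of_int x)\<^sup>2 - u) * h - 2/3)\<^sup>2 + k * (v + (real_of_int x - v) * h)\<^sup>2)
       \<le> (u - 2/3)\<^sup>2 + k * v\<^sup>2 - ((u - 2/3)\<^sup>2 + K * v\<^sup>2) * h + (1 + 4 * k) * h\<^sup>2"
    by (rule drift_subcritical[OF abs_2p_minus_1]) blast
  have "AE w in M. (\<lambda>n. (u n w - 2/3)\<^sup>2 + K * (v n w)\<^sup>2) \<longlonglongrightarrow> 0"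
  proof (rule AE_localize)
    fix m :: nat assume m: "2 \<le> m"
    show "AE w in M. (\<forall>n\<ge>m. 1/3 \<le> u n w) \<longrightarrow> (\<lambda>n. (u n w - 2/3)\<^sup>2 + K * (v n w)\<^sup>2) \<longlonglongrightarrow> 0"
    proof (rule AE_tendsto_0_lyapunov[of m "\<lambda>l. (path_u l - 2/3)\<^sup>2 + k * (path_v l)\<^sup>2" "\<lambda>u v. (u - 2/3)\<^sup>2 + K * v\<^sup>2"
          "2 + 2 * K" "1/3" "\<lambda>n. (1 + 4 * k) * (1 / (real n + 1))\<^sup>2", OF m _ _ _ _ _ summable_const_over_square])
      fix u v u' v' :: real
      assume uv: "0 \<le> u" "u \<le> 1" "0 \<le> u'" "u' \<le> 1" "\<bar>v\<bar> \<le> 1" "\<bar>v'\<bar> \<le> 1"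
      have 1: "\<bar>(u' - 2/3)\<^sup>2 - (u - 2/3)\<^sup>2\<bar> \<le> 2 * \<bar>u' - u\<bar>"
        using abs_square_diff_le[of "u' - 2/3" 1 "u - 2/3"] uv by simp
      have 2: "\<bar>K * (v'\<^sup>2 - v\<^sup>2)\<bar> \<le> K * (2 * \<bar>v' - v\<bar>)"
        using abs_square_diff_le[of v' 1 v] uv K by (simp add: abs_mult)
      have "\<bar>((u' - 2/3)\<^sup>2 + K * v'\<^sup>2) - ((u - 2/3)\<^sup>2 + K * v\<^sup>2)\<bar> = \<bar>((u' - 2/3)\<^sup>2 - (u - 2/3)\<^sup>2) + K * (v'\<^sup>2 - v\<^sup>2)\<bar>"
        by (simp add: algebra_simps)
      also have "\<dots> \<le> 2 * \<bar>u' - u\<bar> + K * (2 * \<bar>v' - v\<bar>)" using 1 2 by linarith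
      also have "\<dots> \<le> (2 + 2 * K) * \<bar>u' - u\<bar> + (2 + 2 * K) * \<bar>v' - v\<bar>"
        using K unfolding mult.assoc[symmetric] by (intro add_mono mult_right_mono) auto
      finally show "\<bar>((u' - 2/3)\<^sup>2 + K * v'\<^sup>2) - ((u - 2/3)\<^sup>2 + K * v\<^sup>2)\<bar> \<le> (2 + 2 * K) * (\<bar>u' - u\<bar> + \<bar>v' - v\<bar>)"
        by (simp add: distrib_left)
    next
      fix n l assume n: "m \<le> n" and l: "l \<in> paths n" and ul: "1/3 \<le> path_u l"
      have len: "length l = n" using l by (simp add: paths_def)
      have q: "path_sq p l = step_sq (2*p-1) (path_u l) (path_v l)" "path_mean p l = step_mean (2*p-1) (path_u l) (path_v l)"
        using n m len by (simp_all add: path_sq_def path_mean_def)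
      have "tmean (path_sq p l) (path_mean p l) (\<lambda>x. (path_u (l @ [x]) - 2/3)\<^sup>2 + k * (path_v (l @ [x]))\<^sup>2)
        = tmean (path_sq p l) (path_mean p l) (\<lambda>x. (path_u l + ((real_of_int x)\<^sup>2 - path_u l) * (1 / (real n + 1)) - 2/3)\<^sup>2
           + k * (path_v l + (real_of_int x - path_v l) * (1 / (real n + 1)))\<^sup>2)"
        unfolding tmean_def by (simp add: path_u_snoc path_v_snoc len)
      also have "\<dots> \<le> (path_u l - 2/3)\<^sup>2 + k * (path_v l)\<^sup>2 - ((path_u l - 2/3)\<^sup>2 + K * (path_v l)\<^sup>2) * (1 / (real n + 1))
          + (1 + 4 * k) * (1 / (real n + 1))\<^sup>2"
        unfolding q using path_uv_bounds ul by (intro drift) auto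
      finally show "tmean (path_sq p l) (path_mean p l) (\<lambda>x. (path_u (l @ [x]) - 2/3)\<^sup>2 + k * (path_v (l @ [x]))\<^sup>2)
        \<le> (path_u l - 2/3)\<^sup>2 + k * (path_v l)\<^sup>2 - ((path_u l - 2/3)\<^sup>2 + K * (path_v l)\<^sup>2) / (real n + 1)
          + (1 + 4 * k) * (1 / (real n + 1))\<^sup>2"
        by simp
    qed (use k K in auto)
  qed
  then show ?thesis
  proof eventually_elim
    case (elim w)
    show ?case
    proof
      show "(\<lambda>n. u n w) \<longlonglongrightarrow> 2/3"
        by (rule tendsto_of_square_le[OF elim, of _ _ 1]) (use K in simp)
      show "(\<lambda>n. v n w) \<longlonglongrightarrow> 0"
        by (rule tendsto_of_square_le[OF elim, of _ _ "1 / K"]) (use K in \<open>simp add: field_simps\<close>)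
    qed
  qed
qed

lemma AE_supercritical:
  assumes p: "7/8 < p"
  defines "U \<equiv> u_star (2*p-1)" and "W \<equiv> v_star_sq (2*p-1)"
  shows "AE w in M. (\<lambda>n. u n w) \<longlonglongrightarrow> U \<and> ((\<lambda>n. v n w) \<longlonglongrightarrow> sqrt W \<or> (\<lambda>n. v n w) \<longlonglongrightarrow> - sqrt W)"
proof -
  have c: "3/4 < 2*p-1" "2*p-1 < 1" using p p01 by simp_all
  note s = star_bounds[OF c, folded U_def W_def]
  have "AE w in M. (\<lambda>n. (u n w - U)\<^sup>2 + 9/64 * ((v n w)\<^sup>2 - W)\<^sup>2) \<longlonglongrightarrow> 0"
  proof (rule AE_localize)
    fix m :: nat assume m: "11 \<le> m"
    have sm: "summable (\<lambda>n. 10^7 / real n powr (3/2))"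
    proof -
      have "summable (\<lambda>n. 10^7 * real n powr (-(3/2)))" by (intro summable_mult) (simp add: summable_real_powr_iff)
      then show ?thesis by (simp only: powr_minus_divide times_divide_eq_right mult_1_right)
    qed
    show "AE w in M. (\<forall>n\<ge>m. 1/3 \<le> u n w) \<longrightarrow> (\<lambda>n. (u n w - U)\<^sup>2 + 9/64 * ((v n w)\<^sup>2 - W)\<^sup>2) \<longlonglongrightarrow> 0"
    proof (rule AE_tendsto_0_lyapunov[of m "\<lambda>l. lyap (2*p-1) (real (length l)) (path_u l) (path_v l)"
          "\<lambda>u v. (u - U)\<^sup>2 + 9/64 * (v\<^sup>2 - W)\<^sup>2" 2 "1/3" "\<lambda>n. 10^7 / real n powr (3/2)", OF _ _ _ _ _ _ sm])
      show "0 \<le> lyap (2*p-1) (real (length l)) (path_u l) (path_v l)" if "m \<le> n" "l \<in> paths n" for n l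
        using that m path_uv_bounds path_v_le_1 c by (intro lyap_nonneg) (auto simp: paths_def)
      fix u v u' v' :: real
      assume uv: "0 \<le> u" "u \<le> 1" "0 \<le> u'" "u' \<le> 1" "\<bar>v\<bar> \<le> 1" "\<bar>v'\<bar> \<le> 1"
      have 1: "\<bar>(u' - U)\<^sup>2 - (u - U)\<^sup>2\<bar> \<le> 2 * \<bar>u' - u\<bar>"
        using abs_square_diff_le[of "u' - U" 1 "u - U"] uv s by simp
      have "v\<^sup>2 \<le> 1" "v'\<^sup>2 \<le> 1" using uv by (simp_all add: abs_square_le_1)
      then have "\<bar>v'\<^sup>2 - W\<bar> \<le> 3" "\<bar>v\<^sup>2 - W\<bar> \<le> 3" using s zero_le_power2[of v] zero_le_power2[of v'] by linarith+
      from abs_square_diff_le[OF this] abs_square_diff_le[of v' 1 v] uv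
      have 2: "\<bar>(v'\<^sup>2 - W)\<^sup>2 - (v\<^sup>2 - W)\<^sup>2\<bar> \<le> 12 * \<bar>v' - v\<bar>" by simp
      have "\<bar>((u' - U)\<^sup>2 + 9/64 * (v'\<^sup>2 - W)\<^sup>2) - ((u - U)\<^sup>2 + 9/64 * (v\<^sup>2 - W)\<^sup>2)\<bar>
        \<le> 2 * \<bar>u' - u\<bar> + 27/16 * \<bar>v' - v\<bar>" using 1 2 by linarith
      also have "\<dots> \<le> 2 * \<bar>u' - u\<bar> + 2 * \<bar>v' - v\<bar>"
        by (intro add_left_mono mult_right_mono) auto
      finally show "\<bar>((u' - U)\<^sup>2 + 9/64 * (v'\<^sup>2 - W)\<^sup>2) - ((u - U)\<^sup>2 + 9/64 * (v\<^sup>2 - W)\<^sup>2)\<bar>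
        \<le> 2 * (\<bar>u' - u\<bar> + \<bar>v' - v\<bar>)" unfolding distrib_left .
    next
      fix n l assume n: "m \<le> n" and l: "l \<in> paths n" and ul: "1/3 \<le> path_u l"
      have len: "length l = n" using l by (simp add: paths_def)
      have q: "path_sq p l = step_sq (2*p-1) (path_u l) (path_v l)" "path_mean p l = step_mean (2*p-1) (path_u l) (path_v l)"
        using n m len by (simp_all add: path_sq_def path_mean_def)
      have "tmean (path_sq p l) (path_mean p l) (\<lambda>x. lyap (2*p-1) (real (length (l @ [x]))) (path_u (l @ [x])) (path_v (l @ [x])))
        = tmean (path_sq p l) (path_mean p l) (\<lambda>x. lyap (2*p-1) (real n + 1)
          (path_u l + ((real_of_int x)\<^sup>2 - path_u l) / (real n + 1)) (path_v l + (real_of_int x - path_v l) / (real n + 1)))"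
        unfolding tmean_def by (simp add: path_u_snoc path_v_snoc len add.commute)
      also have "\<dots> \<le> lyap (2*p-1) (real n) (path_u l) (path_v l)
          - ((path_u l - U)\<^sup>2 + 9/64 * ((path_v l)\<^sup>2 - W)\<^sup>2) / (real n + 1) + 10^7 / real n powr (3/2)"
        unfolding q U_def W_def using path_uv_bounds ul c n m by (intro drift_supercritical) auto
      finally show "tmean (path_sq p l) (path_mean p l) (\<lambda>x. lyap (2*p-1) (real (length (l @ [x]))) (path_u (l @ [x])) (path_v (l @ [x])))
        \<le> lyap (2*p-1) (real (length l)) (path_u l) (path_v l)
          - ((path_u l - U)\<^sup>2 + 9/64 * ((path_v l)\<^sup>2 - W)\<^sup>2) / (real n + 1) + 10^7 / real n powr (3/2)"
        by (simp add: len)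
    qed (use m in auto)
  qed
  then show ?thesis using AE_all_hist_list
  proof eventually_elim
    case (elim w)
    show ?case
    proof
      show "(\<lambda>n. u n w) \<longlonglongrightarrow> U"
        by (rule tendsto_of_square_le[OF elim(1), of _ _ 1]) simp
      have "(\<lambda>n. (v n w)\<^sup>2) \<longlonglongrightarrow> W"
        by (rule tendsto_of_square_le[OF elim(1), of _ _ "64/9"]) simp
      then show "(\<lambda>n. v n w) \<longlonglongrightarrow> sqrt W \<or> (\<lambda>n. v n w) \<longlonglongrightarrow> - sqrt W"
        using s uv_increment(2)[OF elim(2)] by (intro tendsto_sqrt_or_minus) auto
    qed
  qed
qed

text \<open>Under a change of sign \<open>path_sq\<close> is even and \<open>path_mean\<close> is
  odd, so the symmetry passes through \<open>expectation_one_step\<close>. The induction is over all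
  \<open>F\<close>, since each step replaces \<open>F\<close> by its one-step mean.\<close>

lemma expectation_uminus:
  fixes F :: "int list \<Rightarrow> real"
  shows "expectation (\<lambda>w. F (map uminus (hist_list xi n w))) = expectation (\<lambda>w. F (hist_list xi n w))"
proof (induction n arbitrary: F)
  case 0
  have "hist_list xi 0 w = []" for w by (simp add: hist_list_def)
  then show ?case by simp
next
  case (Suc n)
  define F' where "F' l = tmean (path_sq p l) (path_mean p l) (\<lambda>x. F (l @ [x]))" for l
  have "tmean (path_sq p l) (path_mean p l) (\<lambda>x. F (map uminus (l @ [x]))) = F' (map uminus l)" for l
    unfolding F'_def path_moments_uminus by (simp add: tmean_def)
  then have "expectation (\<lambda>w. F (map uminus (hist_list xi (Suc n) w))) = expectation (\<lambda>w. F' (map uminus (hist_list xi n w)))"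
    unfolding expectation_one_step[of "\<lambda>l. F (map uminus l)"] by simp
  also have "\<dots> = expectation (\<lambda>w. F' (hist_list xi n w))" by (rule Suc.IH)
  also have "\<dots> = expectation (\<lambda>w. F (hist_list xi (Suc n) w))"
    unfolding F'_def by (rule expectation_one_step[symmetric])
  finally show ?case .
qed

lemma expectation_v: "expectation (\<lambda>w. v n w) = 0"
  using expectation_uminus[of path_v n] by (simp add: path_uminus)

section \<open>Conditional expectations given the history of Gamma\<close>

lemma sets_filt: "sets (filt M xi n) =
    sigma_sets (space M) {Gam xi k -` A \<inter> space M | k A. k \<in> {1..n} \<and> A \<in> sets (borel :: (real \<times> real) measure)}"
  and space_filt: "space (filt M xi n) = space M"
  unfolding filt_def by (auto intro!: sets_measure_of space_measure_of)

text \<open>The path determines every earlier \<open>Gam xi k\<close> through its prefix of length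
  \<open>k\<close>. The defining identity of a conditional expectation can thus be tested on path
  events.\<close>

lemma sets_filt_imp_hist_list_set:
  assumes "A \<in> sets (filt M xi n)"
  shows "\<exists>B. A = {w \<in> space M. hist_list xi n w \<in> B}"
  using assms unfolding sets_filt
proof (induction rule: sigma_sets.induct)
  case (Basic a)
  then obtain k A where k: "k \<le> n" "a = Gam xi k -` A \<inter> space M" by auto
  have "a = {w \<in> space M. hist_list xi n w \<in> {l. path_gam (take k l) \<in> A}}"
    using k by (auto simp: Gam_eq_path_gam take_hist_list)
  then show ?case by blast
next
  case Empty
  show ?case by (intro exI[of _ "{}"]) simp
next
  case (Compl a)
  then obtain B where "a = {w \<in> space M. hist_list xi n w \<in> B}" by blast
  then show ?case by (intro exI[of _ "- B"]) auto
next
  case (Union a)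
  then obtain B where "\<And>i. a i = {w \<in> space M. hist_list xi n w \<in> B i}" by metis
  then show ?case by (intro exI[of _ "\<Union>i. B i"]) auto
qed

lemma Gam_measurable: "Gam xi n \<in> borel_measurable M"
proof -
  have "(\<lambda>w. path_gam (hist_list xi n w)) \<in> borel_measurable M" by (rule borel_measurable_hist_list)
  then show ?thesis by (simp add: Gam_eq_path_gam[abs_def])
qed

text \<open>\<open>filt\<close> is generated by \<open>Gam\<close> and may be coarser than the
  history of the path. A one-step mean that depends on the path only through \<open>Gam xi n\<close>
  is nevertheless the conditional expectation given \<open>filt\<close>.\<close>

lemma cond_exp_next:
  fixes H :: "int list \<Rightarrow> real" and K :: "real \<times> real \<Rightarrow> real"
  assumes n: "2 \<le> n" and K: "K \<in> borel_measurable borel"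
    and HK: "\<And>l. length l = n \<Longrightarrow> tmean (path_sq p l) (path_mean p l) (\<lambda>x. H (l @ [x])) = K (path_gam l)"
  shows "AE w in M. real_cond_exp M (filt M xi n) (\<lambda>w. H (hist_list xi (Suc n) w)) w = K (Gam xi n w)"
proof -
  have sub: "subalgebra M (filt M xi n)"
    unfolding subalgebra_def space_filt
  proof
    show "sets (filt M xi n) \<subseteq> sets M"
      using sets_filt_imp_hist_list_set hist_list_set_measurable[of "\<lambda>l. l \<in> B" n for B] by blast
  qed simp
  interpret finite_measure_subalgebra M "filt M xi n" by unfold_locales (rule sub)
  have KG: "K (Gam xi n w) = tmean (path_sq p (hist_list xi n w)) (path_mean p (hist_list xi n w)) (\<lambda>x. H (hist_list xi n w @ [x]))" for w
    by (simp add: HK Gam_eq_path_gam)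
  show ?thesis
  proof (rule real_cond_exp_charact)
    fix A assume "A \<in> sets (filt M xi n)"
    then obtain B where A: "A = {w \<in> space M. hist_list xi n w \<in> B}" using sets_filt_imp_hist_list_set by blast
    \<comment> \<open>\<open>butlast\<close> recovers the path at time \<open>n\<close>, so the test
      set becomes part of the integrand of \<open>expectation_one_step\<close>.\<close>
    define F where "F l = indicator B (butlast l) * H l" for l
    have "(\<integral>w\<in>A. H (hist_list xi (Suc n) w) \<partial>M) = expectation (\<lambda>w. F (hist_list xi (Suc n) w))"
      unfolding set_lebesgue_integral_def A
      by (intro Bochner_Integration.integral_cong) (auto simp: F_def hist_list_Suc indicator_def)
    also have "\<dots> = expectation (\<lambda>w. tmean (path_sq p (hist_list xi n w)) (path_mean p (hist_list xi n w)) (\<lambda>x. F (hist_list xi n w @ [x])))"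
      by (rule expectation_one_step)
    also have "\<dots> = (\<integral>w\<in>A. K (Gam xi n w) \<partial>M)"
      unfolding set_lebesgue_integral_def A KG
      by (intro Bochner_Integration.integral_cong) (auto simp: F_def indicator_def tmean_def)
    finally show "(\<integral>w\<in>A. H (hist_list xi (Suc n) w) \<partial>M) = (\<integral>w\<in>A. K (Gam xi n w) \<partial>M)" .
  next
    show "integrable M (\<lambda>w. H (hist_list xi (Suc n) w))" by (rule integrable_hist_list)
    show "integrable M (\<lambda>w. K (Gam xi n w))" unfolding Gam_eq_path_gam by (rule integrable_hist_list)
    have "Gam xi n \<in> measurable (filt M xi n) borel"
    proof (rule measurableI)
      fix A :: "(real \<times> real) set" assume "A \<in> sets borel"
      then show "Gam xi n -` A \<inter> space (filt M xi n) \<in> sets (filt M xi n)"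
        unfolding space_filt sets_filt using n
        by (intro sigma_sets.Basic CollectI exI[of _ n] exI[of _ A]) simp
    qed simp
    then show "(\<lambda>w. K (Gam xi n w)) \<in> borel_measurable (filt M xi n)"
      using K by (rule measurable_compose)
  qed
qed

lemma AE_cond_exp_err:
  defines "a \<equiv> \<lambda>g. fst (hp p g) + fst g" and "b \<equiv> \<lambda>g. snd (hp p g) + snd g"
  shows "AE w in M. \<forall>n\<ge>2.
      real_cond_exp M (filt M xi n) (\<lambda>v. (fst (err xi p n v))\<^sup>2) w = a (Gam xi n w) - (a (Gam xi n w))\<^sup>2
    \<and> real_cond_exp M (filt M xi n) (\<lambda>v. fst (err xi p n v) * snd (err xi p n v)) w = - a (Gam xi n w) * b (Gam xi n w)
    \<and> real_cond_exp M (filt M xi n) (\<lambda>v. snd (err xi p n v) * fst (err xi p n v)) w = - a (Gam xi n w) * b (Gam xi n w)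
    \<and> real_cond_exp M (filt M xi n) (\<lambda>v. (snd (err xi p n v))\<^sup>2) w = b (Gam xi n w) - (b (Gam xi n w))\<^sup>2"
proof -
  have ab: "a \<in> borel_measurable borel" "b \<in> borel_measurable borel"
    unfolding a_def b_def hp_def fst_conv snd_conv
    by (intro borel_measurable_continuous_onI continuous_intros)+
  have m: "(\<lambda>g. a g - (a g)\<^sup>2) \<in> borel_measurable borel" "(\<lambda>g. - a g * b g) \<in> borel_measurable borel"
    "(\<lambda>g. b g - (b g)\<^sup>2) \<in> borel_measurable borel"
    using ab by measurable
  show ?thesis
    unfolding AE_all_countable err_eq_path_err
  proof (intro allI)
    fix n :: nat
    show "AE w in M. 2 \<le> n \<longrightarrow>
      real_cond_exp M (filt M xi n) (\<lambda>v. (fst (path_err p (hist_list xi (Suc n) v)))\<^sup>2) w = a (Gam xi n w) - (a (Gam xi n w))\<^sup>2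
    \<and> real_cond_exp M (filt M xi n) (\<lambda>v. fst (path_err p (hist_list xi (Suc n) v)) * snd (path_err p (hist_list xi (Suc n) v))) w = - a (Gam xi n w) * b (Gam xi n w)
    \<and> real_cond_exp M (filt M xi n) (\<lambda>v. snd (path_err p (hist_list xi (Suc n) v)) * fst (path_err p (hist_list xi (Suc n) v))) w = - a (Gam xi n w) * b (Gam xi n w)
    \<and> real_cond_exp M (filt M xi n) (\<lambda>v. (snd (path_err p (hist_list xi (Suc n) v)))\<^sup>2) w = b (Gam xi n w) - (b (Gam xi n w))\<^sup>2"
    proof (cases "2 \<le> n")
      case True
      have "AE w in M. real_cond_exp M (filt M xi n) (\<lambda>v. (fst (path_err p (hist_list xi (Suc n) v)))\<^sup>2) w = a (Gam xi n w) - (a (Gam xi n w))\<^sup>2"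
        by (rule cond_exp_next[OF True, of "\<lambda>g. a g - (a g)\<^sup>2" "\<lambda>l. (fst (path_err p l))\<^sup>2"])
          (use m True in \<open>auto simp only: tmean_path_err a_def b_def\<close>)
      moreover have "AE w in M. real_cond_exp M (filt M xi n) (\<lambda>v. fst (path_err p (hist_list xi (Suc n) v)) * snd (path_err p (hist_list xi (Suc n) v))) w = - a (Gam xi n w) * b (Gam xi n w)"
        by (rule cond_exp_next[OF True, of "\<lambda>g. - a g * b g" "\<lambda>l. fst (path_err p l) * snd (path_err p l)"])
          (use m True in \<open>auto simp only: tmean_path_err a_def b_def\<close>)
      moreover have "AE w in M. real_cond_exp M (filt M xi n) (\<lambda>v. snd (path_err p (hist_list xi (Suc n) v)) * fst (path_err p (hist_list xi (Suc n) v))) w = - a (Gam xi n w) * b (Gam xi n w)"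
        by (rule cond_exp_next[OF True, of "\<lambda>g. - a g * b g" "\<lambda>l. snd (path_err p l) * fst (path_err p l)"])
          (use m True in \<open>auto simp only: tmean_path_err a_def b_def\<close>)
      moreover have "AE w in M. real_cond_exp M (filt M xi n) (\<lambda>v. (snd (path_err p (hist_list xi (Suc n) v)))\<^sup>2) w = b (Gam xi n w) - (b (Gam xi n w))\<^sup>2"
        by (rule cond_exp_next[OF True, of "\<lambda>g. b g - (b g)\<^sup>2" "\<lambda>l. (snd (path_err p l))\<^sup>2"])
          (use m True in \<open>auto simp only: tmean_path_err a_def b_def\<close>)
      ultimately show ?thesis by eventually_elim blast
    qed simp
  qed
qed

text \<open>At a zero of \<open>hp\<close> the conditional probabilities of the steps 1 and -1 equal
  the coordinates of the limit, so by continuity the explicit second moments tend to the entries of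
  the matrix.\<close>

lemma cond_exp_err_tendsto:
  assumes G: "AE w in M. (\<lambda>n. Gam xi n w) \<longlonglongrightarrow> G w" "AE w in M. hp p (G w) = (0, 0)"
  shows "AE w in M.
      (\<lambda>n. real_cond_exp M (filt M xi n) (\<lambda>v. (fst (err xi p n v))\<^sup>2) w) \<longlonglongrightarrow> sig11 (G w)
    \<and> (\<lambda>n. real_cond_exp M (filt M xi n) (\<lambda>v. fst (err xi p n v) * snd (err xi p n v)) w) \<longlonglongrightarrow> sig12 (G w)
    \<and> (\<lambda>n. real_cond_exp M (filt M xi n) (\<lambda>v. snd (err xi p n v) * fst (err xi p n v)) w) \<longlonglongrightarrow> sig12 (G w)
    \<and> (\<lambda>n. real_cond_exp M (filt M xi n) (\<lambda>v. (snd (err xi p n v))\<^sup>2) w) \<longlonglongrightarrow> sig22 (G w)"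
  using G AE_cond_exp_err
proof eventually_elim
  case (elim w)
  define a where "a = (\<lambda>g. fst (hp p g) + fst g)"
  define b where "b = (\<lambda>g. snd (hp p g) + snd g)"
  have a: "(\<lambda>n. a (Gam xi n w)) \<longlonglongrightarrow> fst (G w)"
  proof -
    have "(\<lambda>n. a (Gam xi n w)) \<longlonglongrightarrow> a (G w)"
      unfolding a_def hp_def fst_conv by (intro tendsto_intros elim(1))
    then show ?thesis using elim(2) by (simp add: a_def)
  qed
  have b: "(\<lambda>n. b (Gam xi n w)) \<longlonglongrightarrow> snd (G w)"
  proof -
    have "(\<lambda>n. b (Gam xi n w)) \<longlonglongrightarrow> b (G w)"
      unfolding b_def hp_def snd_conv by (intro tendsto_intros elim(1))
    then show ?thesis using elim(2) by (simp add: b_def)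
  qed
  have eq: "f \<longlonglongrightarrow> y" if "g \<longlonglongrightarrow> y" "\<And>n. 2 \<le> n \<Longrightarrow> f n = g n" for f g :: "nat \<Rightarrow> real" and y
    using that Lim_transform_eventually[of g y sequentially f] eventually_sequentiallyI[of 2 "\<lambda>n. g n = f n"]
    by simp
  show ?case
    unfolding sig11_def sig12_def sig22_def
  proof (intro conjI)
    show "(\<lambda>n. real_cond_exp M (filt M xi n) (\<lambda>v. (fst (err xi p n v))\<^sup>2) w) \<longlonglongrightarrow> fst (G w) - (fst (G w))\<^sup>2"
      by (rule eq[of "\<lambda>n. a (Gam xi n w) - (a (Gam xi n w))\<^sup>2"], intro tendsto_intros a)
        (use elim(3) in \<open>simp add: a_def\<close>)
    show "(\<lambda>n. real_cond_exp M (filt M xi n) (\<lambda>v. fst (err xi p n v) * snd (err xi p n v)) w) \<longlonglongrightarrow> - fst (G w) * snd (G w)"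
      "(\<lambda>n. real_cond_exp M (filt M xi n) (\<lambda>v. snd (err xi p n v) * fst (err xi p n v)) w) \<longlonglongrightarrow> - fst (G w) * snd (G w)"
      by (rule eq[of "\<lambda>n. - a (Gam xi n w) * b (Gam xi n w)"], intro tendsto_intros a b,
        use elim(3) in \<open>simp add: a_def b_def\<close>)+
    show "(\<lambda>n. real_cond_exp M (filt M xi n) (\<lambda>v. (snd (err xi p n v))\<^sup>2) w) \<longlonglongrightarrow> snd (G w) - (snd (G w))\<^sup>2"
      by (rule eq[of "\<lambda>n. b (Gam xi n w) - (b (Gam xi n w))\<^sup>2"], intro tendsto_intros b)
        (use elim(3) in \<open>simp add: b_def\<close>)
  qed
qed

section \<open>The limit variable and its law\<close>

lemma Gam_uv: "Gam xi n w = ((u n w + v n w) / 2, (u n w - v n w) / 2)"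
  by (simp add: Gam_eq_path_gam path_gam_eq)

text \<open>\<open>lim\<close> is total, which gives a measurable function on the whole space; where
  \<open>Gam\<close> diverges its value is arbitrary, and this happens only on a null set.\<close>

definition "Gam_lim w = lim (\<lambda>n. Gam xi n w)"

lemma Gam_lim_measurable [measurable]: "Gam_lim \<in> borel_measurable M"
  unfolding Gam_lim_def[abs_def] by (intro borel_measurable_lim_metric Gam_measurable)

lemma Gam_tendsto:
  assumes "(\<lambda>n. u n w) \<longlonglongrightarrow> a" "(\<lambda>n. v n w) \<longlonglongrightarrow> b"
  shows "(\<lambda>n. Gam xi n w) \<longlonglongrightarrow> ((a + b) / 2, (a - b) / 2)" "Gam_lim w = ((a + b) / 2, (a - b) / 2)"
proof -
  show "(\<lambda>n. Gam xi n w) \<longlonglongrightarrow> ((a + b) / 2, (a - b) / 2)"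
    unfolding Gam_uv using assms by (intro tendsto_intros) auto
  then show "Gam_lim w = ((a + b) / 2, (a - b) / 2)" unfolding Gam_lim_def by (rule limI)
qed

lemma subcritical_limit:
  assumes p: "p < 7/8"
  shows "AE w in M. (\<lambda>n. Gam xi n w) \<longlonglongrightarrow> Gam_lim w" "AE w in M. Gam_lim w = (1/3, 1/3)"
    "AE w in M. hp p (Gam_lim w) = (0, 0)"
proof -
  have "AE w in M. (\<lambda>n. Gam xi n w) \<longlonglongrightarrow> Gam_lim w \<and> Gam_lim w = (1/3, 1/3)"
    using AE_subcritical[OF p]
  proof eventually_elim
    case (elim w)
    with Gam_tendsto[of w "2/3" 0] show ?case by simp
  qed
  moreover have "hp p (1/3, 1/3) = (0, 0)" by (simp add: hp_def power2_eq_square field_simps)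
  ultimately show "AE w in M. (\<lambda>n. Gam xi n w) \<longlonglongrightarrow> Gam_lim w" "AE w in M. Gam_lim w = (1/3, 1/3)"
    "AE w in M. hp p (Gam_lim w) = (0, 0)" by auto
qed

text \<open>The law follows from the vanishing mean of \<open>v n\<close>: by dominated convergence
  the limit of \<open>v\<close>, which is \<open>sqrt W\<close> or \<open>- sqrt W\<close>, also has
  mean 0, so the two values are equally likely. This is what places both points in the
  support.\<close>

lemma supercritical_limit:
  assumes p: "7/8 < p"
  shows "AE w in M. (\<lambda>n. Gam xi n w) \<longlonglongrightarrow> Gam_lim w" "AE w in M. Gam_lim w \<in> {gamma_p p, gamma_bar_p p}"
    "AE w in M. hp p (Gam_lim w) = (0, 0)"
    "prob {w \<in> space M. Gam_lim w = gamma_p p} = 1/2" "prob {w \<in> space M. Gam_lim w = gamma_bar_p p} = 1/2"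
proof -
  define U where "U = u_star (2*p-1)"
  define W where "W = v_star_sq (2*p-1)"
  have c: "3/4 < 2*p-1" "2*p-1 < 1" using p p01 by simp_all
  note s = star_bounds[OF c, folded U_def W_def]
  note \<gamma> = gamma_eq_star[OF p p01(2), folded U_def W_def]
  have lim: "AE w in M. (\<lambda>n. Gam xi n w) \<longlonglongrightarrow> Gam_lim w \<and> Gam_lim w \<in> {gamma_p p, gamma_bar_p p}"
    using AE_supercritical[OF p]
  proof eventually_elim
    case (elim w)
    with Gam_tendsto[of w U "sqrt W"] Gam_tendsto[of w U "- sqrt W"] show ?case
      unfolding \<gamma> U_def[symmetric] W_def[symmetric] by auto
  qed
  then show lim1: "AE w in M. (\<lambda>n. Gam xi n w) \<longlonglongrightarrow> Gam_lim w"
    and lim2: "AE w in M. Gam_lim w \<in> {gamma_p p, gamma_bar_p p}" by auto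
  have "hp p ((U + y) / 2, (U - y) / 2) = (0, 0)" if y: "y\<^sup>2 = W" for y
  proof -
    have "step_sq (2*p-1) U y = U" "step_mean (2*p-1) U y = y"
      unfolding U_def using step_at_star[OF c] y by (auto simp: W_def)
    moreover have "(U + y) / 2 + (U - y) / 2 = U" "(U + y) / 2 - (U - y) / 2 = y" by (simp_all add: field_simps)
    ultimately have "fst (hp p ((U + y) / 2, (U - y) / 2)) + (U + y) / 2 = (U + y) / 2"
      "snd (hp p ((U + y) / 2, (U - y) / 2)) + (U - y) / 2 = (U - y) / 2"
      using hp_eq_step[of p "(U + y) / 2" "(U - y) / 2"] by (simp_all only:)
    then have "fst (hp p ((U + y) / 2, (U - y) / 2)) = 0" "snd (hp p ((U + y) / 2, (U - y) / 2)) = 0"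
      by (simp_all only: add_cancel_left_left)
    then show ?thesis by (simp add: prod_eq_iff)
  qed
  from this[of "sqrt W"] this[of "- sqrt W"] s
  have "hp p (gamma_p p) = (0, 0)" "hp p (gamma_bar_p p) = (0, 0)" unfolding \<gamma> by simp_all
  with lim2 show "AE w in M. hp p (Gam_lim w) = (0, 0)" by (auto elim!: AE_mp)
  define A where "A = {w \<in> space M. Gam_lim w = gamma_p p}"
  define B where "B = {w \<in> space M. Gam_lim w = gamma_bar_p p}"
  have [measurable]: "A \<in> events" "B \<in> events" unfolding A_def B_def by measurable
  have ne: "gamma_p p \<noteq> gamma_bar_p p" using s unfolding \<gamma> by (simp add: field_simps)
  have "(\<lambda>n. expectation (v n)) \<longlonglongrightarrow> expectation (\<lambda>w. sqrt W * indicator A w - sqrt W * indicator B w)"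
  proof (rule integral_dominated_convergence[where w = "\<lambda>_. 1"])
    show "AE w in M. (\<lambda>n. v n w) \<longlonglongrightarrow> sqrt W * indicator A w - sqrt W * indicator B w"
      using lim AE_space
    proof eventually_elim
      case (elim w)
      have "(\<lambda>n. fst (Gam xi n w) - snd (Gam xi n w)) \<longlonglongrightarrow> fst (Gam_lim w) - snd (Gam_lim w)"
        using elim by (intro tendsto_intros) auto
      moreover have "fst (Gam xi n w) - snd (Gam xi n w) = v n w" for n by (simp add: Gam_uv field_simps)
      moreover have "fst (Gam_lim w) - snd (Gam_lim w) = sqrt W * indicator A w - sqrt W * indicator B w"
      proof (cases "Gam_lim w = gamma_p p")
        case True
        then have "w \<in> A" "w \<notin> B" using elim ne by (auto simp: A_def B_def)
        then show ?thesis using True by (simp add: \<gamma> field_simps)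
      next
        case False
        then have "w \<notin> A" "w \<in> B" "Gam_lim w = gamma_bar_p p" using elim by (auto simp: A_def B_def)
        then show ?thesis by (simp add: \<gamma> field_simps)
      qed
      ultimately show ?case by simp
    qed
    show "AE w in M. norm (v n w) \<le> 1" for n using path_v_le_1 by simp
  qed auto
  then have "expectation (\<lambda>w. sqrt W * indicator A w - sqrt W * indicator B w) = 0"
    unfolding expectation_v by (simp add: LIMSEQ_const_iff)
  then have "sqrt W * prob A - sqrt W * prob B = 0"
    by (subst (asm) Bochner_Integration.integral_diff)
      (simp_all only: expectation_scaled_indicator integrable_scaled_indicator \<open>A \<in> events\<close> \<open>B \<in> events\<close>)
  then have AB: "prob A = prob B" using s by simp
  have "prob (A \<union> B) = prob (space M)"
    by (rule finite_measure_eq_AE) (use lim2 in \<open>auto simp: A_def B_def elim!: AE_mp\<close>)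
  moreover have "prob (A \<union> B) = prob A + prob B"
    by (rule finite_measure_Union) (use ne in \<open>auto simp: A_def B_def\<close>)
  ultimately have "prob A + prob B = 1" by (simp add: prob_space)
  with AB show "prob {w \<in> space M. Gam_lim w = gamma_p p} = 1/2" "prob {w \<in> space M. Gam_lim w = gamma_bar_p p} = 1/2"
    unfolding A_def[symmetric] B_def[symmetric] by linarith+
qed

end

theorem theorem4p2:
  fixes M :: "'a measure" and xi :: "src \<Rightarrow> 'a \<Rightarrow> int" and p :: real
  assumes P: "prob_space M"
    and p01: "0 < p" "p < 1" and p_ne: "p \<noteq> 7/8"
    and indep: "prob_space.indep_vars M (\<lambda>_. count_space UNIV) xi used_src"
    and dist_init: "\<And>k. k \<in> {1, 2} \<Longrightarrow>
           distr M (count_space UNIV) (xi (Init k)) = measure_pmf (rad (1/2))"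
    and dist_U1: "\<And>n. n \<ge> 2 \<Longrightarrow>
           distr M (count_space UNIV) (xi (Unif1 (Suc n))) = measure_pmf (pmf_of_set {1..int n})"
    and dist_U2: "\<And>n. n \<ge> 2 \<Longrightarrow>
           distr M (count_space UNIV) (xi (Unif2 (Suc n))) = measure_pmf (pmf_of_set {1..int n})"
    and dist_A1: "\<And>n. n \<ge> 2 \<Longrightarrow>
           distr M (count_space UNIV) (xi (Alpha1 (Suc n))) = measure_pmf (rad p)"
    and dist_A2: "\<And>n. n \<ge> 2 \<Longrightarrow>
           distr M (count_space UNIV) (xi (Alpha2 (Suc n))) = measure_pmf (rad p)"
  shows "\<exists>G :: 'a \<Rightarrow> real \<times> real.
           G \<in> borel_measurable M
         \<and> (AE w in M. (\<lambda>n. Gam xi n w) \<longlonglongrightarrow> G w)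
         \<and> (p < 7/8 \<longrightarrow> (AE w in M. G w = (1/3, 1/3)))
         \<and> (p > 7/8 \<longrightarrow> (AE w in M. G w \<in> {gamma_p p, gamma_bar_p p})
                        \<and> measure M {w \<in> space M. G w = gamma_p p} > 0
                        \<and> measure M {w \<in> space M. G w = gamma_bar_p p} > 0)
         \<and> (\<forall>\<gamma>. measure M {w \<in> space M. G w = \<gamma>} > 0 \<longrightarrow>
              (AE w in M. G w = \<gamma> \<longrightarrow>
                 (\<lambda>n. real_cond_exp M (filt M xi n) (\<lambda>v. (fst (err xi p n v))^2) w)
                    \<longlonglongrightarrow> sig11 \<gamma>
               \<and> (\<lambda>n. real_cond_exp M (filt M xi n) (\<lambda>v. fst (err xi p n v) * snd (err xi p n v)) w)
                    \<longlonglongrightarrow> sig12 \<gamma>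
               \<and> (\<lambda>n. real_cond_exp M (filt M xi n) (\<lambda>v. snd (err xi p n v) * fst (err xi p n v)) w)
                    \<longlonglongrightarrow> sig12 \<gamma>
               \<and> (\<lambda>n. real_cond_exp M (filt M xi n) (\<lambda>v. (snd (err xi p n v))^2) w)
                    \<longlonglongrightarrow> sig22 \<gamma>))"
proof -
  interpret two_memory_walk M xi p
    using P p01 indep dist_init dist_U1 dist_U2 dist_A1 dist_A2
    by (intro two_memory_walk.intro two_memory_walk_axioms.intro) auto
  have lim: "AE w in M. (\<lambda>n. Gam xi n w) \<longlonglongrightarrow> Gam_lim w" "AE w in M. hp p (Gam_lim w) = (0, 0)"
    using subcritical_limit supercritical_limit p_ne by (cases "p < 7/8"; force)+
  show ?thesis
  proof (intro exI[of _ Gam_lim] conjI impI allI)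
    show "measure M {w \<in> space M. Gam_lim w = gamma_p p} > 0" "measure M {w \<in> space M. Gam_lim w = gamma_bar_p p} > 0"
      if "p > 7/8" using supercritical_limit[OF that] by simp_all
  next
    fix \<gamma> assume "measure M {w \<in> space M. Gam_lim w = \<gamma>} > 0"
    show "AE w in M. Gam_lim w = \<gamma> \<longrightarrow>
                 (\<lambda>n. real_cond_exp M (filt M xi n) (\<lambda>v. (fst (err xi p n v))^2) w)
                    \<longlonglongrightarrow> sig11 \<gamma>
               \<and> (\<lambda>n. real_cond_exp M (filt M xi n) (\<lambda>v. fst (err xi p n v) * snd (err xi p n v)) w)
                    \<longlonglongrightarrow> sig12 \<gamma>
               \<and> (\<lambda>n. real_cond_exp M (filt M xi n) (\<lambda>v. snd (err xi p n v) * fst (err xi p n v)) w)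
                    \<longlonglongrightarrow> sig12 \<gamma>
               \<and> (\<lambda>n. real_cond_exp M (filt M xi n) (\<lambda>v. (snd (err xi p n v))^2) w)
                    \<longlonglongrightarrow> sig22 \<gamma>"
      using cond_exp_err_tendsto[OF lim] by eventually_elim blast
  qed (use lim subcritical_limit(2) supercritical_limit(2) in \<open>auto simp: Gam_lim_measurable\<close>)
qed

end
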